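(* Let $(-A,B,C)$ be a $(2,2)$-admissible linear system with input and output spaces $\mathbf{C}$, and let $\phi(x)=Ce^{-xA}B$. Let $\tau_\infty(x;\mu)=\det(I+\mu R_x)$ and $\tau_0(x;\mu)=\det(I-\mu R_x)$, where $R_x=\int_x^\infty e^{-tA}BCe^{-tA}\,dt$. (i) Then there exists $\delta>0$ such that for all $\mu\in\mathbf{C}$ such that $|\mu|<\delta$, the Gelfand--Levitan integral equation $$T(x,y)+\Phi(x+y)+\mu\int_x^\infty T(x,z)\Phi(z+y)\,dz=0\qquad(0<x<y)$$ with $$T(x,y)=\begin{pmatrix}W(x,y)&V(x,y)\\ V(x,y)&W(x,y)\end{pmatrix},\qquad\Phi(x+y)=\begin{pmatrix}0&\phi(x+y)\\ \phi(x+y)&0\end{pmatrix}$$ has a solution such that $$W(x,x)=\frac{d}{dx}\frac1{2\mu}\log\big(\tau_\infty(x;\mu)\tau_0(x;\mu)\big),\qquad V(x,x)=\frac{d}{dx}\frac1{2\mu}\log\frac{\tau_\infty(x;\mu)}{\tau_0(x;\mu)},$$ and $$\frac1{2\mu}\frac{d}{dx}W(x,x)=-V(x,x)^2.$$ (ii) Also Toda's equation holds in the form $$\tau_0''\tau_\infty-2\tau_0'\tau_\infty'+\tau_0\tau_\infty''=0,$$ where primes denote $d/dx$.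
   Context: $H$ is a complex separable Hilbert space (state space). In a linear system $(-A,B,C)$ with input/output space $H_0$, $-A$ generates a strongly continuous semigroup $(e^{-tA})_{t\ge0}$ on $H$ with $\sup_{t\ge 0}\|e^{-tA}\|<\infty$, and $B:H_0\to H$, $C:H\to H_0$ are bounded. It is $(2,2)$-admissible if $\Theta_0f=\int_0^\infty e^{-sA^\dagger}C^\dagger f(s)\,ds$ and $\Xi_0f=\int_0^\infty e^{-sA}Bf(s)\,ds$ define Hilbert--Schmidt operators $L^2((0,\infty);H_0)\to H$; then $R_x$ is trace class. Determinants are Fredholm determinants.
   Formalization: In (ii) the second derivatives of the tau functions need not exist at every x, so Toda's equation is proved at each x>0 where both first derivatives are differentiable, and on (0,∞) in the sense of distributions; in (i) the formulas with 1/(2μ) are for μ≠0. *)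

theory Defs
  imports "HOL-Analysis.Analysis" "HOL-Combinatorics.Permutations"
begin

section \<open>Complex Hilbert spaces\<close>

text \<open>The inner product is antilinear in the first and linear in the second argument.
  Positivity and definiteness of \<open>cinner\<close> follow from the last axiom, as \<open>norm\<close> is already
  a norm. Separability is expressed by the additional sort \<open>second_countable_topology\<close>.\<close>

class complex_hilbert = banach +
  fixes scaleC :: "complex \<Rightarrow> 'a \<Rightarrow> 'a" (infixr "*\<^sub>C" 75)
    and cinner :: "'a \<Rightarrow> 'a \<Rightarrow> complex"
  assumes scaleC_add_right: "a *\<^sub>C (x + y) = a *\<^sub>C x + a *\<^sub>C y"
    and scaleC_add_left: "(a + b) *\<^sub>C x = a *\<^sub>C x + b *\<^sub>C x"
    and scaleC_scaleC: "a *\<^sub>C (b *\<^sub>C x) = (a * b) *\<^sub>C x"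
    and scaleC_of_real: "complex_of_real r *\<^sub>C x = r *\<^sub>R x"
    and cinner_commute: "cinner x y = cnj (cinner y x)"
    and cinner_add_right: "cinner x (y + z) = cinner x y + cinner x z"
    and cinner_scaleC_right: "cinner x (a *\<^sub>C y) = a * cinner x y"
    and norm_eq_sqrt_cinner: "norm x = sqrt (Re (cinner x x))"

instantiation complex :: complex_hilbert
begin

definition scaleC_complex :: "complex \<Rightarrow> complex \<Rightarrow> complex"
  where "scaleC_complex a z = a * z"

definition cinner_complex :: "complex \<Rightarrow> complex \<Rightarrow> complex"
  where "cinner_complex z w = cnj z * w"

instance
  by standard
    (auto simp: scaleC_complex_def cinner_complex_def algebra_simps scaleR_conv_of_real
      cmod_def power2_eq_square)

end

definition bounded_clinear :: "('a::complex_hilbert \<Rightarrow> 'b::complex_hilbert) \<Rightarrow> bool"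
  where "bounded_clinear f \<longleftrightarrow> bounded_linear f \<and> (\<forall>a x. f (a *\<^sub>C x) = a *\<^sub>C f x)"

definition cadjoint :: "('a::complex_hilbert \<Rightarrow> 'b::complex_hilbert) \<Rightarrow> 'b \<Rightarrow> 'a"
  where "cadjoint f = (SOME g. \<forall>x y. cinner (f x) y = cinner x (g y))"

definition orthonormal_basis :: "'a::complex_hilbert set \<Rightarrow> bool"
  where "orthonormal_basis E \<longleftrightarrow>
    (\<forall>e\<in>E. \<forall>f\<in>E. cinner e f = (if e = f then 1 else 0)) \<and>
    (\<forall>h. (\<forall>e\<in>E. cinner e h = 0) \<longrightarrow> h = 0)"

section \<open>Fredholm determinants\<close>

definition principal_minor :: "('a::complex_hilbert \<Rightarrow> 'a) \<Rightarrow> 'a set \<Rightarrow> complex"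
  where "principal_minor T F =
    (\<Sum>p | p permutes F. of_int (sign p) * (\<Prod>e\<in>F. cinner e (T (p e))))"

text \<open>For an orthonormal basis \<open>E\<close> of \<open>H\<close> the wedge products of the \<open>k\<close>-element subsets \<open>F\<close> of
  \<open>E\<close> form an orthonormal basis of the \<open>k\<close>-th exterior power of \<open>H\<close>, and the corresponding diagonal
  entries of the \<open>k\<close>-th exterior power of \<open>T\<close> are the principal minors of \<open>T\<close>. For trace class \<open>T\<close>
  this power is again trace class, so the sum converges absolutely to its trace and does not depend
  on the choice of \<open>E\<close>.\<close>

definition trace_exterior_power :: "nat \<Rightarrow> ('a::complex_hilbert \<Rightarrow> 'a) \<Rightarrow> complex"
  where "trace_exterior_power k T =
    (let E = (SOME E. orthonormal_basis E)
     in \<Sum>\<^sub>\<infinity>F\<in>{F. F \<subseteq> E \<and> finite F \<and> card F = k}. principal_minor T F)"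

text \<open>This is the Fredholm determinant of the operator \<open>I + T\<close>, for \<open>T\<close> of trace class.\<close>

definition fredholm_det_1_plus :: "('a::complex_hilbert \<Rightarrow> 'a) \<Rightarrow> complex"
  where "fredholm_det_1_plus T = (\<Sum>k. trace_exterior_power k T)"

section \<open>Hilbert--Schmidt operators on $L^2((0,\infty);H_0)$\<close>

text \<open>Elements of $L^2$ are represented by functions, of which only the values on
  $(0,\infty)$ matter, and these only up to null sets.\<close>

definition L2_halfline :: "(real \<Rightarrow> 'b::{complex_hilbert, second_countable_topology}) set"
  where "L2_halfline = {f. set_borel_measurable lborel {0<..} f \<and>
    set_integrable lborel {0<..} (\<lambda>s. (norm (f s))\<^sup>2)}"

definition L2_norm_halfline :: "(real \<Rightarrow> 'b::{complex_hilbert, second_countable_topology}) \<Rightarrow> real"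
  where "L2_norm_halfline f = sqrt (LINT s:{0<..}|lborel. (norm (f s))\<^sup>2)"

definition L2_inner_halfline ::
  "(real \<Rightarrow> 'b::{complex_hilbert, second_countable_topology}) \<Rightarrow> (real \<Rightarrow> 'b) \<Rightarrow> complex"
  where "L2_inner_halfline f g = (LINT s:{0<..}|lborel. cinner (f s) (g s))"

definition L2_orthonormal_basis ::
  "(real \<Rightarrow> 'b::{complex_hilbert, second_countable_topology}) set \<Rightarrow> bool"
  where "L2_orthonormal_basis E \<longleftrightarrow> E \<subseteq> L2_halfline \<and>
    (\<forall>e\<in>E. \<forall>f\<in>E. L2_inner_halfline e f = (if e = f then 1 else 0)) \<and>
    (\<forall>f\<in>L2_halfline. (\<forall>e\<in>E. L2_inner_halfline e f = 0) \<longrightarrow>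
      (AE s in lborel. 0 < s \<longrightarrow> f s = 0))"

text \<open>The boundedness condition includes that \<open>T\<close> respects equality almost everywhere. The
  Hilbert--Schmidt sum of a bounded operator is the same for all orthonormal bases.\<close>

definition hilbert_schmidt_L2 ::
  "((real \<Rightarrow> 'b::{complex_hilbert, second_countable_topology}) \<Rightarrow> 'a::complex_hilbert) \<Rightarrow> bool"
  where "hilbert_schmidt_L2 T \<longleftrightarrow>
    (\<forall>f\<in>L2_halfline. \<forall>g\<in>L2_halfline. T (\<lambda>s. f s + g s) = T f + T g) \<and>
    (\<forall>f\<in>L2_halfline. \<forall>a. T (\<lambda>s. a *\<^sub>C f s) = a *\<^sub>C T f) \<and>
    (\<exists>K. \<forall>f\<in>L2_halfline. norm (T f) \<le> K * L2_norm_halfline f) \<and>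
    (\<exists>E. L2_orthonormal_basis E \<and> (\<lambda>e. (norm (T e))\<^sup>2) summable_on E)"

section \<open>Linear systems\<close>

definition c0_semigroup :: "(real \<Rightarrow> 'a::complex_hilbert \<Rightarrow> 'a) \<Rightarrow> bool"
  where "c0_semigroup S \<longleftrightarrow>
    (\<forall>t\<ge>0. bounded_clinear (S t)) \<and>
    S 0 = id \<and>
    (\<forall>s\<ge>0. \<forall>t\<ge>0. S (s + t) = S s \<circ> S t) \<and>
    (\<forall>h. continuous_on {0..} (\<lambda>t. S t h))"

text \<open>The (in general unbounded) operator \<open>G\<close> with domain \<open>D\<close> is the generator of \<open>S\<close>;
  values of \<open>G\<close> outside \<open>D\<close> are irrelevant.\<close>

definition generates ::
  "'a::complex_hilbert set \<Rightarrow> ('a \<Rightarrow> 'a) \<Rightarrow> (real \<Rightarrow> 'a \<Rightarrow> 'a) \<Rightarrow> bool"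
  where "generates D G S \<longleftrightarrow> c0_semigroup S \<and>
    D = {h. \<exists>l. ((\<lambda>t. (S t h - h) /\<^sub>R t) \<longlongrightarrow> l) (at_right 0)} \<and>
    (\<forall>h\<in>D. ((\<lambda>t. (S t h - h) /\<^sub>R t) \<longlongrightarrow> G h) (at_right 0))"

text \<open>The linear system $(-A,B,C)$, where \<open>A\<close> has domain \<open>D\<close> and \<open>S t\<close> stands for $e^{-tA}$.\<close>

definition linear_system ::
  "'a::complex_hilbert set \<Rightarrow> ('a \<Rightarrow> 'a) \<Rightarrow> (real \<Rightarrow> 'a \<Rightarrow> 'a) \<Rightarrow>
    ('b::complex_hilbert \<Rightarrow> 'a) \<Rightarrow> ('a \<Rightarrow> 'b) \<Rightarrow> bool"
  where "linear_system D A S B C \<longleftrightarrow>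
    generates D (\<lambda>h. - A h) S \<and>
    bdd_above ((\<lambda>t. onorm (S t)) ` {0..}) \<and>
    bounded_clinear B \<and> bounded_clinear C"

text \<open>Here $e^{-sA^\dagger}$ is the adjoint of $e^{-sA}$.\<close>

definition Theta0 ::
  "(real \<Rightarrow> 'a \<Rightarrow> 'a) \<Rightarrow> ('a \<Rightarrow> 'b) \<Rightarrow> (real \<Rightarrow> 'b::complex_hilbert) \<Rightarrow>
    'a::{complex_hilbert, second_countable_topology}"
  where "Theta0 S C f = (LINT s:{0<..}|lborel. cadjoint (S s) (cadjoint C (f s)))"

definition Xi0 ::
  "(real \<Rightarrow> 'a \<Rightarrow> 'a) \<Rightarrow> ('b \<Rightarrow> 'a) \<Rightarrow> (real \<Rightarrow> 'b::complex_hilbert) \<Rightarrow>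
    'a::{complex_hilbert, second_countable_topology}"
  where "Xi0 S B f = (LINT s:{0<..}|lborel. S s (B (f s)))"

definition admissible22 ::
  "'a::{complex_hilbert, second_countable_topology} set \<Rightarrow> ('a \<Rightarrow> 'a) \<Rightarrow> (real \<Rightarrow> 'a \<Rightarrow> 'a) \<Rightarrow>
    ('b::{complex_hilbert, second_countable_topology} \<Rightarrow> 'a) \<Rightarrow> ('a \<Rightarrow> 'b) \<Rightarrow> bool"
  where "admissible22 D A S B C \<longleftrightarrow> linear_system D A S B C \<and>
    (\<forall>f\<in>L2_halfline. set_integrable lborel {0<..} (\<lambda>s. cadjoint (S s) (cadjoint C (f s)))) \<and>
    (\<forall>f\<in>L2_halfline. set_integrable lborel {0<..} (\<lambda>s. S s (B (f s)))) \<and>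
    hilbert_schmidt_L2 (Theta0 S C) \<and> hilbert_schmidt_L2 (Xi0 S B)"

section \<open>Tau functions and the Gelfand--Levitan equation\<close>

text \<open>The operator $Ce^{-xA}B$ on the one-dimensional space \<open>complex\<close> is identified with a number
  by evaluating it at 1.\<close>

definition phi ::
  "(real \<Rightarrow> 'a \<Rightarrow> 'a) \<Rightarrow> (complex \<Rightarrow> 'a) \<Rightarrow> ('a \<Rightarrow> complex) \<Rightarrow> real \<Rightarrow> complex"
  where "phi S B C x = C (S x (B 1))"

definition R_op ::
  "(real \<Rightarrow> 'a \<Rightarrow> 'a) \<Rightarrow> (complex \<Rightarrow> 'a) \<Rightarrow> ('a \<Rightarrow> complex) \<Rightarrow> real \<Rightarrow>
    'a::{complex_hilbert, second_countable_topology} \<Rightarrow> 'a"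
  where "R_op S B C x h = (LINT t:{x<..}|lborel. S t (B (C (S t h))))"

definition tau_inf ::
  "(real \<Rightarrow> 'a \<Rightarrow> 'a) \<Rightarrow> (complex \<Rightarrow> 'a) \<Rightarrow>
    ('a::{complex_hilbert, second_countable_topology} \<Rightarrow> complex) \<Rightarrow> complex \<Rightarrow> real \<Rightarrow> complex"
  where "tau_inf S B C \<mu> x = fredholm_det_1_plus (\<lambda>h. \<mu> *\<^sub>C R_op S B C x h)"

definition tau_0 ::
  "(real \<Rightarrow> 'a \<Rightarrow> 'a) \<Rightarrow> (complex \<Rightarrow> 'a) \<Rightarrow>
    ('a::{complex_hilbert, second_countable_topology} \<Rightarrow> complex) \<Rightarrow> complex \<Rightarrow> real \<Rightarrow> complex"
  where "tau_0 S B C \<mu> x = fredholm_det_1_plus (\<lambda>h. - (\<mu> *\<^sub>C R_op S B C x h))"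

definition mat22 :: "complex \<Rightarrow> complex \<Rightarrow> complex \<Rightarrow> complex \<Rightarrow> complex^2^2"
  where "mat22 a b c d = vector [vector [a, b], vector [c, d]]"

text \<open>The equation at $0 < x < y$ leaves the diagonal values \<open>W x x\<close> and \<open>V x x\<close> undetermined, so a
  solution is required to be continuous in \<open>y\<close> up to the diagonal. The factor \<open>mat \<mu>\<close> is the scalar
  \<open>\<mu>\<close> times the identity matrix.\<close>

definition gelfand_levitan_solution ::
  "(real \<Rightarrow> complex) \<Rightarrow> complex \<Rightarrow> (real \<Rightarrow> real \<Rightarrow> complex) \<Rightarrow> (real \<Rightarrow> real \<Rightarrow> complex) \<Rightarrow> bool"
  where "gelfand_levitan_solution \<phi> \<mu> W V \<longleftrightarrow>
    (let T = (\<lambda>x y. mat22 (W x y) (V x y) (V x y) (W x y));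
         \<Phi> = (\<lambda>u. mat22 0 (\<phi> u) (\<phi> u) 0)
     in (\<forall>x y. 0 < x \<and> x < y \<longrightarrow>
          set_integrable lborel {x<..} (\<lambda>z. T x z ** \<Phi> (z + y)) \<and>
          T x y + \<Phi> (x + y) + mat \<mu> ** (LINT z:{x<..}|lborel. T x z ** \<Phi> (z + y)) = 0) \<and>
        (\<forall>x>0. continuous_on {x..} (W x) \<and> continuous_on {x..} (V x)))"

abbreviation ddx :: "(real \<Rightarrow> complex) \<Rightarrow> real \<Rightarrow> complex"
  where "ddx f x \<equiv> vector_derivative f (at x)"

text \<open>Toda's equation $g''f - 2g'f' + gf'' = 0$ at every point of $(0,\infty)$ at which $f'$ and
  $g'$ are differentiable.\<close>

definition toda_pointwise :: "(real \<Rightarrow> complex) \<Rightarrow> (real \<Rightarrow> complex) \<Rightarrow> bool"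
  where "toda_pointwise g f \<longleftrightarrow>
    (\<forall>x>0. ddx g differentiable (at x) \<longrightarrow> ddx f differentiable (at x) \<longrightarrow>
      ddx (ddx g) x * f x - 2 * ddx g x * ddx f x + g x * ddx (ddx f) x = 0)"

text \<open>For a merely continuous function $\varphi$ the second derivatives of the tau functions need not
  exist pointwise. For continuously differentiable $f$ and $g$ the products $g''f$ and $gf''$ are
  still distributions on $(0,\infty)$, $\langle g''f,\psi\rangle = -\int g'(f\psi)'$, of order at most
  one, whence test functions of class $C^1$.\<close>

definition test_function :: "(real \<Rightarrow> complex) \<Rightarrow> bool"
  where "test_function \<psi> \<longleftrightarrow>
    (\<forall>x. \<psi> differentiable (at x)) \<and> continuous_on UNIV (ddx \<psi>) \<and>
    (\<exists>K. compact K \<and> K \<subseteq> {0<..} \<and> (\<forall>x. x \<notin> K \<longrightarrow> \<psi> x = 0))"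

definition C1_halfline :: "(real \<Rightarrow> complex) \<Rightarrow> bool"
  where "C1_halfline f \<longleftrightarrow>
    (\<forall>x>0. f differentiable (at x)) \<and> continuous_on {0<..} (ddx f)"

definition toda_distributional :: "(real \<Rightarrow> complex) \<Rightarrow> (real \<Rightarrow> complex) \<Rightarrow> bool"
  where "toda_distributional g f \<longleftrightarrow>
    (\<forall>\<psi>. test_function \<psi> \<longrightarrow>
      - (LINT x:{0<..}|lborel. ddx g x * ddx (\<lambda>t. f t * \<psi> t) x)
      - 2 * (LINT x:{0<..}|lborel. ddx g x * ddx f x * \<psi> x)
      - (LINT x:{0<..}|lborel. ddx f x * ddx (\<lambda>t. g t * \<psi> t) x) = 0)"

end

theory Submission
  imports Defs
begin

text \<open>
  Write \<open>b = B 1\<close> and \<open>\<tau>(\<mu>) = det (I + \<mu> R\<^sub>x)\<close>, so that \<open>\<tau>\<^sub>\<infinity> = \<tau>(\<mu>)\<close> and \<open>\<tau>\<^sub>0 = \<tau>(- \<mu>)\<close>. As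
  \<open>R\<^sub>x\<close> has the derivative \<open>- S\<^sub>x b \<otimes> C S\<^sub>x\<close> of rank one, the logarithmic derivative of \<open>\<tau>(\<mu>)\<close>
  is \<open>- \<mu> p(\<mu>)\<close> with \<open>p(\<mu>) = C S\<^sub>x (I + \<mu> R\<^sub>x)\<^sup>-\<^sup>1 S\<^sub>x b\<close>. The function \<open>- C S\<^sub>x (I + \<mu>
  R\<^sub>x)\<^sup>-\<^sup>1 S\<^sub>y b\<close> solves the scalar Gelfand--Levitan equation, because \<open>R\<^sub>x\<close> is the integral
  of \<open>S\<^sub>z b \<otimes> C S\<^sub>z\<close> over \<open>z > x\<close> (\<open>GL_equation\<close>); half the difference and half the sum of the
  solutions for \<open>\<mu>\<close> and \<open>- \<mu>\<close> are \<open>W\<close> and \<open>V\<close>. Their diagonal values are thus combinations of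
  \<open>p(\<mu>)\<close> and \<open>p(- \<mu>)\<close>.

  The point that needs care is the second derivative, since \<open>p(\<mu>)\<close> is in general only
  continuous in \<open>x\<close>. With \<open>U = S\<^sub>2\<^sub>x\<close>, the semigroup law gives \<open>R\<^sub>x = S\<^sub>x R\<^sub>0 S\<^sub>x\<close> and \<open>R\<^sub>2\<^sub>x
  = U R\<^sub>0 U\<close>, hence \<open>C S\<^sub>x R\<^sub>x\<^sup>k S\<^sub>x b = C (U R\<^sub>0)\<^sup>k U b\<close>. For odd \<open>k\<close> the latter is a product
  of the fixed operator \<open>R\<^sub>0\<close> and of \<open>R\<^sub>2\<^sub>x\<close>, which is strongly differentiable. So the part of
  \<open>p\<close> that is odd in \<open>\<mu>\<close> is differentiable, and its derivative is, up to the factor \<open>2 \<mu>\<close>, the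
  square of the even part (\<open>orbit_odd_has_vector_derivative\<close>, \<open>resolvent_odd_deriv\<close>). This is
  the relation between \<open>W\<close> and \<open>V\<close>, and it is equivalent to \<open>(\<tau>\<^sub>\<infinity> \<tau>\<^sub>0)'' = 4 \<tau>\<^sub>\<infinity>' \<tau>\<^sub>0'\<close>
  (\<open>toda_integrated\<close>), from which both forms of Toda's equation follow by the product rule and
  by integration by parts (\<open>toda_of_integrated\<close>).

  Since Toda's equation is claimed for all \<open>\<mu>\<close>, these identities are proved for power series
  in \<open>\<mu>\<close>, where \<open>I + \<mu> R\<^sub>x\<close> is always invertible, and then summed. The series for \<open>\<tau>\<close> has
  infinite radius of convergence by an elementary estimate. In an orthonormal basis, the
  entries of \<open>R\<^sub>x\<close> are bounded by products \<open>u\<^sub>e v\<^sub>f\<close> of $L^2$ norms, where \<open>\<Sum> u\<^sub>e\<^sup>2\<close> and \<open>\<Sum>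
  v\<^sub>f\<^sup>2\<close> are finite by the Hilbert--Schmidt condition. Hence a minor with \<open>k\<close> rows is at most
  \<open>k!\<close> times the product of the \<open>u\<^sub>e v\<^sub>e\<close> over its rows; as the rows are distinct and \<open>\<Sum> u\<^sub>e
  v\<^sub>e\<close> is finite, the sum of all these bounds decays faster than every geometric sequence
  (\<open>minor_sums_bound\<close>). The derivative of \<open>\<tau>\<close> is obtained from Cramer's rule for finite
  matrices (\<open>minors_cramer\<close>), by compressing \<open>R\<^sub>x\<close> to the spans of finitely many basis vectors
  (\<open>rate_fps_eq\<close>).
\<close>

section \<open>Complex Hilbert spaces\<close>

lemma cinner_add_left: "cinner (x + y) z = cinner x z + cinner y z"
  for x y z :: "'a::complex_hilbert"
  by (metis cinner_commute cinner_add_right complex_cnj_add)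

lemma cinner_scaleC_left: "cinner (a *\<^sub>C x) y = cnj a * cinner x y"
  for x y :: "'a::complex_hilbert"
  by (metis cinner_commute cinner_scaleC_right complex_cnj_mult)

lemma cinner_scaleR_right: "cinner x (r *\<^sub>R y) = r *\<^sub>R cinner x y"
  for x y :: "'a::complex_hilbert"
  using cinner_scaleC_right[of x "complex_of_real r" y]
  by (simp add: scaleC_of_real scaleR_conv_of_real)

lemma cinner_scaleR_left: "cinner (r *\<^sub>R x) y = r *\<^sub>R cinner x y"
  for x y :: "'a::complex_hilbert"
  using cinner_scaleC_left[of "complex_of_real r" x y]
  by (simp add: scaleC_of_real scaleR_conv_of_real)

lemma cinner_self: "cinner x x = complex_of_real ((norm x)\<^sup>2)"
  for x :: "'a::complex_hilbert"
proof -
  have "Im (cinner x x) = 0"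
    using cinner_commute[of x x] by (metis Reals_cnj_iff complex_is_Real_iff)
  moreover have "Re (cinner x x) \<ge> 0"
    using norm_ge_zero[of x] unfolding norm_eq_sqrt_cinner by simp
  then have "Re (cinner x x) = (norm x)\<^sup>2"
    by (simp add: norm_eq_sqrt_cinner)
  ultimately show ?thesis by (simp add: complex_eq_iff)
qed

lemma cinner_minus_right: "cinner x (- y) = - cinner x y"
  for x y :: "'a::complex_hilbert"
  using cinner_scaleR_right[of x "-1" y] by simp

lemma cinner_minus_left: "cinner (- x) y = - cinner x y"
  for x y :: "'a::complex_hilbert"
  using cinner_scaleR_left[of "-1" x y] by simp

lemma cinner_diff_right: "cinner x (y - z) = cinner x y - cinner x z"
  for x y z :: "'a::complex_hilbert"
  by (metis cinner_add_right cinner_minus_right uminus_add_conv_diff add.commute)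

lemma cinner_diff_left: "cinner (x - y) z = cinner x z - cinner y z"
  for x y z :: "'a::complex_hilbert"
  by (metis cinner_add_left cinner_minus_left uminus_add_conv_diff add.commute)

lemma norm_scaleC: "norm (a *\<^sub>C x) = norm a * norm x"
  for x :: "'a::complex_hilbert"
proof -
  have "cinner (a *\<^sub>C x) (a *\<^sub>C x) = complex_of_real ((norm a * norm x)\<^sup>2)"
    unfolding cinner_scaleC_left cinner_scaleC_right cinner_self[of x] power_mult_distrib of_real_mult
      complex_norm_square by (simp add: mult.commute)
  then have "(norm (a *\<^sub>C x))\<^sup>2 = (norm a * norm x)\<^sup>2"
    unfolding cinner_self of_real_eq_iff .
  then show ?thesis by simp
qed

lemma cauchy_schwarz_cinner: "norm (cinner x y) \<le> norm x * norm y"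
  for x y :: "'a::complex_hilbert"
proof (cases "y = 0")
  case True
  then show ?thesis using cinner_scaleR_right[of x 0 y] by simp
next
  case False
  then have ny: "norm y > 0" by simp
  \<comment> \<open>\<open>z\<close> is \<open>\<parallel>y\<parallel>\<^sup>2\<close> times the component of \<open>x\<close> orthogonal to \<open>y\<close>.\<close>
  define z where "z = complex_of_real ((norm y)\<^sup>2) *\<^sub>C x - cinner y x *\<^sub>C y"
  have *: "cinner x y = cnj (cinner y x)" by (rule cinner_commute)
  have "cinner z z = complex_of_real ((norm y)\<^sup>2) * (complex_of_real ((norm y)\<^sup>2) * complex_of_real ((norm x)\<^sup>2)
      - cinner y x * cnj (cinner y x))"
    unfolding z_def cinner_diff_left cinner_diff_right cinner_scaleC_left cinner_scaleC_right *
      cinner_self[of x] cinner_self[of y]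
    by (simp add: algebra_simps)
  also have "\<dots> = complex_of_real ((norm y)\<^sup>2 * ((norm y)\<^sup>2 * (norm x)\<^sup>2 - (norm (cinner y x))\<^sup>2))"
    by (simp only: of_real_mult of_real_diff complex_norm_square)
  finally have "(norm z)\<^sup>2 = (norm y)\<^sup>2 * ((norm y)\<^sup>2 * (norm x)\<^sup>2 - (norm (cinner y x))\<^sup>2)"
    unfolding cinner_self of_real_eq_iff .
  then have "0 \<le> (norm y)\<^sup>2 * ((norm y)\<^sup>2 * (norm x)\<^sup>2 - (norm (cinner y x))\<^sup>2)"
    by (metis zero_le_power2)
  then have "(norm (cinner y x))\<^sup>2 \<le> (norm x * norm y)\<^sup>2"
    using ny by (simp add: zero_le_mult_iff power_mult_distrib mult.commute)
  then have "norm (cinner y x) \<le> norm x * norm y"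
    by (rule power2_le_imp_le) simp
  then show ?thesis by (simp add: *)
qed

lemma bounded_bilinear_cinner: "bounded_bilinear (cinner :: 'a::complex_hilbert \<Rightarrow> _)"
  by standard (auto simp: cinner_add_left cinner_add_right cinner_scaleR_left cinner_scaleR_right
      intro!: exI[of _ 1] cauchy_schwarz_cinner)

lemmas bounded_linear_cinner_right = bounded_bilinear.bounded_linear_right[OF bounded_bilinear_cinner]
lemmas tendsto_cinner = bounded_bilinear.tendsto[OF bounded_bilinear_cinner]
lemmas continuous_on_cinner = bounded_bilinear.continuous_on[OF bounded_bilinear_cinner]
lemmas cinner_sum_right = bounded_bilinear.sum_right[OF bounded_bilinear_cinner]
lemmas cinner_sum_left = bounded_bilinear.sum_left[OF bounded_bilinear_cinner]
lemmas cinner_zero_right [simp] = bounded_bilinear.zero_right[OF bounded_bilinear_cinner]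
lemmas cinner_zero_left [simp] = bounded_bilinear.zero_left[OF bounded_bilinear_cinner]

lemma bounded_bilinear_scaleC: "bounded_bilinear (scaleC :: complex \<Rightarrow> 'a::complex_hilbert \<Rightarrow> _)"
proof
  show "(r *\<^sub>R a) *\<^sub>C b = r *\<^sub>R (a *\<^sub>C b)" for r a and b :: 'a
    using scaleC_scaleC[of "complex_of_real r" a b] by (simp add: scaleC_of_real scaleR_conv_of_real)
  show "a *\<^sub>C (r *\<^sub>R b) = r *\<^sub>R (a *\<^sub>C b)" for r a and b :: 'a
    by (metis scaleC_of_real scaleC_scaleC mult.commute)
qed (auto simp: scaleC_add_left scaleC_add_right norm_scaleC intro!: exI[of _ 1])

lemmas bounded_linear_scaleC_right = bounded_bilinear.bounded_linear_right[OF bounded_bilinear_scaleC]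
lemmas bounded_linear_scaleC_left = bounded_bilinear.bounded_linear_left[OF bounded_bilinear_scaleC]
lemmas continuous_on_scaleC = bounded_bilinear.continuous_on[OF bounded_bilinear_scaleC]
lemmas scaleC_sum_right = bounded_bilinear.sum_right[OF bounded_bilinear_scaleC]
lemmas scaleC_minus_left = bounded_bilinear.minus_left[OF bounded_bilinear_scaleC]
lemmas scaleC_zero_right [simp] = bounded_bilinear.zero_right[OF bounded_bilinear_scaleC]
lemmas scaleC_zero_left [simp] = bounded_bilinear.zero_left[OF bounded_bilinear_scaleC]

lemma scaleC_one [simp]: "1 *\<^sub>C x = x" for x :: "'a::complex_hilbert"
  using scaleC_of_real[of 1 x] by simp

lemma bounded_clinear_scaleC: "bounded_clinear f \<Longrightarrow> f (a *\<^sub>C x) = a *\<^sub>C f x"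
  by (simp add: bounded_clinear_def)

lemma bounded_clinear_imp_linear: "bounded_clinear f \<Longrightarrow> bounded_linear f"
  by (simp add: bounded_clinear_def)

lemma bounded_clinear_id: "bounded_clinear (\<lambda>x. x)"
  by (simp add: bounded_clinear_def bounded_linear_ident)

lemma bounded_clinear_compose:
  "bounded_clinear f \<Longrightarrow> bounded_clinear g \<Longrightarrow> bounded_clinear (\<lambda>x. f (g x))"
  by (simp add: bounded_clinear_def bounded_linear_compose)

lemma bounded_clinear_funpow: "bounded_clinear f \<Longrightarrow> bounded_clinear (f ^^ k)"
  for f :: "'a::complex_hilbert \<Rightarrow> 'a"
  by (induction k) (auto simp: id_def o_def intro: bounded_clinear_id bounded_clinear_compose)

lemma bounded_clinear_sum_scaleC:
  assumes "bounded_clinear f" shows "f (\<Sum>i\<in>I. a i *\<^sub>C x i) = (\<Sum>i\<in>I. a i *\<^sub>C f (x i))"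
  using linear_sum[OF bounded_linear.linear[OF bounded_clinear_imp_linear[OF assms]], of "\<lambda>i. a i *\<^sub>C x i" I]
  by (simp add: bounded_clinear_scaleC[OF assms])

section \<open>Orthonormal bases and adjoints\<close>

definition orthonormal :: "'a::complex_hilbert set \<Rightarrow> bool"
  where "orthonormal E \<longleftrightarrow> (\<forall>e\<in>E. \<forall>f\<in>E. cinner e f = (if e = f then 1 else 0))"

lemma orthonormal_subset: "orthonormal E \<Longrightarrow> G \<subseteq> E \<Longrightarrow> orthonormal G"
  unfolding orthonormal_def by blast

lemma orthonormal_cinner_sum:
  assumes "orthonormal E" "finite G" "G \<subseteq> E" "e \<in> E"
  shows "cinner e (\<Sum>f\<in>G. a f *\<^sub>C f) = (if e \<in> G then a e else 0)"
proof -
  have "cinner e (\<Sum>f\<in>G. a f *\<^sub>C f) = (\<Sum>f\<in>G. if f = e then a f else 0)"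
    unfolding cinner_sum_right cinner_scaleC_right using assms
    by (intro sum.cong) (auto simp: orthonormal_def subset_eq)
  then show ?thesis using assms by simp
qed

lemma orthonormal_norm_sum:
  assumes "orthonormal E" "finite G" "G \<subseteq> E"
  shows "(norm (\<Sum>f\<in>G. a f *\<^sub>C f))\<^sup>2 = (\<Sum>f\<in>G. (norm (a f))\<^sup>2)"
proof -
  have "cinner (\<Sum>f\<in>G. a f *\<^sub>C f) (\<Sum>f\<in>G. a f *\<^sub>C f) = (\<Sum>e\<in>G. cnj (a e) * a e)"
    unfolding cinner_sum_left[of _ G] cinner_scaleC_left
    using assms by (intro sum.cong refl) (auto simp: orthonormal_cinner_sum[OF assms(1,2)] subset_eq)
  also have "\<dots> = complex_of_real (\<Sum>f\<in>G. (norm (a f))\<^sup>2)"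
    unfolding of_real_sum by (intro sum.cong refl) (metis complex_norm_square mult.commute)
  finally show ?thesis unfolding cinner_self of_real_eq_iff .
qed

definition ortho_proj :: "'a::complex_hilbert set \<Rightarrow> 'a \<Rightarrow> 'a"
  where "ortho_proj G h = (\<Sum>e\<in>G. cinner e h *\<^sub>C e)"

lemma bessel_inequality:
  assumes "orthonormal E" "finite G" "G \<subseteq> E"
  shows "(\<Sum>e\<in>G. (norm (cinner e h))\<^sup>2) \<le> (norm h)\<^sup>2"
proof -
  let ?p = "\<Sum>f\<in>G. cinner f h *\<^sub>C f"
  have ph: "cinner ?p h = complex_of_real (\<Sum>f\<in>G. (norm (cinner f h))\<^sup>2)"
    unfolding cinner_sum_left cinner_scaleC_left of_real_sum
    by (intro sum.cong refl) (metis complex_norm_square mult.commute)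
  have hp: "cinner h ?p = complex_of_real (\<Sum>f\<in>G. (norm (cinner f h))\<^sup>2)"
    by (subst cinner_commute) (simp add: ph)
  have "cinner (h - ?p) (h - ?p) = complex_of_real ((norm h)\<^sup>2 - (\<Sum>f\<in>G. (norm (cinner f h))\<^sup>2))"
    unfolding cinner_diff_left cinner_diff_right ph hp cinner_self[of h] cinner_self[of ?p]
      orthonormal_norm_sum[OF assms] by simp
  then have "(norm (h - ?p))\<^sup>2 = (norm h)\<^sup>2 - (\<Sum>f\<in>G. (norm (cinner f h))\<^sup>2)"
    unfolding cinner_self of_real_eq_iff .
  then show ?thesis using zero_le_power2[of "norm (h - ?p)"] by linarith
qed

lemma norm_ortho_proj_le:
  assumes "orthonormal E" "finite G" "G \<subseteq> E"
  shows "norm (ortho_proj G h) \<le> norm h"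
proof (rule power2_le_imp_le)
  show "(norm (ortho_proj G h))\<^sup>2 \<le> (norm h)\<^sup>2"
    unfolding ortho_proj_def orthonormal_norm_sum[OF assms] by (rule bessel_inequality[OF assms])
qed simp

lemma bounded_linear_ortho_proj: "finite G \<Longrightarrow> bounded_linear (ortho_proj G)"
  unfolding ortho_proj_def
  by (intro bounded_linear_sum bounded_linear_compose[OF bounded_linear_scaleC_left]
      bounded_linear_cinner_right)

lemma ortho_proj_scaleC: "ortho_proj G (a *\<^sub>C h) = a *\<^sub>C ortho_proj G h"
  by (simp add: ortho_proj_def scaleC_sum_right cinner_scaleC_right scaleC_scaleC)

lemma ortho_proj_clinear: "finite G \<Longrightarrow> bounded_clinear (ortho_proj G)"
  by (simp add: bounded_clinear_def bounded_linear_ortho_proj ortho_proj_scaleC)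

lemma orthonormal_basis_exists: "\<exists>E :: 'a::complex_hilbert set. orthonormal_basis E"
proof -
  have "\<exists>M\<in>Collect orthonormal. \<forall>X\<in>Collect (orthonormal :: 'a set \<Rightarrow> bool). M \<subseteq> X \<longrightarrow> X = M"
  proof (rule subset_Zorn)
    fix c :: "'a set set" assume c: "subset.chain (Collect orthonormal) c"
    have "orthonormal (\<Union>c)"
      unfolding orthonormal_def
    proof (intro ballI)
      fix e f assume "e \<in> \<Union>c" "f \<in> \<Union>c"
      then obtain X Y where XY: "X \<in> c" "Y \<in> c" "e \<in> X" "f \<in> Y" by blast
      then obtain Z where Z: "Z \<in> c" "e \<in> Z" "f \<in> Z"
        using c unfolding subset_chain_def by (metis subsetD)
      then have "orthonormal Z" using c unfolding subset_chain_def by blast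
      then show "cinner e f = (if e = f then 1 else 0)" using Z by (simp add: orthonormal_def)
    qed
    then show "\<exists>U\<in>Collect orthonormal. \<forall>X\<in>c. X \<subseteq> U" by blast
  qed
  then obtain M :: "'a set" where M: "orthonormal M" and max: "\<And>X. orthonormal X \<Longrightarrow> M \<subseteq> X \<Longrightarrow> X = M"
    by auto
  have "h = 0" if h: "\<forall>e\<in>M. cinner e h = 0" for h
  proof (rule ccontr)
    assume "h \<noteq> 0"
    define g where "g = inverse (norm h) *\<^sub>R h"
    have "norm g = 1" using \<open>h \<noteq> 0\<close> by (simp add: g_def)
    then have gg: "cinner g g = 1" by (simp add: cinner_self)
    have eg: "cinner e g = 0" if "e \<in> M" for e using h that by (simp add: g_def cinner_scaleR_right)
    then have ge: "cinner g e = 0" if "e \<in> M" for e by (metis cinner_commute complex_cnj_zero that)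
    have "orthonormal (insert g M)"
      using M gg eg ge by (auto simp: orthonormal_def)
    then have "g \<in> M" using max by blast
    then show False using eg gg by force
  qed
  then show ?thesis using M unfolding orthonormal_basis_def orthonormal_def by blast
qed

text \<open>Distinct elements of an orthonormal set have distance \<open>\<surd>2\<close>, so a countable dense set
  contains different approximations to them.\<close>

lemma orthonormal_imp_countable:
  fixes E :: "'a::{complex_hilbert, second_countable_topology} set"
  assumes "orthonormal E"
  shows "countable E"
proof -
  have dist: "dist e f > 1" if "e \<in> E" "f \<in> E" "e \<noteq> f" for e f
  proof -
    have "cinner (e - f) (e - f) = 2"
      using assms that unfolding orthonormal_def by (simp add: cinner_diff_left cinner_diff_right)
    then have "(norm (e - f))\<^sup>2 = 2"
      unfolding cinner_self by (metis of_real_eq_iff of_real_numeral)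
    then show ?thesis unfolding dist_norm by (smt (verit) power2_eq_square mult_le_one norm_ge_zero)
  qed
  obtain D :: "'a set" where D: "countable D" "\<And>X. open X \<Longrightarrow> X \<noteq> {} \<Longrightarrow> \<exists>d\<in>D. d \<in> X"
    using countable_dense_setE by blast
  have "\<forall>e\<in>E. \<exists>d\<in>D. d \<in> ball e (1/2)" by (intro ballI D(2)) auto
  then obtain d where d: "\<And>e. e \<in> E \<Longrightarrow> d e \<in> D \<and> dist e (d e) < 1/2" by (metis mem_ball)
  have "inj_on d E"
  proof (rule inj_onI, rule ccontr)
    fix e f assume *: "e \<in> E" "f \<in> E" "d e = d f" "e \<noteq> f"
    have "dist e f \<le> dist e (d e) + dist f (d f)" by (metis *(3) dist_commute dist_triangle)
    then show False using d[OF *(1)] d[OF *(2)] dist[OF *(1,2,4)] by linarith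
  qed
  then show ?thesis using countable_image_inj_on[of d E] D(1) d
    by (meson countable_subset image_subsetI)
qed

lemma countable_exhaustion:
  assumes "countable E"
  obtains G :: "nat \<Rightarrow> 'a set" where "\<And>n. finite (G n)" "\<And>n. G n \<subseteq> E" "incseq G" "(\<Union>n. G n) = E"
proof (cases "E = {}")
  case True
  then show ?thesis by (intro that[of "\<lambda>_. {}"]) auto
next
  case False
  show ?thesis
  proof (rule that[of "\<lambda>n. from_nat_into E ` {..<n}"])
    show "incseq (\<lambda>n. from_nat_into E ` {..<n})" by (intro monoI image_mono) auto
    show "(\<Union>n. from_nat_into E ` {..<n}) = E"
      using range_from_nat_into[OF False assms] by blast
  qed (auto simp: from_nat_into[OF False])
qed

lemma exhaustion_eventually:
  fixes G :: "nat \<Rightarrow> 'a set"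
  assumes "incseq G" "(\<Union>n. G n) = E" "finite F" "F \<subseteq> E"
  shows "eventually (\<lambda>n. F \<subseteq> G n) sequentially"
  using assms(3,4)
proof (induction F)
  case (insert x F)
  then obtain m where "x \<in> G m" using assms(2) by blast
  then have "eventually (\<lambda>n. x \<in> G n) sequentially"
    unfolding eventually_sequentially using assms(1) by (metis incseqD subsetD)
  then show ?case using insert by (auto elim: eventually_elim2)
qed simp

lemma orthonormal_series_converges:
  assumes "orthonormal E" and G: "\<And>n. finite (G n)" "\<And>n. G n \<subseteq> E" "incseq G"
    and bd: "\<And>n. (\<Sum>e\<in>G n. (norm (a e))\<^sup>2) \<le> M"
  shows "convergent (\<lambda>n. \<Sum>e\<in>G n. a e *\<^sub>C (e :: 'a::complex_hilbert))"
proof -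
  let ?s = "\<lambda>n. \<Sum>e\<in>G n. (norm (a e))\<^sup>2" and ?v = "\<lambda>n. \<Sum>e\<in>G n. a e *\<^sub>C e"
  have inc: "incseq ?s"
    using G(1) by (intro monoI sum_mono2) (auto dest: incseqD[OF G(3)])
  then obtain L where L: "?s \<longlonglongrightarrow> L" using bd incseq_convergent[of ?s M] by blast
  have diff: "(norm (?v n - ?v m))\<^sup>2 = ?s n - ?s m" if "m \<le> n" for m n
  proof -
    have sub: "G m \<subseteq> G n" using that incseqD[OF G(3)] by blast
    have "?v n - ?v m = (\<Sum>e\<in>G n - G m. a e *\<^sub>C e)"
      using sum_diff[OF G(1) sub, of "\<lambda>e. a e *\<^sub>C e"] by simp
    also have "(norm \<dots>)\<^sup>2 = (\<Sum>e\<in>G n - G m. (norm (a e))\<^sup>2)"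
      using G by (intro orthonormal_norm_sum[OF assms(1)]) auto
    also have "\<dots> = ?s n - ?s m" using sum_diff[OF G(1) sub, of "\<lambda>e. (norm (a e))\<^sup>2"] by simp
    finally show ?thesis .
  qed
  have "Cauchy ?v"
  proof (rule CauchyI')
    fix e :: real assume "e > 0"
    then obtain N where N: "\<And>n m. n \<ge> N \<Longrightarrow> m \<ge> N \<Longrightarrow> dist (?s m) (?s n) < e\<^sup>2"
      using metric_CauchyD[OF LIMSEQ_imp_Cauchy[OF L], of "e\<^sup>2"] by auto
    show "\<exists>M. \<forall>m\<ge>M. \<forall>n>m. dist (?v m) (?v n) < e"
    proof (intro exI allI impI)
      fix m n assume "m \<ge> N" "m < n"
      then have "(norm (?v n - ?v m))\<^sup>2 < e\<^sup>2"
        using N[of n m] diff[of m n] by (auto simp: dist_real_def)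
      then have "norm (?v n - ?v m) < e" using \<open>e > 0\<close> by (simp add: power2_less_imp_less)
      then show "dist (?v m) (?v n) < e" by (simp add: dist_norm norm_minus_commute)
    qed
  qed
  then show ?thesis by (rule Cauchy_convergent)
qed

lemma orthonormal_basisD:
  assumes "orthonormal_basis E" shows "orthonormal E" "(\<And>e. e \<in> E \<Longrightarrow> cinner e h = 0) \<Longrightarrow> h = 0"
  using assms unfolding orthonormal_basis_def orthonormal_def by blast+

text \<open>The projections converge by Bessel's inequality and completeness, and the difference of \<open>h\<close>
  and the limit is orthogonal to the basis.\<close>

lemma ortho_proj_tendsto:
  assumes E: "orthonormal_basis E" and G: "\<And>n. finite (G n)" "\<And>n. G n \<subseteq> E" "incseq G" "(\<Union>n. G n) = E"
  shows "(\<lambda>n. ortho_proj (G n) h) \<longlonglongrightarrow> h"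
proof -
  note on = orthonormal_basisD(1)[OF E]
  have "convergent (\<lambda>n. ortho_proj (G n) h)"
    unfolding ortho_proj_def
    using bessel_inequality[OF on G(1,2)] by (intro orthonormal_series_converges[OF on G(1-3)]) auto
  then obtain g where g: "(\<lambda>n. ortho_proj (G n) h) \<longlonglongrightarrow> g" by (auto simp: convergent_def)
  have "cinner e (h - g) = 0" if "e \<in> E" for e
  proof -
    have "(\<lambda>n. cinner e (ortho_proj (G n) h)) \<longlonglongrightarrow> cinner e g"
      by (intro tendsto_cinner tendsto_const g)
    moreover have "eventually (\<lambda>n. cinner e (ortho_proj (G n) h) = cinner e h) sequentially"
    proof -
      have "eventually (\<lambda>n. {e} \<subseteq> G n) sequentially"
        using that by (intro exhaustion_eventually[OF G(3,4)]) auto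
      then show ?thesis
        by eventually_elim (use that in \<open>simp add: ortho_proj_def orthonormal_cinner_sum[OF on G(1,2)]\<close>)
    qed
    ultimately have "cinner e g = cinner e h"
      by (metis LIMSEQ_unique tendsto_eventually)
    then show ?thesis by (simp add: cinner_diff_right)
  qed
  then have "h - g = 0" by (rule orthonormal_basisD(2)[OF E])
  then show ?thesis using g by simp
qed

text \<open>The functional \<open>c\<close> is tested on \<open>v = \<Sum> cnj (c e) e\<close>, the part in the span of \<open>G\<close> of the
  vector that represents \<open>c\<close>: there \<open>c v = \<parallel>v\<parallel>\<^sup>2\<close>.\<close>

lemma bounded_functional_coefficients:
  assumes "orthonormal E" "finite G" "G \<subseteq> E" and c: "bounded_clinear c"
    and K: "\<And>h. norm (c h) \<le> K * norm h"
  shows "(\<Sum>e\<in>G. (norm (c e :: complex))\<^sup>2) \<le> K\<^sup>2"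
proof -
  let ?v = "\<Sum>e\<in>G. cnj (c e) *\<^sub>C e" and ?s = "\<Sum>e\<in>G. (norm (c e))\<^sup>2"
  interpret c: bounded_linear c using c by (rule bounded_clinear_imp_linear)
  have "c ?v = complex_of_real ?s"
    unfolding c.sum bounded_clinear_scaleC[OF c] scaleC_complex_def of_real_sum
    by (intro sum.cong refl) (metis complex_norm_square mult.commute)
  moreover have s0: "?s \<ge> 0" by (intro sum_nonneg) auto
  ultimately have "norm (c ?v) = ?s" by (simp only: norm_of_real abs_of_nonneg)
  then have "?s \<le> K * norm ?v" using K[of ?v] by (simp only:)
  then have "?s\<^sup>2 \<le> (K * norm ?v)\<^sup>2" using s0 by (rule power_mono)
  also have "\<dots> = K\<^sup>2 * ?s"
    unfolding power_mult_distrib orthonormal_norm_sum[OF assms(1-3)] by simp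
  finally have "?s * ?s \<le> K\<^sup>2 * ?s" by (simp add: power2_eq_square)
  then have "?s \<le> K\<^sup>2 \<or> ?s \<le> 0" unfolding mult_le_cancel_right using s0 by linarith
  then show ?thesis using zero_le_power2[of K] by linarith
qed

text \<open>By the coefficient bound, the series \<open>\<Sum> cnj (c e) e\<close> for the functional \<open>c x = \<langle>y, f x\<rangle>\<close>
  converges; its sum is the value of the adjoint at \<open>y\<close>.\<close>

lemma cadjoint_exists:
  fixes f :: "'a::{complex_hilbert, second_countable_topology} \<Rightarrow> 'b::complex_hilbert"
  assumes f: "bounded_clinear f"
  shows "\<exists>g. \<forall>x y. cinner (f x) y = cinner x (g y)"
proof -
  obtain E :: "'a set" where E: "orthonormal_basis E" using orthonormal_basis_exists by blast
  note on = orthonormal_basisD(1)[OF E]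
  obtain G where G: "\<And>n. finite (G n)" "\<And>n. G n \<subseteq> E" "incseq G" "(\<Union>n. G n) = E"
    using countable_exhaustion[OF orthonormal_imp_countable[OF on]] by metis
  interpret f: bounded_linear f using f by (rule bounded_clinear_imp_linear)
  obtain K where K: "\<And>x. norm (f x) \<le> norm x * K" using f.bounded by blast
  have "\<exists>v. \<forall>x. cinner (f x) y = cinner x v" for y
  proof -
    define c where "c x = cinner y (f x)" for x
    have "bounded_clinear c"
      unfolding bounded_clinear_def c_def
      by (simp add: bounded_linear_compose[OF bounded_linear_cinner_right f.bounded_linear_axioms]
          bounded_clinear_scaleC[OF f] cinner_scaleC_right scaleC_complex_def)
    moreover have "norm (c x) \<le> (norm y * K) * norm x" for x
      unfolding c_def by (rule order_trans[OF cauchy_schwarz_cinner])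
        (metis K ab_semigroup_mult_class.mult_ac(1) mult.commute mult_left_mono norm_ge_zero)
    ultimately have bd: "(\<Sum>e\<in>G n. (norm (c e))\<^sup>2) \<le> (norm y * K)\<^sup>2" for n
      using bounded_functional_coefficients[OF on G(1,2)] by blast
    have "convergent (\<lambda>n. \<Sum>e\<in>G n. cnj (c e) *\<^sub>C e)"
      using bd by (intro orthonormal_series_converges[OF on G(1-3)]) auto
    then obtain v where v: "(\<lambda>n. \<Sum>e\<in>G n. cnj (c e) *\<^sub>C e) \<longlonglongrightarrow> v" by (auto simp: convergent_def)
    have "cinner (f x) y = cinner x v" for x
    proof (rule LIMSEQ_unique)
      show "(\<lambda>n. cinner (f (ortho_proj (G n) x)) y) \<longlonglongrightarrow> cinner (f x) y"
        by (intro tendsto_cinner tendsto_const f.tendsto ortho_proj_tendsto[OF E G])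
      have "cinner (f (ortho_proj (G n) x)) y = cinner x (\<Sum>e\<in>G n. cnj (c e) *\<^sub>C e)" for n
        unfolding ortho_proj_def f.sum bounded_clinear_scaleC[OF f] cinner_sum_left cinner_sum_right
          cinner_scaleC_left cinner_scaleC_right c_def
        by (intro sum.cong refl) (metis cinner_commute mult.commute)
      then show "(\<lambda>n. cinner (f (ortho_proj (G n) x)) y) \<longlonglongrightarrow> cinner x v"
        using tendsto_cinner[OF tendsto_const v, of x] by simp
    qed
    then show ?thesis by blast
  qed
  then show ?thesis by metis
qed

lemma cinner_cadjoint:
  fixes f :: "'a::{complex_hilbert, second_countable_topology} \<Rightarrow> 'b::complex_hilbert"
  assumes "bounded_clinear f"
  shows "cinner x (cadjoint f y) = cinner (f x) y"
proof -
  have "\<forall>x y. cinner (f x) y = cinner x (cadjoint f y)"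
    unfolding cadjoint_def by (rule someI_ex[OF cadjoint_exists[OF assms]])
  then show ?thesis by simp
qed

section \<open>Square integrable functions\<close>

definition square_integrable :: "'x measure \<Rightarrow> ('x \<Rightarrow> complex) \<Rightarrow> bool"
  where "square_integrable M f \<longleftrightarrow> f \<in> borel_measurable M \<and> integrable M (\<lambda>x. (norm (f x))\<^sup>2)"

lemma square_integrable_measurable [measurable_dest]:
  "square_integrable M f \<Longrightarrow> f \<in> borel_measurable M"
  by (simp add: square_integrable_def)

lemma square_integrable_norm_mult:
  assumes "square_integrable M f" "square_integrable M g"
  shows "integrable M (\<lambda>x. norm (f x) * norm (g x))"
proof (rule Bochner_Integration.integrable_bound)
  show "integrable M (\<lambda>x. (norm (f x))\<^sup>2 + (norm (g x))\<^sup>2)"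
    using assms by (simp add: square_integrable_def)
  show "(\<lambda>x. norm (f x) * norm (g x)) \<in> borel_measurable M"
    using assms[THEN square_integrable_measurable] by measurable
  show "AE x in M. norm (norm (f x) * norm (g x)) \<le> norm ((norm (f x))\<^sup>2 + (norm (g x))\<^sup>2)"
  proof (intro AE_I2)
    fix x
    have "2 * (norm (f x) * norm (g x)) \<le> (norm (f x))\<^sup>2 + (norm (g x))\<^sup>2"
      using sum_squares_bound[of "norm (f x)" "norm (g x)"] by (simp add: mult.assoc)
    moreover have "0 \<le> norm (f x) * norm (g x)" by simp
    ultimately show "norm (norm (f x) * norm (g x)) \<le> norm ((norm (f x))\<^sup>2 + (norm (g x))\<^sup>2)"
      by (simp only: real_norm_def abs_of_nonneg add_nonneg_nonneg zero_le_power2)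
  qed
qed

lemma square_integrable_mult:
  assumes "square_integrable M f" "square_integrable M g"
  shows "integrable M (\<lambda>x. f x * g x)"
proof (rule Bochner_Integration.integrable_bound[OF square_integrable_norm_mult[OF assms]])
  show "(\<lambda>x. f x * g x) \<in> borel_measurable M"
    using assms[THEN square_integrable_measurable] by measurable
qed (auto simp: norm_mult)

lemma borel_measurable_cnj:
  assumes "f \<in> borel_measurable M" shows "(\<lambda>x. cnj (f x)) \<in> borel_measurable M"
  using assms by (rule measurable_compose) (intro borel_measurable_continuous_onI continuous_intros)

lemma square_integrable_cnj: "square_integrable M f \<Longrightarrow> square_integrable M (\<lambda>x. cnj (f x))"
  unfolding square_integrable_def complex_mod_cnj by (auto intro: borel_measurable_cnj)

lemma square_integrable_cmult: "square_integrable M f \<Longrightarrow> square_integrable M (\<lambda>x. a * f x)"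
  by (auto simp: square_integrable_def norm_mult power_mult_distrib)

lemma square_integrable_add:
  assumes "square_integrable M f" "square_integrable M g"
  shows "square_integrable M (\<lambda>x. f x + g x)"
  unfolding square_integrable_def
proof
  note [measurable] = assms[THEN square_integrable_measurable]
  show "(\<lambda>x. f x + g x) \<in> borel_measurable M" by measurable
  have "integrable M (\<lambda>x. (f x + g x) * cnj (f x + g x))"
    using assms[THEN square_integrable_cnj] assms
    by (auto simp: algebra_simps intro!: Bochner_Integration.integrable_add square_integrable_mult)
  then have "integrable M (\<lambda>x. norm ((f x + g x) * cnj (f x + g x)))" by (rule integrable_norm)
  then show "integrable M (\<lambda>x. (norm (f x + g x))\<^sup>2)" 
    by (simp only: norm_mult complex_mod_cnj power2_eq_square)
qed

lemma square_integrable_diff: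
  assumes "square_integrable M f" "square_integrable M g"
  shows "square_integrable M (\<lambda>x. f x - g x)"
  using square_integrable_add[OF assms(1) square_integrable_cmult[OF assms(2), of "-1"]] by simp

lemma square_integrable_sum:
  assumes "\<And>i. i \<in> I \<Longrightarrow> square_integrable M (f i)"
  shows "square_integrable M (\<lambda>x. \<Sum>i\<in>I. f i x)"
  using assms
  by (induction I rule: infinite_finite_induct)
     (auto intro: square_integrable_add simp: square_integrable_def[of M "\<lambda>_. 0"])

lemma integral_cauchy_schwarz:
  assumes f: "square_integrable M f" and g: "square_integrable M g"
  shows "(LINT x|M. norm (f x) * norm (g x)) \<le>
    sqrt (LINT x|M. (norm (f x))\<^sup>2) * sqrt (LINT x|M. (norm (g x))\<^sup>2)"
proof -
  note [measurable] = f[THEN square_integrable_measurable] g[THEN square_integrable_measurable]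
  have "(\<integral>\<^sup>+x. ennreal (norm (f x)) * ennreal (norm (g x)) \<partial>M)\<^sup>2
      \<le> (\<integral>\<^sup>+x. (ennreal (norm (f x)))\<^sup>2 \<partial>M) * (\<integral>\<^sup>+x. (ennreal (norm (g x)))\<^sup>2 \<partial>M)"
    by (rule Cauchy_Schwarz_nn_integral) auto
  moreover have "(\<integral>\<^sup>+x. ennreal (norm (f x)) * ennreal (norm (g x)) \<partial>M)
      = ennreal (LINT x|M. norm (f x) * norm (g x))"
    unfolding ennreal_mult[symmetric, OF norm_ge_zero norm_ge_zero]
    by (intro nn_integral_eq_integral square_integrable_norm_mult f g AE_I2) auto
  moreover have "(\<integral>\<^sup>+x. (ennreal (norm (f x)))\<^sup>2 \<partial>M) = ennreal (LINT x|M. (norm (f x))\<^sup>2)"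
    unfolding ennreal_power[OF norm_ge_zero]
    using f by (intro nn_integral_eq_integral AE_I2) (auto simp: square_integrable_def)
  moreover have "(\<integral>\<^sup>+x. (ennreal (norm (g x)))\<^sup>2 \<partial>M) = ennreal (LINT x|M. (norm (g x))\<^sup>2)"
    unfolding ennreal_power[OF norm_ge_zero]
    using g by (intro nn_integral_eq_integral AE_I2) (auto simp: square_integrable_def)
  ultimately have "(LINT x|M. norm (f x) * norm (g x))\<^sup>2
      \<le> (LINT x|M. (norm (f x))\<^sup>2) * (LINT x|M. (norm (g x))\<^sup>2)"
    by (simp add: ennreal_power ennreal_mult[symmetric])
  then show ?thesis
    unfolding real_sqrt_mult[symmetric] by (rule real_le_rsqrt)
qed

lemma integral_cauchy_schwarz':
  assumes f: "square_integrable M f" and g: "square_integrable M g"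
  shows "norm (LINT x|M. f x * g x) \<le>
    sqrt (LINT x|M. (norm (f x))\<^sup>2) * sqrt (LINT x|M. (norm (g x))\<^sup>2)"
  using order_trans[OF integral_norm_bound integral_cauchy_schwarz[OF assms, folded norm_mult]] .

text \<open>The inner product space of square integrable functions is complete (Riesz--Fischer), so the
  expansion of \<open>g\<close> in a maximal orthonormal system converges to \<open>g\<close>. The partial sums \<open>h n\<close>
  below are so close to optimal that they converge almost everywhere; by Fatou's lemma the
  limit \<open>h\<close> is also their limit in the mean, and \<open>g - h\<close> is orthogonal to the system.\<close>

lemma L2_parseval_approx:
  fixes E :: "('x \<Rightarrow> complex) set"
  assumes sq: "\<And>e. e \<in> E \<Longrightarrow> square_integrable M e"
    and on: "\<And>e f. e \<in> E \<Longrightarrow> f \<in> E \<Longrightarrow> (LINT x|M. cnj (e x) * f x) = (if e = f then 1 else 0)"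
    and total: "\<And>f. square_integrable M f \<Longrightarrow> (\<And>e. e \<in> E \<Longrightarrow> (LINT x|M. cnj (e x) * f x) = 0)
      \<Longrightarrow> AE x in M. f x = 0"
    and g: "square_integrable M g" and "\<epsilon> > 0"
  shows "\<exists>F\<subseteq>E. finite F \<and>
    (LINT x|M. (norm (g x))\<^sup>2) \<le> \<epsilon> + (\<Sum>e\<in>F. (norm (LINT x|M. cnj (e x) * g x))\<^sup>2)"
proof -
  define c where "c e = (LINT x|M. cnj (e x) * g x)" for e
  define N where "N f = (LINT x|M. (norm (f x))\<^sup>2)" for f :: "'x \<Rightarrow> complex"
  define Q where "Q F = (\<Sum>e\<in>F. (norm (c e))\<^sup>2)" for F
  define s where "s F x = (\<Sum>e\<in>F. c e * e x)" for F x
  have s_sq: "square_integrable M (s F)" if "F \<subseteq> E" for F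
    unfolding s_def using that by (intro square_integrable_sum square_integrable_cmult sq) auto
  have N_cnj: "complex_of_real (N f) = (LINT x|M. cnj (f x) * f x)" if "square_integrable M f" for f
  proof -
    have "complex_of_real (N f) = (LINT x|M. complex_of_real ((norm (f x))\<^sup>2))"
      unfolding N_def by (rule integral_complex_of_real[symmetric])
    also have "\<dots> = (LINT x|M. cnj (f x) * f x)"
      by (intro Bochner_Integration.integral_cong refl) (metis complex_norm_square mult.commute)
    finally show ?thesis .
  qed
  have e_s: "(LINT x|M. cnj (e x) * s F x) = (if e \<in> F then c e else 0)"
    if "finite F" "F \<subseteq> E" "e \<in> E" for e F
  proof -
    have "(LINT x|M. cnj (e x) * s F x) = (LINT x|M. (\<Sum>f\<in>F. c f * (cnj (e x) * f x)))"
      unfolding s_def sum_distrib_left by (simp add: mult_ac)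
    also have "\<dots> = (\<Sum>f\<in>F. c f * (LINT x|M. cnj (e x) * f x))"
      using that sq by (subst Bochner_Integration.integral_sum)
        (auto intro!: integrable_mult_right square_integrable_mult square_integrable_cnj)
    also have "\<dots> = (\<Sum>f\<in>F. if f = e then c f else 0)"
      using that on by (intro sum.cong) (auto simp: subset_eq)
    finally show ?thesis using that by simp
  qed
  have f_s: "(LINT x|M. cnj (s F x) * f x) = (\<Sum>e\<in>F. cnj (c e) * (LINT x|M. cnj (e x) * f x))"
    if "finite F" "F \<subseteq> E" "square_integrable M f" for f F
  proof -
    have "(LINT x|M. cnj (s F x) * f x) = (LINT x|M. (\<Sum>e\<in>F. cnj (c e) * (cnj (e x) * f x)))"
      unfolding s_def cnj_sum sum_distrib_right by (simp add: mult_ac)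
    also have "\<dots> = (\<Sum>e\<in>F. cnj (c e) * (LINT x|M. cnj (e x) * f x))"
      using that sq by (subst Bochner_Integration.integral_sum)
        (auto intro!: integrable_mult_right square_integrable_mult square_integrable_cnj)
    finally show ?thesis .
  qed
  have Q_complex: "(\<Sum>e\<in>F. cnj (c e) * c e) = complex_of_real (Q F)" for F
    unfolding Q_def of_real_sum by (intro sum.cong refl) (metis complex_norm_square mult.commute)
  have N_s: "N (s F) = Q F" if "finite F" "F \<subseteq> E" for F
  proof -
    have "complex_of_real (N (s F)) = (\<Sum>e\<in>F. cnj (c e) * c e)"
      unfolding N_cnj[OF s_sq[OF that(2)]] f_s[OF that s_sq[OF that(2)]]
      using that by (intro sum.cong refl) (auto simp: e_s subset_eq)
    then show ?thesis unfolding Q_complex of_real_eq_iff .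
  qed
  have N_diff: "N (\<lambda>x. g x - s F x) = N g - Q F" if "finite F" "F \<subseteq> E" for F
  proof -
    note sF = s_sq[OF that(2)]
    have sg: "(LINT x|M. cnj (s F x) * g x) = complex_of_real (Q F)"
      using f_s[OF that g] Q_complex by (simp add: c_def)
    have "(LINT x|M. cnj (g x) * s F x) = (LINT x|M. cnj (cnj (s F x) * g x))"
      by (simp add: mult.commute)
    also have "\<dots> = cnj (LINT x|M. cnj (s F x) * g x)" by (rule Bochner_Integration.integral_cnj)
    finally have gs: "(LINT x|M. cnj (g x) * s F x) = complex_of_real (Q F)" using sg by simp
    note int = square_integrable_mult[OF square_integrable_cnj[OF g] g]
      square_integrable_mult[OF square_integrable_cnj[OF g] sF]
      square_integrable_mult[OF square_integrable_cnj[OF sF] g]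
      square_integrable_mult[OF square_integrable_cnj[OF sF] sF]
    have "complex_of_real (N (\<lambda>x. g x - s F x))
        = (LINT x|M. (cnj (g x) * g x - cnj (g x) * s F x) - (cnj (s F x) * g x - cnj (s F x) * s F x))"
      unfolding N_cnj[OF square_integrable_diff[OF g sF]] by (simp add: algebra_simps)
    also have "\<dots> = complex_of_real (N g - Q F)"
      using int N_cnj[OF g] N_cnj[OF sF] N_s[OF that] gs sg by simp
    finally show ?thesis unfolding of_real_eq_iff .
  qed
  have N_nonneg: "N f \<ge> 0" for f unfolding N_def by simp
  have Q_le: "Q F \<le> N g" if "finite F" "F \<subseteq> E" for F
    using N_diff[OF that] N_nonneg[of "\<lambda>x. g x - s F x"] by linarith
  define A where "A = Q ` {F. finite F \<and> F \<subseteq> E}"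
  define S where "S = Sup A"
  have bdd: "bdd_above A" unfolding A_def using Q_le by (auto intro!: bdd_aboveI)
  have ne: "A \<noteq> {}" unfolding A_def by auto
  have Q_S: "Q F \<le> S" if "finite F" "F \<subseteq> E" for F
    unfolding S_def using that by (intro cSup_upper bdd) (auto simp: A_def)
  \<comment> \<open>The errors \<open>4\<^sup>-\<^sup>n\<close> make \<open>\<Sum> 2\<^sup>n \<parallel>h (n+1) - h n\<parallel>\<^sup>2\<close> finite, which forces convergence almost everywhere.\<close>
  have "\<exists>F. finite F \<and> F \<subseteq> E \<and> S - (1/4)^n < Q F" for n :: nat
  proof -
    have "S - (1/4)^n < Sup A" unfolding S_def by simp
    then show ?thesis using less_cSup_iff[OF ne bdd] by (auto simp: A_def)
  qed
  then obtain F' :: "nat \<Rightarrow> _" where F': "\<And>n. finite (F' n)" "\<And>n. F' n \<subseteq> E" "\<And>n. S - (1/4)^n < Q (F' n)"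
    by metis
  define F where "F n = (\<Union>i\<le>n. F' i)" for n
  have F: "finite (F n)" "F n \<subseteq> E" for n using F' by (auto simp: F_def)
  have F_mono: "F m \<subseteq> F n" if "m \<le> n" for m n
    unfolding F_def using that by (intro UN_mono) auto
  have Q_mono: "Q G \<le> Q G'" if "G \<subseteq> G'" "finite G'" for G G'
    unfolding Q_def using that by (intro sum_mono2) auto
  have F_close: "S - (1/4)^n \<le> Q (F n)" for n
    using F'(3)[of n] Q_mono[of "F' n" "F n"] F by (force simp: F_def)
  define h where "h n = s (F n)" for n
  have h_sq: "square_integrable M (h n)" for n unfolding h_def by (rule s_sq[OF F(2)])
  have N_h: "N (\<lambda>x. h n x - h m x) \<le> (1/4)^m" if "m \<le> n" for m n
  proof -
    have "h n x - h m x = s (F n - F m) x" for x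
      unfolding h_def s_def using F F_mono[OF that] by (simp add: sum_diff)
    then have "N (\<lambda>x. h n x - h m x) = Q (F n - F m)"
      using N_s[OF finite_Diff[OF F(1)] order_trans[OF Diff_subset F(2)]] by simp
    also have "\<dots> = Q (F n) - Q (F m)" unfolding Q_def using F F_mono[OF that] by (simp add: sum_diff)
    also have "\<dots> \<le> (1/4)^m" using F_close[of m] Q_S[OF F, of n] by linarith
    finally show ?thesis .
  qed
  have nn_N: "(\<integral>\<^sup>+x. ennreal ((norm (f x))\<^sup>2) \<partial>M) = ennreal (N f)" if "square_integrable M f" for f
    unfolding N_def using that by (intro nn_integral_eq_integral) (auto simp: square_integrable_def)
  note [measurable] = h_sq[THEN square_integrable_measurable] g[THEN square_integrable_measurable]
  have conv: "AE x in M. convergent (\<lambda>n. h n x)"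
  proof -
    let ?t = "\<lambda>n x. 2^n * (norm (h (Suc n) x - h n x))\<^sup>2"
    have "(\<integral>\<^sup>+x. (\<Sum>n. ennreal (?t n x)) \<partial>M) = (\<Sum>n. \<integral>\<^sup>+x. ennreal (?t n x) \<partial>M)"
      by (rule nn_integral_suminf) measurable
    also have "\<dots> \<le> (\<Sum>n. ennreal ((1/2)^n))"
    proof (rule suminf_le)
      fix n
      have "(\<integral>\<^sup>+x. ennreal (?t n x) \<partial>M) = 2^n * ennreal (N (\<lambda>x. h (Suc n) x - h n x))"
        unfolding nn_N[OF square_integrable_diff[OF h_sq h_sq], symmetric]
        by (subst nn_integral_cmult[symmetric]) (auto simp: ennreal_mult ennreal_power[symmetric])
      also have "\<dots> = ennreal (2^n * N (\<lambda>x. h (Suc n) x - h n x))"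
        using N_nonneg by (simp add: ennreal_mult ennreal_power[symmetric])
      also have "\<dots> \<le> ennreal (2^n * (1/4)^n)"
        using N_h[of n "Suc n"] by (intro ennreal_leI mult_left_mono) auto
      also have "2^n * (1/4)^n = (1/2 :: real)^n" unfolding power_mult_distrib[symmetric] by simp
      finally show "(\<integral>\<^sup>+x. ennreal (?t n x) \<partial>M) \<le> ennreal ((1/2)^n)" .
    qed auto
    also have "\<dots> = ennreal (\<Sum>n. (1/2)^n)" by (rule suminf_ennreal2) auto
    also have "\<dots> < \<infinity>" by simp
    finally have "AE x in M. (\<Sum>n. ennreal (?t n x)) \<noteq> \<infinity>"
      by (intro nn_integral_PInf_AE) auto
    then show ?thesis
    proof eventually_elim
      case (elim x)
      have sm: "summable (\<lambda>n. ?t n x)" using elim by (intro summable_suminf_not_top) auto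
      have "summable (\<lambda>n. h (Suc n) x - h n x)"
      proof (rule summable_comparison_test')
        show "summable (\<lambda>n. (1/2)^n + ?t n x)" using sm by (intro summable_add) auto
        fix n :: nat
        define a where "a = norm (h (Suc n) x - h n x)"
        \<comment> \<open>the inequality \<open>2 a \<le> 2\<^sup>-\<^sup>n + 2\<^sup>n a\<^sup>2\<close>\<close>
        have "0 \<le> (1 - 2^n * a)\<^sup>2 / 2^n" by simp
        also have "\<dots> = (1/2)^n + 2^n * a\<^sup>2 - 2 * a"
          by (simp add: power2_eq_square field_simps power_divide)
        finally have "a \<le> (1/2)^n + 2^n * a\<^sup>2" using norm_ge_zero[of "h (Suc n) x - h n x"]
          unfolding a_def by linarith
        then show "norm (h (Suc n) x - h n x) \<le> (1/2)^n + ?t n x" by (simp add: a_def)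
      qed
      then have "convergent (\<lambda>n. \<Sum>i<n. h (Suc i) x - h i x)"
        by (rule summable_LIMSEQ[THEN convergentI])
      then have "convergent (\<lambda>n. h n x - h 0 x)"
        unfolding sum_lessThan_telescope[of "\<lambda>i. h i x"] .
      then have "convergent (\<lambda>n. (h n x - h 0 x) + h 0 x)"
        by (intro convergent_add convergent_const)
      then show ?case by simp
    qed
  qed
  define k where "k x = lim (\<lambda>n. h n x)" for x
  have k_meas [measurable]: "k \<in> borel_measurable M" unfolding k_def by measurable
  have k_lim: "AE x in M. (\<lambda>n. h n x) \<longlonglongrightarrow> k x"
    using conv by (auto simp: convergent_LIMSEQ_iff k_def)
  have nn_k: "(\<integral>\<^sup>+x. ennreal ((norm (k x - h m x))\<^sup>2) \<partial>M) \<le> ennreal ((1/4)^m)" for m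
  proof -
    have "(\<integral>\<^sup>+x. ennreal ((norm (k x - h m x))\<^sup>2) \<partial>M)
        = (\<integral>\<^sup>+x. liminf (\<lambda>n. ennreal ((norm (h n x - h m x))\<^sup>2)) \<partial>M)"
    proof (rule nn_integral_cong_AE, use k_lim in eventually_elim)
      fix x assume "(\<lambda>n. h n x) \<longlonglongrightarrow> k x"
      then have "(\<lambda>n. ennreal ((norm (h n x - h m x))\<^sup>2)) \<longlonglongrightarrow> ennreal ((norm (k x - h m x))\<^sup>2)"
        by (intro tendsto_intros)
      then show "ennreal ((norm (k x - h m x))\<^sup>2) = liminf (\<lambda>n. ennreal ((norm (h n x - h m x))\<^sup>2))"
        by (intro lim_imp_Liminf[symmetric]) auto
    qed
    also have "\<dots> \<le> liminf (\<lambda>n. \<integral>\<^sup>+x. ennreal ((norm (h n x - h m x))\<^sup>2) \<partial>M)"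
      by (rule nn_integral_liminf) measurable
    also have "\<dots> \<le> ennreal ((1/4)^m)"
    proof (rule Liminf_le)
      show "eventually (\<lambda>n. (\<integral>\<^sup>+x. ennreal ((norm (h n x - h m x))\<^sup>2) \<partial>M) \<le> ennreal ((1/4)^m)) sequentially"
        using eventually_ge_at_top[of m]
        by eventually_elim (simp add: nn_N[OF square_integrable_diff[OF h_sq h_sq]] N_h ennreal_leI)
    qed simp
    finally show ?thesis .
  qed
  have kh_sq: "square_integrable M (\<lambda>x. k x - h m x)" for m
    unfolding square_integrable_def
  proof
    show "integrable M (\<lambda>x. (norm (k x - h m x))\<^sup>2)"
      using order.strict_trans1[OF nn_k[of m] ennreal_less_top] by (intro integrableI_bounded) auto
  qed measurable
  have N_k: "N (\<lambda>x. k x - h m x) \<le> (1/4)^m" for m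
    using nn_k[of m] unfolding nn_N[OF kh_sq] by simp
  have k_sq: "square_integrable M k"
    using square_integrable_add[OF kh_sq[of 0] h_sq[of 0]] by simp
  have "(LINT x|M. cnj (e x) * (g x - k x)) = 0" if e: "e \<in> E" for e
  proof -
    have "norm (LINT x|M. cnj (e x) * (g x - k x)) \<le> 2 * (1/2)^n" for n
    proof -
      have le: "norm (LINT x|M. cnj (e x) * (g x - h n x)) \<le> (1/2)^n"
      proof -
        have "(LINT x|M. cnj (e x) * (g x - h n x)) = c e - (if e \<in> F n then c e else 0)"
          unfolding e_s[OF F e, symmetric] unfolding c_def h_def right_diff_distrib
          by (intro Bochner_Integration.integral_diff square_integrable_mult square_integrable_cnj
              sq[OF e] g s_sq F)
        moreover have "norm (c e) \<le> (1/2)^n" if "e \<notin> F n"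
        proof -
          have "Q (insert e (F n)) = (norm (c e))\<^sup>2 + Q (F n)" using that F by (simp add: Q_def)
          moreover have "Q (insert e (F n)) \<le> S" using F e by (intro Q_S) auto
          ultimately have "(norm (c e))\<^sup>2 \<le> (1/4)^n" using F_close[of n] by linarith
          also have "(1/4 :: real)^n = ((1/2)^n)\<^sup>2" by (simp add: power2_eq_square flip: power_mult_distrib)
          finally show ?thesis by (rule power2_le_imp_le) simp
        qed
        ultimately show ?thesis by auto
      qed
      have "norm (LINT x|M. cnj (e x) * (k x - h n x)) \<le> sqrt (N (\<lambda>x. cnj (e x))) * sqrt (N (\<lambda>x. k x - h n x))"
        unfolding N_def by (rule integral_cauchy_schwarz'[OF square_integrable_cnj[OF sq[OF e]] kh_sq])
      also have "N (\<lambda>x. cnj (e x)) = 1"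
        using N_cnj[OF sq[OF e]] on[OF e e] unfolding N_def complex_mod_cnj
        by (metis of_real_eq_1_iff)
      also have "sqrt 1 * sqrt (N (\<lambda>x. k x - h n x)) \<le> sqrt ((1/4)^n)" using N_k[of n] by simp
      also have "sqrt ((1/4)^n) = (1/2 :: real)^n"
        by (rule real_sqrt_unique) (simp_all add: power2_eq_square flip: power_mult_distrib)
      finally have le': "norm (LINT x|M. cnj (e x) * (k x - h n x)) \<le> (1/2)^n" .
      have "(LINT x|M. cnj (e x) * (g x - k x))
          = (LINT x|M. cnj (e x) * (g x - h n x) - cnj (e x) * (k x - h n x))"
        by (simp add: algebra_simps)
      also have "\<dots> = (LINT x|M. cnj (e x) * (g x - h n x)) - (LINT x|M. cnj (e x) * (k x - h n x))"
        by (intro Bochner_Integration.integral_diff square_integrable_mult square_integrable_cnj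
            sq[OF e] square_integrable_diff[OF g h_sq] kh_sq)
      finally show ?thesis
        using norm_triangle_ineq4[of "LINT x|M. cnj (e x) * (g x - h n x)"
            "LINT x|M. cnj (e x) * (k x - h n x)"] le le' by simp
    qed
    note le = this
    have lim: "(\<lambda>n. 2 * (1/2 :: real)^n) \<longlonglongrightarrow> 2 * 0"
      by (intro tendsto_mult tendsto_const LIMSEQ_power_zero) simp
    have "norm (LINT x|M. cnj (e x) * (g x - k x)) \<le> 2 * 0"
      by (rule LIMSEQ_le_const[OF lim]) (use le in blast)
    then show ?thesis by simp
  qed
  then have gk: "AE x in M. g x - k x = 0" by (rule total[OF square_integrable_diff[OF g k_sq]])
  obtain n where n: "(1/4 :: real)^n < \<epsilon>"
    using real_arch_pow_inv[OF \<open>\<epsilon> > 0\<close>, of "1/4"] by auto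
  have "N g - Q (F n) = N (\<lambda>x. g x - h n x)" unfolding h_def using N_diff[OF F] by simp
  also have "\<dots> = N (\<lambda>x. k x - h n x)"
    unfolding N_def using gk by (intro integral_cong_AE) (auto elim!: eventually_mono)
  also have "\<dots> \<le> \<epsilon>" using N_k[of n] n by linarith
  finally have "N g \<le> \<epsilon> + Q (F n)" by linarith
  then show ?thesis using F[of n] unfolding N_def Q_def c_def by blast
qed

section \<open>Admissible systems\<close>

abbreviation halfline :: "real measure"
  where "halfline \<equiv> restrict_space lborel {0<..}"

lemma set_integrable_halfline: "set_integrable lborel {0<..} f \<longleftrightarrow> integrable halfline f"
  for f :: "real \<Rightarrow> 'b::{banach, second_countable_topology}"
  by (simp add: set_integrable_def integrable_restrict_space)

lemma set_integral_halfline: "(LINT t:{0<..}|lborel. f t) = (LINT t|halfline. f t)"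
  for f :: "real \<Rightarrow> 'b::{banach, second_countable_topology}"
  by (simp add: set_lebesgue_integral_def integral_restrict_space)

lemma L2_halfline_iff: "f \<in> L2_halfline \<longleftrightarrow> square_integrable halfline f"
  by (simp add: L2_halfline_def square_integrable_def set_integrable_halfline
      set_borel_measurable_def borel_measurable_restrict_space_iff)

lemma borel_measurable_halfline:
  fixes g :: "real \<Rightarrow> 'b::{banach, second_countable_topology}"
  assumes "continuous_on {0..} g"
  shows "g \<in> borel_measurable halfline"
  using borel_measurable_continuous_on_restrict[OF continuous_on_subset[OF assms, of "{0<..}"]]
  by (auto simp: measurable_cong_sets[OF sets_restrict_space_cong[OF sets_lborel] refl] subset_eq)

text \<open>The functional is tested on \<open>g\<close> itself, cut off at \<open>n\<close> because square integrability is not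
  yet known; the bounds do not depend on \<open>n\<close>.\<close>

lemma square_integrable_halfline_by_duality:
  fixes g :: "real \<Rightarrow> complex"
  assumes g: "continuous_on {0..} g" and "K \<ge> 0"
    and bound: "\<And>f. square_integrable halfline f \<Longrightarrow>
      norm (LINT t|halfline. cnj (f t) * g t) \<le> K * sqrt (LINT t|halfline. (norm (f t))\<^sup>2)"
  shows "square_integrable halfline g" "(LINT t|halfline. (norm (g t))\<^sup>2) \<le> K\<^sup>2"
proof -
  note meas [measurable] = borel_measurable_halfline[OF g]
  have [measurable]: "(\<lambda>t. t) \<in> borel_measurable halfline"
    by (intro measurable_restrict_space1) simp
  define f where "f n t = (if t \<le> real n then g t else 0)" for n :: nat and t
  have f_meas [measurable]: "f n \<in> borel_measurable halfline" for n
    unfolding f_def by measurable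
  have f_int: "integrable halfline (\<lambda>t. (norm (f n t))\<^sup>2)" for n
  proof -
    have "continuous_on {0..real n} (\<lambda>t. (norm (g t))\<^sup>2)"
      by (intro continuous_intros continuous_on_subset[OF g]) auto
    then have "set_integrable lborel {0..real n} (\<lambda>t. (norm (g t))\<^sup>2)"
      by (rule borel_integrable_atLeastAtMost')
    then have "set_integrable lborel {0<..real n} (\<lambda>t. (norm (g t))\<^sup>2)"
      by (rule set_integrable_subset) auto
    then have "set_integrable lborel {0<..} (\<lambda>t. (norm (f n t))\<^sup>2)"
      unfolding set_integrable_def
      by (rule Bochner_Integration.integrable_cong[THEN iffD1, rotated -1])
        (auto simp: f_def indicator_def)
    then show ?thesis by (simp add: set_integrable_halfline)
  qed
  then have f_sq: "square_integrable halfline (f n)" for n by (simp add: square_integrable_def)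
  have f_le: "(LINT t|halfline. (norm (f n t))\<^sup>2) \<le> K\<^sup>2" for n
  proof -
    let ?I = "LINT t|halfline. (norm (f n t))\<^sup>2"
    have "(LINT t|halfline. cnj (f n t) * g t) = (LINT t|halfline. complex_of_real ((norm (f n t))\<^sup>2))"
      by (intro Bochner_Integration.integral_cong refl)
        (auto simp: f_def complex_norm_square mult.commute simp del: of_real_power)
    also have "\<dots> = complex_of_real ?I" by (rule integral_complex_of_real)
    finally have "norm (complex_of_real ?I) \<le> K * sqrt ?I" using bound[OF f_sq[of n]] by simp
    moreover have I0: "?I \<ge> 0" by simp
    ultimately have "sqrt ?I * sqrt ?I \<le> K * sqrt ?I" unfolding norm_of_real by simp
    then have "sqrt ?I \<le> K" using \<open>K \<ge> 0\<close> I0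
      by (metis mult_right_le_imp_le order_le_less real_sqrt_ge_zero)
    then show ?thesis by (rule sqrt_le_D)
  qed
  have "(\<integral>\<^sup>+t. ennreal ((norm (g t))\<^sup>2) \<partial>halfline)
      = (\<integral>\<^sup>+t. liminf (\<lambda>n. ennreal ((norm (f n t))\<^sup>2)) \<partial>halfline)"
  proof (rule nn_integral_cong)
    fix t :: real
    have "eventually (\<lambda>n. f n t = g t) sequentially"
      using eventually_ge_at_top[of "nat \<lceil>t\<rceil>"]
      by eventually_elim (auto simp: f_def)
    then have "eventually (\<lambda>n. ennreal ((norm (f n t))\<^sup>2) = ennreal ((norm (g t))\<^sup>2)) sequentially"
      by eventually_elim simp
    then show "ennreal ((norm (g t))\<^sup>2) = liminf (\<lambda>n. ennreal ((norm (f n t))\<^sup>2))"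
      by (intro lim_imp_Liminf[symmetric] tendsto_eventually) auto
  qed
  also have "\<dots> \<le> liminf (\<lambda>n. \<integral>\<^sup>+t. ennreal ((norm (f n t))\<^sup>2) \<partial>halfline)"
    by (rule nn_integral_liminf) measurable
  also have "\<dots> \<le> ennreal (K\<^sup>2)"
  proof (rule Liminf_le)
    show "eventually (\<lambda>n. (\<integral>\<^sup>+t. ennreal ((norm (f n t))\<^sup>2) \<partial>halfline) \<le> ennreal (K\<^sup>2)) sequentially"
      using f_le by (intro always_eventually allI) (simp add: nn_integral_eq_integral[OF f_int] ennreal_leI)
  qed simp
  finally have nn: "(\<integral>\<^sup>+t. ennreal ((norm (g t))\<^sup>2) \<partial>halfline) \<le> ennreal (K\<^sup>2)" .
  have int: "integrable halfline (\<lambda>t. (norm (g t))\<^sup>2)"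
    using order.strict_trans1[OF nn ennreal_less_top] by (intro integrableI_bounded) auto
  then show "square_integrable halfline g" by (simp add: square_integrable_def)
  show "(LINT t|halfline. (norm (g t))\<^sup>2) \<le> K\<^sup>2"
    using nn by (simp add: nn_integral_eq_integral[OF int])
qed

text \<open>The Hilbert--Schmidt norm can also be computed from the adjoint: if \<open>g e\<close> represents the
  functional \<open>f \<mapsto> \<langle>e, T f\<rangle>\<close>, then by Parseval's identity in $L^2$ and Bessel's inequality the
  squared norms of the \<open>g e\<close> sum up to at most those of the \<open>T f\<close>.\<close>

lemma hilbert_schmidt_kernel_bound:
  fixes T :: "(real \<Rightarrow> complex) \<Rightarrow> 'a::complex_hilbert"
  assumes on: "orthonormal E" and E': "L2_orthonormal_basis E'"
    and summ: "(\<lambda>f. (norm (T f))\<^sup>2) summable_on E'"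
    and g: "\<And>e. square_integrable halfline (g e)"
    and T: "\<And>e f. f \<in> E' \<Longrightarrow> norm (LINT t|halfline. cnj (f t) * g e t) = norm (cinner e (T f))"
    and G: "finite G" "G \<subseteq> E"
  shows "(\<Sum>e\<in>G. LINT t|halfline. (norm (g e t))\<^sup>2) \<le> (\<Sum>\<^sub>\<infinity>f\<in>E'. (norm (T f))\<^sup>2)"
proof (rule field_le_epsilon)
  fix \<epsilon> :: real assume "\<epsilon> > 0"
  define \<eta> where "\<eta> = \<epsilon> / (card G + 1)"
  have \<eta>: "\<eta> > 0" "card G * \<eta> \<le> \<epsilon>" using \<open>\<epsilon> > 0\<close> by (auto simp: \<eta>_def field_simps)
  let ?p = "\<lambda>e f. (norm (LINT t|halfline. cnj (f t) * g e t))\<^sup>2"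
  have "\<exists>F\<subseteq>E'. finite F \<and> (LINT t|halfline. (norm (g e t))\<^sup>2) \<le> \<eta> + (\<Sum>f\<in>F. ?p e f)" for e
  proof (rule L2_parseval_approx)
    show "square_integrable halfline f" if "f \<in> E'" for f
      using that E' by (auto simp: L2_orthonormal_basis_def L2_halfline_iff)
    show "(LINT t|halfline. cnj (e t) * f t) = (if e = f then 1 else 0)" if "e \<in> E'" "f \<in> E'" for e f
      using that E'
      by (auto simp: L2_orthonormal_basis_def L2_inner_halfline_def set_integral_halfline cinner_complex_def)
    show "AE t in halfline. f t = 0"
      if "square_integrable halfline f" "\<And>e. e \<in> E' \<Longrightarrow> (LINT t|halfline. cnj (e t) * f t) = 0" for f
      using that E'
      by (auto simp: L2_orthonormal_basis_def L2_inner_halfline_def set_integral_halfline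
          cinner_complex_def L2_halfline_iff AE_restrict_space_iff)
  qed (use g \<eta> in auto)
  from choice[OF allI[OF this]] obtain F where "\<forall>e. F e \<subseteq> E' \<and> finite (F e) \<and>
    (LINT t|halfline. (norm (g e t))\<^sup>2) \<le> \<eta> + (\<Sum>f\<in>F e. ?p e f)" ..
  then have F: "\<And>e. F e \<subseteq> E'" "\<And>e. finite (F e)"
    "\<And>e. (LINT t|halfline. (norm (g e t))\<^sup>2) \<le> \<eta> + (\<Sum>f\<in>F e. ?p e f)" by blast+
  define F' where "F' = (\<Union>e\<in>G. F e)"
  have F': "finite F'" "F' \<subseteq> E'" using F(1,2) G by (auto simp: F'_def)
  have "(\<Sum>e\<in>G. LINT t|halfline. (norm (g e t))\<^sup>2) \<le> (\<Sum>e\<in>G. \<eta> + (\<Sum>f\<in>F'. ?p e f))"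
  proof (rule sum_mono)
    fix e assume "e \<in> G"
    then have "(\<Sum>f\<in>F e. ?p e f) \<le> (\<Sum>f\<in>F'. ?p e f)"
      using F' by (intro sum_mono2) (auto simp: F'_def)
    then show "(LINT t|halfline. (norm (g e t))\<^sup>2) \<le> \<eta> + (\<Sum>f\<in>F'. ?p e f)" using F(3)[of e] by linarith
  qed
  also have "\<dots> = card G * \<eta> + (\<Sum>f\<in>F'. \<Sum>e\<in>G. ?p e f)"
    by (simp add: sum.distrib sum.swap[of _ F' G])
  also have "(\<Sum>f\<in>F'. \<Sum>e\<in>G. ?p e f) \<le> (\<Sum>f\<in>F'. (norm (T f))\<^sup>2)"
    using F' T bessel_inequality[OF on G] by (intro sum_mono) (auto simp: subset_eq)
  also have "\<dots> \<le> (\<Sum>\<^sub>\<infinity>f\<in>E'. (norm (T f))\<^sup>2)"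
    using F' by (intro finite_sum_le_infsum summ) auto
  finally show "(\<Sum>e\<in>G. LINT t|halfline. (norm (g e t))\<^sup>2) \<le> (\<Sum>\<^sub>\<infinity>f\<in>E'. (norm (T f))\<^sup>2) + \<epsilon>"
    using \<eta>(2) by linarith
qed

text \<open>Admissibility for scalar input and output, expressed through the functions \<open>t \<mapsto> C S\<^sub>t h\<close> and
  \<open>t \<mapsto> \<langle>g, S\<^sub>t b\<rangle>\<close> with \<open>b = B 1\<close>. The constant \<open>L\<close> bounds the semigroup and its compositions
  with \<open>b\<close> and \<open>C\<close>; \<open>M\<close> bounds both the operator norms and the Hilbert--Schmidt norms of
  \<^term>\<open>Theta0 S C\<close> and \<^term>\<open>Xi0 S B\<close>.\<close>

locale scalar_system =
  fixes S :: "real \<Rightarrow> 'a::{complex_hilbert, second_countable_topology} \<Rightarrow> 'a"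
    and b :: 'a and C :: "'a \<Rightarrow> complex" and L M :: real
  assumes S_clinear: "0 \<le> t \<Longrightarrow> bounded_clinear (S t)"
    and S_zero: "S 0 h = h"
    and S_add: "0 \<le> s \<Longrightarrow> 0 \<le> t \<Longrightarrow> S (s + t) h = S s (S t h)"
    and S_continuous: "continuous_on {0..} (\<lambda>t. S t h)"
    and C_clinear: "bounded_clinear C"
    and L_pos: "0 < L"
    and S_bound: "0 \<le> t \<Longrightarrow> norm (S t h) \<le> L * norm h"
    and b_bound: "0 \<le> t \<Longrightarrow> norm (S t b) \<le> L"
    and C_bound: "0 \<le> t \<Longrightarrow> norm (C (S t h)) \<le> L * norm h"
    and M_nonneg: "0 \<le> M"
    and C_sq: "square_integrable halfline (\<lambda>t. C (S t h))"
    and C_sq_bound: "(LINT t|halfline. (norm (C (S t h)))\<^sup>2) \<le> (M * norm h)\<^sup>2"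
    and b_sq: "square_integrable halfline (\<lambda>t. cinner g (S t b))"
    and b_sq_bound: "(LINT t|halfline. (norm (cinner g (S t b)))\<^sup>2) \<le> (M * norm g)\<^sup>2"
    and C_hs: "orthonormal G \<Longrightarrow> finite G \<Longrightarrow> (\<Sum>e\<in>G. LINT t|halfline. (norm (C (S t e)))\<^sup>2) \<le> M\<^sup>2"
    and b_hs: "orthonormal G \<Longrightarrow> finite G \<Longrightarrow> (\<Sum>e\<in>G. LINT t|halfline. (norm (cinner e (S t b)))\<^sup>2) \<le> M\<^sup>2"
    and Cb_integrable: "integrable halfline (\<lambda>t. C (S t h) *\<^sub>C S t b)"

text \<open>The adjoints of \<^term>\<open>Theta0 S C\<close> and \<^term>\<open>Xi0 S B\<close> are \<open>h \<mapsto> (t \<mapsto> C S\<^sub>t h)\<close> and \<open>g \<mapsto> (t \<mapsto> cnj \<langle>g,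
  S\<^sub>t b\<rangle>)\<close>, so the estimates are those of bounded, and of Hilbert--Schmidt, operators for the
  adjoints.\<close>

lemma admissible22_imp_scalar_system:
  fixes D :: "'a::{complex_hilbert, second_countable_topology} set" and B :: "complex \<Rightarrow> 'a"
  assumes adm: "admissible22 D A S B C"
  obtains L M where "scalar_system S (B 1) C L M"
proof -
  have c0: "c0_semigroup S" and bdd: "bdd_above ((\<lambda>t. onorm (S t)) ` {0..})"
    and Bc: "bounded_clinear B" and Cc: "bounded_clinear C"
    and \<Theta>_int: "\<And>f. f \<in> L2_halfline \<Longrightarrow> set_integrable lborel {0<..} (\<lambda>s. cadjoint (S s) (cadjoint C (f s)))"
    and \<Xi>_int: "\<And>f. f \<in> L2_halfline \<Longrightarrow> set_integrable lborel {0<..} (\<lambda>s. S s (B (f s)))"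
    and \<Theta>: "hilbert_schmidt_L2 (Theta0 S C)" and \<Xi>: "hilbert_schmidt_L2 (Xi0 S B)"
    using adm unfolding admissible22_def linear_system_def generates_def by auto
  have S_clinear: "\<And>t. 0 \<le> t \<Longrightarrow> bounded_clinear (S t)"
    and S_zero: "\<And>h. S 0 h = h"
    and S_add: "\<And>s t h. 0 \<le> s \<Longrightarrow> 0 \<le> t \<Longrightarrow> S (s + t) h = S s (S t h)"
    and S_cont: "\<And>h. continuous_on {0..} (\<lambda>t. S t h)"
    using c0 unfolding c0_semigroup_def by auto
  note S_lin = S_clinear[THEN bounded_clinear_imp_linear]
  note C_lin = Cc[THEN bounded_clinear_imp_linear]
  obtain L\<^sub>0 where L\<^sub>0: "\<And>t. 0 \<le> t \<Longrightarrow> onorm (S t) \<le> L\<^sub>0" using bdd by (auto simp: bdd_above_def)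
  have S_le: "norm (S t h) \<le> \<bar>L\<^sub>0\<bar> * norm h" if "0 \<le> t" for t h
    by (rule order_trans[OF onorm[OF S_lin[OF that]]])
      (use L\<^sub>0[OF that] in \<open>intro mult_right_mono, auto\<close>)
  obtain Kc where Kc: "\<And>h. norm (C h) \<le> norm h * Kc" "Kc > 0"
    using bounded_linear.pos_bounded[OF C_lin] by blast
  define L where "L = 1 + \<bar>L\<^sub>0\<bar> * (1 + norm (B 1) + Kc)"
  have L0: "0 < L" using Kc(2) by (simp add: L_def add_pos_nonneg)
  have LS: "norm (S t h) \<le> L * norm h" if "0 \<le> t" for t h
  proof -
    have "\<bar>L\<^sub>0\<bar> \<le> L" using Kc(2) by (simp add: L_def algebra_simps)
    then show ?thesis using S_le[OF that, of h] by (meson mult_right_mono norm_ge_zero order_trans)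
  qed
  have Lb: "norm (S t (B 1)) \<le> L" if "0 \<le> t" for t
  proof -
    have "\<bar>L\<^sub>0\<bar> * norm (B 1) \<le> L" using Kc(2) by (simp add: L_def algebra_simps)
    then show ?thesis using S_le[OF that, of "B 1"] by linarith
  qed
  have LC: "norm (C (S t h)) \<le> L * norm h" if "0 \<le> t" for t h
  proof -
    have "norm (C (S t h)) \<le> \<bar>L\<^sub>0\<bar> * norm h * Kc"
      using Kc S_le[OF that, of h] by (meson mult_right_mono order_trans less_imp_le)
    also have "\<dots> \<le> L * norm h"
      unfolding L_def using Kc(2) by (simp add: algebra_simps)
    finally show ?thesis .
  qed
  have B_eq: "B z = z *\<^sub>C B 1" for z
    using bounded_clinear_scaleC[OF Bc, of z 1] by (simp add: scaleC_complex_def)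
  have S_B: "S s (B z) = z *\<^sub>C S s (B 1)" if "0 \<le> s" for s z
    by (subst B_eq) (rule bounded_clinear_scaleC[OF S_clinear[OF that]])
  have C_cont: "continuous_on {0..} (\<lambda>t. C (S t h))" for h
    by (rule bounded_linear.continuous_on[OF C_lin S_cont])
  have b_cont: "continuous_on {0..} (\<lambda>t. cinner g (S t (B 1)))" for g
    by (rule continuous_on_cinner[OF continuous_on_const S_cont])
  have \<Theta>_adj: "cinner h (Theta0 S C f) = cnj (LINT t|halfline. cnj (f t) * C (S t h))"
    if "square_integrable halfline f" for f h
  proof -
    have "integrable halfline (\<lambda>s. cadjoint (S s) (cadjoint C (f s)))"
      using \<Theta>_int[of f] that by (simp add: L2_halfline_iff set_integrable_halfline)
    then have "cinner h (Theta0 S C f) = (LINT s|halfline. cinner h (cadjoint (S s) (cadjoint C (f s))))"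
      unfolding Theta0_def set_integral_halfline
      by (rule integral_bounded_linear[OF bounded_linear_cinner_right, symmetric])
    also have "\<dots> = (LINT s|halfline. cnj (cnj (f s) * C (S s h)))"
      by (intro Bochner_Integration.integral_cong refl)
        (auto simp: space_restrict_space cinner_cadjoint[OF S_clinear] cinner_cadjoint[OF Cc]
          cinner_complex_def mult.commute)
    also have "\<dots> = cnj (LINT t|halfline. cnj (f t) * C (S t h))"
      by (rule Bochner_Integration.integral_cnj)
    finally show ?thesis .
  qed
  have \<Xi>_adj: "cinner h (Xi0 S B f) = (LINT t|halfline. f t * cinner h (S t (B 1)))"
    if "square_integrable halfline f" for f h
  proof -
    have "integrable halfline (\<lambda>s. S s (B (f s)))"
      using \<Xi>_int[of f] that by (simp add: L2_halfline_iff set_integrable_halfline)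
    then have "cinner h (Xi0 S B f) = (LINT s|halfline. cinner h (S s (B (f s))))"
      unfolding Xi0_def set_integral_halfline
      by (rule integral_bounded_linear[OF bounded_linear_cinner_right, symmetric])
    also have "\<dots> = (LINT t|halfline. f t * cinner h (S t (B 1)))"
    proof (intro Bochner_Integration.integral_cong refl)
      fix s assume "s \<in> space halfline"
      then have "0 \<le> s" by (simp add: space_restrict_space)
      then show "cinner h (S s (B (f s))) = f s * cinner h (S s (B 1))"
        by (simp only: S_B[of s "f s"] cinner_scaleC_right)
    qed
    finally show ?thesis .
  qed
  have L2n: "L2_norm_halfline f = sqrt (LINT t|halfline. (norm (f t))\<^sup>2)" for f :: "real \<Rightarrow> complex"
    by (simp add: L2_norm_halfline_def set_integral_halfline)
  obtain K\<^sub>1 where "\<forall>f\<in>L2_halfline. norm (Theta0 S C f) \<le> K\<^sub>1 * L2_norm_halfline f"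
    using \<Theta> unfolding hilbert_schmidt_L2_def by blast
  then have K\<^sub>1: "norm (Theta0 S C f) \<le> K\<^sub>1 * sqrt (LINT t|halfline. (norm (f t))\<^sup>2)"
    if "square_integrable halfline f" for f
    using that by (simp only: L2_halfline_iff L2n Ball_def)
  obtain K\<^sub>2 where "\<forall>f\<in>L2_halfline. norm (Xi0 S B f) \<le> K\<^sub>2 * L2_norm_halfline f"
    using \<Xi> unfolding hilbert_schmidt_L2_def by blast
  then have K\<^sub>2: "norm (Xi0 S B f) \<le> K\<^sub>2 * sqrt (LINT t|halfline. (norm (f t))\<^sup>2)"
    if "square_integrable halfline f" for f
    using that by (simp only: L2_halfline_iff L2n Ball_def)
  have adj_bound: "norm (cinner h X) \<le> (\<bar>K\<bar> * norm h) * r" if "norm X \<le> K * r" "0 \<le> r"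
    for h X :: 'a and K r :: real
  proof -
    have "norm X \<le> \<bar>K\<bar> * r" using that by (meson abs_ge_self mult_right_mono order_trans)
    then have "norm h * norm X \<le> norm h * (\<bar>K\<bar> * r)" by (intro mult_left_mono) auto
    then show ?thesis using cauchy_schwarz_cinner[of h X] by (simp add: mult_ac)
  qed
  have C_dual: "norm (LINT t|halfline. cnj (f t) * C (S t h))
      \<le> (\<bar>K\<^sub>1\<bar> * norm h) * sqrt (LINT t|halfline. (norm (f t))\<^sup>2)"
    if "square_integrable halfline f" for f h
    using adj_bound[OF K\<^sub>1[OF that], of h] unfolding \<Theta>_adj[OF that] complex_mod_cnj by simp
  have b_dual: "norm (LINT t|halfline. cnj (f t) * cinner g (S t (B 1)))
      \<le> (\<bar>K\<^sub>2\<bar> * norm g) * sqrt (LINT t|halfline. (norm (f t))\<^sup>2)"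
    if "square_integrable halfline f" for f g
    using adj_bound[OF K\<^sub>2[OF square_integrable_cnj[OF that]], of g]
    unfolding \<Xi>_adj[OF square_integrable_cnj[OF that]] complex_mod_cnj by simp
  note C_L2 = square_integrable_halfline_by_duality[OF C_cont _ C_dual]
  note b_L2 = square_integrable_halfline_by_duality[OF b_cont _ b_dual]
  obtain E\<^sub>1 where E\<^sub>1: "L2_orthonormal_basis E\<^sub>1" "(\<lambda>f. (norm (Theta0 S C f))\<^sup>2) summable_on E\<^sub>1"
    using \<Theta> unfolding hilbert_schmidt_L2_def by blast
  obtain E\<^sub>2 where E\<^sub>2: "L2_orthonormal_basis E\<^sub>2" "(\<lambda>f. (norm (Xi0 S B f))\<^sup>2) summable_on E\<^sub>2"
    using \<Xi> unfolding hilbert_schmidt_L2_def by blast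
  have sq1: "square_integrable halfline f" if "f \<in> E\<^sub>1" for f
    using that E\<^sub>1 by (auto simp: L2_orthonormal_basis_def L2_halfline_iff)
  have sq2: "square_integrable halfline f" if "f \<in> E\<^sub>2" for f
    using that E\<^sub>2 by (auto simp: L2_orthonormal_basis_def L2_halfline_iff)
  define I\<^sub>1 where "I\<^sub>1 = (\<Sum>\<^sub>\<infinity>f\<in>E\<^sub>1. (norm (Theta0 S C f))\<^sup>2)"
  define I\<^sub>2 where "I\<^sub>2 = (\<Sum>\<^sub>\<infinity>f\<in>E\<^sub>2. (norm (Xi0 S B f))\<^sup>2)"
  have I_nonneg: "0 \<le> I\<^sub>1" "0 \<le> I\<^sub>2" unfolding I\<^sub>1_def I\<^sub>2_def by (auto intro: infsum_nonneg)
  define M where "M = \<bar>K\<^sub>1\<bar> + \<bar>K\<^sub>2\<bar> + sqrt I\<^sub>1 + sqrt I\<^sub>2"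
  have M: "0 \<le> M" "\<bar>K\<^sub>1\<bar> \<le> M" "\<bar>K\<^sub>2\<bar> \<le> M" "sqrt I\<^sub>1 \<le> M" "sqrt I\<^sub>2 \<le> M"
    using I_nonneg by (auto simp: M_def)
  have HS1: "(\<Sum>e\<in>G. LINT t|halfline. (norm (C (S t e)))\<^sup>2) \<le> M\<^sup>2" if "orthonormal G" "finite G" for G
  proof -
    have "(\<Sum>e\<in>G. LINT t|halfline. (norm (C (S t e)))\<^sup>2) \<le> I\<^sub>1"
      unfolding I\<^sub>1_def
      by (rule hilbert_schmidt_kernel_bound[OF that(1) E\<^sub>1 _ _ that(2) order_refl])
        (use \<Theta>_adj[OF sq1] C_L2 in auto)
    also have "I\<^sub>1 \<le> M\<^sup>2" using M(4) by (rule sqrt_le_D)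
    finally show ?thesis .
  qed
  have HS2: "(\<Sum>e\<in>G. LINT t|halfline. (norm (cinner e (S t (B 1))))\<^sup>2) \<le> M\<^sup>2"
    if "orthonormal G" "finite G" for G
  proof -
    have "(\<Sum>e\<in>G. LINT t|halfline. (norm (cnj (cinner e (S t (B 1)))))\<^sup>2) \<le> I\<^sub>2"
      unfolding I\<^sub>2_def
    proof (rule hilbert_schmidt_kernel_bound[OF that(1) E\<^sub>2 _ _ that(2) order_refl])
      fix e :: 'a
      show "square_integrable halfline (\<lambda>t. cnj (cinner e (S t (B 1))))"
        by (intro square_integrable_cnj b_L2) auto
      fix f assume f: "f \<in> E\<^sub>2"
      have "(LINT t|halfline. cnj (f t) * cnj (cinner e (S t (B 1))))
          = cnj (LINT t|halfline. f t * cinner e (S t (B 1)))"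
        unfolding complex_cnj_mult[symmetric] by (rule Bochner_Integration.integral_cnj)
      then show "norm (LINT t|halfline. cnj (f t) * cnj (cinner e (S t (B 1)))) = norm (cinner e (Xi0 S B f))"
        unfolding \<Xi>_adj[OF sq2[OF f]] by simp
    qed
    also have "I\<^sub>2 \<le> M\<^sup>2" using M(5) by (rule sqrt_le_D)
    finally show ?thesis by simp
  qed
  have le_M: "x \<le> (M * norm h)\<^sup>2" if "x \<le> (\<bar>K\<bar> * norm h)\<^sup>2" "\<bar>K\<bar> \<le> M" for x K :: real and h :: 'a
    by (rule order_trans[OF that(1)]) (intro power_mono mult_right_mono that(2), auto)
  have "scalar_system S (B 1) C L M"
  proof
    show "(LINT t|halfline. (norm (C (S t h)))\<^sup>2) \<le> (M * norm h)\<^sup>2" for h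
      by (rule le_M[OF C_L2(2) M(2)]) auto
    show "(LINT t|halfline. (norm (cinner g (S t (B 1))))\<^sup>2) \<le> (M * norm g)\<^sup>2" for g
      by (rule le_M[OF b_L2(2) M(3)]) auto
    show C_sq: "square_integrable halfline (\<lambda>t. C (S t h))" for h by (intro C_L2) auto
    show "square_integrable halfline (\<lambda>t. cinner g (S t (B 1)))" for g by (intro b_L2) auto
    show "integrable halfline (\<lambda>t. C (S t h) *\<^sub>C S t (B 1))" for h
    proof -
      have "integrable halfline (\<lambda>t. S t (B (C (S t h))))"
        using \<Xi>_int[of "\<lambda>t. C (S t h)"] C_sq[of h] by (simp add: L2_halfline_iff set_integrable_halfline)
      then show ?thesis
      proof (rule Bochner_Integration.integrable_cong[THEN iffD1, OF refl, rotated])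
        fix t assume "t \<in> space halfline"
        then have "0 \<le> t" by (simp add: space_restrict_space)
        then show "S t (B (C (S t h))) = C (S t h) *\<^sub>C S t (B 1)" by (rule S_B)
      qed
    qed
  qed (use S_clinear S_zero S_add S_cont Cc L0 LS Lb LC M HS1 HS2 in auto)
  then show ?thesis by (rule that)
qed

section \<open>Determinants over a finite index set\<close>

definition det_on :: "'i set \<Rightarrow> ('i \<Rightarrow> 'i \<Rightarrow> 'r::comm_ring_1) \<Rightarrow> 'r"
  where "det_on F K = (\<Sum>p | p permutes F. of_int (sign p) * (\<Prod>e\<in>F. K e (p e)))"

lemma principal_minor_det_on: "principal_minor T F = det_on F (\<lambda>e f. cinner e (T f))"
  by (simp add: principal_minor_def det_on_def)

lemma det_on_scale:
  assumes "finite F" shows "det_on F (\<lambda>i j. c i * K i j) = (\<Prod>e\<in>F. c e) * det_on F K"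
  unfolding det_on_def sum_distrib_left
  by (intro sum.cong refl) (simp add: prod.distrib mult_ac)

lemma det_on_fun_upd:
  assumes "finite F" "e \<in> F"
  shows "det_on F (K(e := g)) =
    (\<Sum>p | p permutes F. of_int (sign p) * (g (p e) * (\<Prod>i\<in>F - {e}. K i (p i))))"
  unfolding det_on_def
proof (intro sum.cong refl arg_cong2[of _ _ _ _ "(*)"])
  fix p
  show "(\<Prod>i\<in>F. (K(e := g)) i (p i)) = g (p e) * (\<Prod>i\<in>F - {e}. K i (p i))"
    unfolding prod.remove[OF assms] by (auto intro!: arg_cong2[of _ _ _ _ "(*)"] prod.cong)
qed

lemma det_on_row_scale:
  assumes "finite F" "e \<in> F"
  shows "det_on F (K(e := \<lambda>f. a * g f)) = a * det_on F (K(e := g))"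
  using assms by (simp add: det_on_fun_upd sum_distrib_left mult_ac)

text \<open>Expanding the product over the rows leaves, for each set \<open>F\<close> of rows in which \<open>K\<close> is chosen,
  the permutations that fix all other indices.\<close>

lemma det_on_diag_add:
  assumes G: "finite G"
  shows "det_on G (\<lambda>i j. (if i = j then d i else 0) + K i j) =
    (\<Sum>F\<in>Pow G. (\<Prod>e\<in>G - F. d e) * det_on F K)"
proof -
  have "det_on G (\<lambda>i j. (if i = j then d i else 0) + K i j) =
    (\<Sum>p | p permutes G. \<Sum>F\<in>Pow G. of_int (sign p) *
      ((\<Prod>e\<in>F. K e (p e)) * (\<Prod>e\<in>G - F. if e = p e then d e else 0)))"
    unfolding det_on_def
    by (subst add.commute, subst prod_add[OF G]) (simp add: sum_distrib_left)
  also have "\<dots> = (\<Sum>F\<in>Pow G. \<Sum>p | p permutes G. of_int (sign p) *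
      ((\<Prod>e\<in>F. K e (p e)) * (\<Prod>e\<in>G - F. if e = p e then d e else 0)))"
    by (rule sum.swap)
  also have "\<dots> = (\<Sum>F\<in>Pow G. (\<Prod>e\<in>G - F. d e) * det_on F K)"
  proof (intro sum.cong refl)
    fix F assume "F \<in> Pow G"
    then have F: "F \<subseteq> G" by simp
    have sub: "{p. p permutes F} \<subseteq> {p. p permutes G}" using permutes_subset[OF _ F] by blast
    have zero: "of_int (sign p) * ((\<Prod>e\<in>F. K e (p e)) * (\<Prod>e\<in>G - F. if e = p e then d e else 0)) = 0"
      if p: "p permutes G" "\<not> p permutes F" for p
    proof -
      obtain e where "e \<in> G - F" "p e \<noteq> e" using permutes_superset[OF p(1), of F] p(2) by auto
      then have "(\<Prod>e\<in>G - F. if e = p e then d e else 0) = 0"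
        using G by (intro prod_zero bexI[of _ e]) auto
      then show ?thesis by simp
    qed
    have "(\<Sum>p | p permutes G. of_int (sign p) *
        ((\<Prod>e\<in>F. K e (p e)) * (\<Prod>e\<in>G - F. if e = p e then d e else 0)))
      = (\<Sum>p | p permutes F. of_int (sign p) *
        ((\<Prod>e\<in>F. K e (p e)) * (\<Prod>e\<in>G - F. if e = p e then d e else 0)))"
      using sub zero by (intro sum.mono_neutral_right finite_permutations G) auto
    also have "\<dots> = (\<Sum>p | p permutes F. (\<Prod>e\<in>G - F. d e) * (of_int (sign p) * (\<Prod>e\<in>F. K e (p e))))"
    proof (intro sum.cong refl)
      fix p assume "p \<in> {p. p permutes F}"
      then have "(\<Prod>e\<in>G - F. if e = p e then d e else 0) = (\<Prod>e\<in>G - F. d e)"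
        by (intro prod.cong refl) (auto dest: permutes_not_in)
      then show "of_int (sign p) * ((\<Prod>e\<in>F. K e (p e)) * (\<Prod>e\<in>G - F. if e = p e then d e else 0)) =
          (\<Prod>e\<in>G - F. d e) * (of_int (sign p) * (\<Prod>e\<in>F. K e (p e)))"
        by (simp add: mult_ac)
    qed
    finally show "(\<Sum>p | p permutes G. of_int (sign p) *
        ((\<Prod>e\<in>F. K e (p e)) * (\<Prod>e\<in>G - F. if e = p e then d e else 0))) =
      (\<Prod>e\<in>G - F. d e) * det_on F K"
      by (simp add: det_on_def sum_distrib_left)
  qed
  finally show ?thesis .
qed

lemma det_on_repeated_row:
  fixes K :: "'i \<Rightarrow> 'i \<Rightarrow> complex fps"
  assumes G: "finite G" and ie: "i \<in> G" "e \<in> G" "i \<noteq> e" and eq: "K i = K e"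
  shows "det_on G K = 0"
proof -
  define \<tau> where "\<tau> = Transposition.transpose i e"
  have \<tau>: "\<tau> permutes G" unfolding \<tau>_def using ie by (intro permutes_swap_id)
  have "det_on G K = (\<Sum>p | p permutes G. of_int (sign (p \<circ> \<tau>)) * (\<Prod>j\<in>G. K j ((p \<circ> \<tau>) j)))"
    unfolding det_on_def by (rule sum_permutations_compose_right[OF \<tau>])
  also have "\<dots> = (\<Sum>p | p permutes G. - (of_int (sign p) * (\<Prod>j\<in>G. K j (p j))))"
  proof (intro sum.cong refl)
    fix p assume "p \<in> {p. p permutes G}"
    then have "permutation p" "permutation \<tau>"
      using G \<tau> by (auto simp: permutation_permutes)
    then have "sign (p \<circ> \<tau>) = - sign p" using ie by (simp add: sign_compose \<tau>_def sign_swap_id)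
    moreover have "(\<Prod>j\<in>G. K j ((p \<circ> \<tau>) j)) = (\<Prod>j\<in>G. K (\<tau> j) (p (\<tau> j)))"
      using eq by (intro prod.cong refl) (auto simp: \<tau>_def Transposition.transpose_def)
    moreover have "\<dots> = (\<Prod>j\<in>G. K j (p j))"
      using prod.permute[OF \<tau>, of "\<lambda>j. K j (p j)"] by (simp add: o_def)
    ultimately show "of_int (sign (p \<circ> \<tau>)) * (\<Prod>j\<in>G. K j ((p \<circ> \<tau>) j)) =
        - (of_int (sign p) * (\<Prod>j\<in>G. K j (p j)))" by simp
  qed
  also have "\<dots> = - det_on G K" by (simp add: det_on_def sum_negf)
  finally have "det_on G K = - det_on G K" .
  then have "fps_nth (det_on G K) n = - fps_nth (det_on G K) n" for n by (metis fps_neg_nth)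
  then show ?thesis by (simp add: fps_eq_iff)
qed

lemma det_on_cramer:
  fixes K :: "'i \<Rightarrow> 'i \<Rightarrow> complex fps"
  assumes G: "finite G" "e \<in> G" and g: "\<And>j. j \<in> G \<Longrightarrow> g j = (\<Sum>i\<in>G. y i * K i j)"
  shows "det_on G (K(e := g)) = y e * det_on G K"
proof -
  have "det_on G (K(e := g)) = (\<Sum>p | p permutes G. \<Sum>i\<in>G. y i * (of_int (sign p) * (K i (p e) * (\<Prod>j\<in>G - {e}. K j (p j)))))"
    unfolding det_on_fun_upd[OF G]
    by (intro sum.cong refl) (simp add: g permutes_in_image G sum_distrib_left sum_distrib_right mult_ac)
  also have "\<dots> = (\<Sum>i\<in>G. y i * det_on G (K(e := K i)))"
    unfolding det_on_fun_upd[OF G] by (subst sum.swap) (simp add: sum_distrib_left)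
  also have "\<dots> = (\<Sum>i\<in>G. if i = e then y e * det_on G K else 0)"
  proof (intro sum.cong refl)
    fix i assume "i \<in> G"
    show "y i * det_on G (K(e := K i)) = (if i = e then y e * det_on G K else 0)"
      using det_on_repeated_row[OF G(1) \<open>i \<in> G\<close> G(2), of "K(e := K i)"] by auto
  qed
  finally show ?thesis using G by simp
qed

lemma det_on_fps_const:
  fixes R :: "'i \<Rightarrow> 'i \<Rightarrow> complex"
  shows "det_on F (\<lambda>i j. fps_const (R i j)) = fps_const (det_on F R)"
proof -
  have prod: "(\<Prod>e\<in>F. fps_const (f e)) = fps_const (\<Prod>e\<in>F. f e)" for f :: "'i \<Rightarrow> complex"
    by (induction F rule: infinite_finite_induct) auto
  have sum: "(\<Sum>p\<in>P. fps_const (f p)) = fps_const (\<Sum>p\<in>P. f p)" for f :: "_ \<Rightarrow> complex" and P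
    by (induction P rule: infinite_finite_induct) auto
  show ?thesis
    unfolding det_on_def prod fps_of_int[symmetric] fps_const_mult sum ..
qed

lemma det_on_one_plus_fps:
  fixes R :: "'i \<Rightarrow> 'i \<Rightarrow> complex"
  assumes "finite G"
  shows "det_on G (\<lambda>i j. (if i = j then 1 else 0) + fps_X * fps_const (R i j)) =
    (\<Sum>F\<in>Pow G. fps_const (det_on F R) * fps_X ^ card F)"
proof -
  have "det_on F (\<lambda>i j. fps_X * fps_const (R i j)) = fps_const (det_on F R) * fps_X ^ card F"
    if "F \<subseteq> G" for F
  proof -
    have "finite F" using that assms finite_subset by blast
    then show ?thesis by (simp add: det_on_scale det_on_fps_const mult.commute)
  qed
  then show ?thesis unfolding det_on_diag_add[OF assms] by (intro sum.cong) auto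
qed

text \<open>Replacing a row also removes its diagonal entry \<open>1\<close>, so that only the minors containing \<open>e\<close>
  remain. They have one factor \<open>X\<close> less than elements.\<close>

lemma det_on_one_plus_fps_row:
  fixes R :: "'i \<Rightarrow> 'i \<Rightarrow> complex"
  assumes G: "finite G" "e \<in> G"
  shows "fps_X * det_on G ((\<lambda>i j. (if i = j then 1 else 0) + fps_X * fps_const (R i j))(e := \<lambda>j. fps_const (\<gamma> j))) =
    (\<Sum>F | F \<subseteq> G \<and> e \<in> F. fps_const (det_on F (R(e := \<gamma>))) * fps_X ^ card F)"
proof -
  let ?K = "\<lambda>i j. (if i = e then 1 else fps_X) * fps_const ((R(e := \<gamma>)) i j)"
  have "(\<lambda>i j. (if i = j then 1 else 0) + fps_X * fps_const (R i j))(e := \<lambda>j. fps_const (\<gamma> j))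
      = (\<lambda>i j. (if i = j then (if i = e then 0 else 1) else 0) + ?K i j)"
    by (auto simp: fun_eq_iff)
  then have "fps_X * det_on G ((\<lambda>i j. (if i = j then 1 else 0) + fps_X * fps_const (R i j))(e := \<lambda>j. fps_const (\<gamma> j)))
      = (\<Sum>F\<in>Pow G. fps_X * ((\<Prod>i\<in>G - F. if i = e then 0 else 1) * det_on F ?K))"
    by (simp only: det_on_diag_add[OF G(1)] sum_distrib_left)
  also have "\<dots> = (\<Sum>F | F \<subseteq> G \<and> e \<in> F. fps_X * ((\<Prod>i\<in>G - F. if i = e then 0 else 1) * det_on F ?K))"
  proof (rule sum.mono_neutral_right)
    show "\<forall>F\<in>Pow G - {F. F \<subseteq> G \<and> e \<in> F}. fps_X * ((\<Prod>i\<in>G - F. if i = e then 0 else 1) * det_on F ?K) = 0"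
      using G by (auto intro!: prod_zero)
  qed (use G in auto)
  also have "\<dots> = (\<Sum>F | F \<subseteq> G \<and> e \<in> F. fps_const (det_on F (R(e := \<gamma>))) * fps_X ^ card F)"
  proof (intro sum.cong refl)
    fix F assume "F \<in> {F. F \<subseteq> G \<and> e \<in> F}"
    then have F: "finite F" "e \<in> F" using G finite_subset by auto
    have P: "(\<Prod>i\<in>F. if i = e then 1 else fps_X) = (fps_X :: complex fps) ^ (card F - 1)"
    proof -
      have "(\<Prod>i\<in>F. if i = e then 1 else fps_X) = (\<Prod>i\<in>F - {e}. fps_X :: complex fps)"
        unfolding prod.remove[OF F] by (auto intro!: prod.cong)
      then show ?thesis using F by simp
    qed
    have Q: "(\<Prod>i\<in>G - F. if i = e then 0 else 1) = (1 :: complex fps)"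
      using F by (intro prod.neutral) auto
    have pow: "fps_X * fps_X ^ (card F - 1) = (fps_X :: complex fps) ^ card F"
      using F by (metis card_gt_0_iff empty_iff power_eq_if less_irrefl)
    show "fps_X * ((\<Prod>i\<in>G - F. if i = e then 0 else 1) * det_on F ?K) =
        fps_const (det_on F (R(e := \<gamma>))) * fps_X ^ card F"
      unfolding det_on_scale[OF F(1), of "\<lambda>i. if i = e then 1 else fps_X"] det_on_fps_const
      unfolding P Q mult_1_left by (metis pow mult.assoc mult.commute)
  qed
  finally show ?thesis .
qed

lemma fps_nth_subset_sum:
  fixes f :: "'i set \<Rightarrow> complex"
  assumes "finite \<F>"
  shows "fps_nth (\<Sum>F\<in>\<F>. fps_const (f F) * fps_X ^ card F) k = (\<Sum>F | F \<in> \<F> \<and> card F = k. f F)"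
proof -
  have "fps_nth (\<Sum>F\<in>\<F>. fps_const (f F) * fps_X ^ card F) k = (\<Sum>F\<in>\<F>. if card F = k then f F else 0)"
    unfolding fps_sum_nth by (intro sum.cong) (auto simp: fps_X_power_nth)
  also have "\<dots> = (\<Sum>F | F \<in> \<F> \<and> card F = k. f F)"
    using assms by (simp add: sum.inter_filter)
  finally show ?thesis .
qed

text \<open>Jacobi's formula, coefficient by coefficient. The left-hand side collects the derivatives of
  the principal minors of \<open>R\<close> in the direction of the rank one matrix \<open>\<beta> \<otimes> \<gamma>\<close>; the row vector
  \<open>y\<close> is \<open>\<gamma> (I + X R)\<^sup>-\<^sup>1\<close>, and Cramer's rule expresses the replaced rows through it. Working
  with power series in \<open>X\<close> makes \<open>I + X R\<close> invertible without any smallness condition.\<close>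

lemma minors_cramer:
  fixes R :: "'i \<Rightarrow> 'i \<Rightarrow> complex" and y :: "'i \<Rightarrow> complex fps"
  assumes G: "finite G"
    and y: "\<And>j. j \<in> G \<Longrightarrow> fps_const (\<gamma> j) = y j + (\<Sum>i\<in>G. y i * (fps_X * fps_const (R i j)))"
  shows "Abs_fps (\<lambda>k. \<Sum>F | F \<subseteq> G \<and> card F = k. \<Sum>e\<in>F. \<beta> e * det_on F (R(e := \<gamma>))) =
    fps_X * Abs_fps (\<lambda>k. \<Sum>F | F \<subseteq> G \<and> card F = k. det_on F R) * (\<Sum>e\<in>G. fps_const (\<beta> e) * y e)"
proof -
  let ?K = "\<lambda>i j. (if i = j then 1 else 0) + fps_X * fps_const (R i j)"
  let ?D = "det_on G ?K"
  have D: "Abs_fps (\<lambda>k. \<Sum>F | F \<subseteq> G \<and> card F = k. det_on F R) = ?D"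
    unfolding det_on_one_plus_fps[OF G] using G
    by (intro fps_ext) (simp add: fps_nth_subset_sum)
  have row: "fps_X * det_on G (?K(e := \<lambda>j. fps_const (\<gamma> j))) = fps_X * (y e * ?D)" if "e \<in> G" for e
  proof (intro arg_cong[of _ _ "(*) fps_X"] det_on_cramer[OF G that])
    fix j assume "j \<in> G"
    have "(\<Sum>i\<in>G. y i * ?K i j) = (\<Sum>i\<in>G. (if i = j then y i else 0) + y i * (fps_X * fps_const (R i j)))"
      by (intro sum.cong refl) (simp add: algebra_simps)
    also have "\<dots> = fps_const (\<gamma> j)"
      unfolding sum.distrib using G \<open>j \<in> G\<close> y by simp
    finally show "fps_const (\<gamma> j) = (\<Sum>i\<in>G. y i * ?K i j)" ..
  qed
  have "fps_nth (\<Sum>e\<in>G. fps_const (\<beta> e) * (fps_X * (y e * ?D))) k =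
      (\<Sum>F | F \<subseteq> G \<and> card F = k. \<Sum>e\<in>F. \<beta> e * det_on F (R(e := \<gamma>)))" for k
  proof -
    have "fps_nth (\<Sum>e\<in>G. fps_const (\<beta> e) * (fps_X * (y e * ?D))) k
        = (\<Sum>e\<in>G. \<beta> e * fps_nth (fps_X * (y e * ?D)) k)"
      by (simp add: fps_sum_nth)
    also have "\<dots> = (\<Sum>e\<in>G. \<beta> e * (\<Sum>F | F \<in> {F. F \<subseteq> G \<and> e \<in> F} \<and> card F = k. det_on F (R(e := \<gamma>))))"
    proof (intro sum.cong refl arg_cong2[of _ _ _ _ "(*)"])
      fix e assume "e \<in> G"
      have "finite {F. F \<subseteq> G \<and> e \<in> F}" using G by simp
      then show "fps_nth (fps_X * (y e * ?D)) k =
          (\<Sum>F | F \<in> {F. F \<subseteq> G \<and> e \<in> F} \<and> card F = k. det_on F (R(e := \<gamma>)))"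
        unfolding row[OF \<open>e \<in> G\<close>, symmetric] det_on_one_plus_fps_row[OF G \<open>e \<in> G\<close>]
        by (rule fps_nth_subset_sum)
    qed
    also have "\<dots> = (\<Sum>e\<in>G. \<Sum>F | F \<in> {F. F \<subseteq> G \<and> card F = k} \<and> e \<in> F. \<beta> e * det_on F (R(e := \<gamma>)))"
      unfolding sum_distrib_left by (intro sum.cong) auto
    also have "\<dots> = (\<Sum>F | F \<subseteq> G \<and> card F = k. \<Sum>e | e \<in> G \<and> e \<in> F. \<beta> e * det_on F (R(e := \<gamma>)))"
      using G by (intro sum.swap_restrict) auto
    also have "\<dots> = (\<Sum>F | F \<subseteq> G \<and> card F = k. \<Sum>e\<in>F. \<beta> e * det_on F (R(e := \<gamma>)))"
      by (intro sum.cong) auto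
    finally show ?thesis .
  qed
  then have "Abs_fps (\<lambda>k. \<Sum>F | F \<subseteq> G \<and> card F = k. \<Sum>e\<in>F. \<beta> e * det_on F (R(e := \<gamma>))) =
      (\<Sum>e\<in>G. fps_const (\<beta> e) * (fps_X * (y e * ?D)))"
    by (simp add: fps_eq_iff)
  also have "\<dots> = fps_X * ?D * (\<Sum>e\<in>G. fps_const (\<beta> e) * y e)"
    unfolding sum_distrib_left by (intro sum.cong) (auto simp: mult_ac)
  finally show ?thesis unfolding D .
qed

lemma has_vector_derivative_det_on:
  fixes K :: "'i \<Rightarrow> 'i \<Rightarrow> real \<Rightarrow> complex"
  assumes F: "finite F"
    and K: "\<And>i j. i \<in> F \<Longrightarrow> j \<in> F \<Longrightarrow> (K i j has_vector_derivative K' i j) (at x within A)"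
  shows "((\<lambda>x. det_on F (\<lambda>i j. K i j x)) has_vector_derivative
    (\<Sum>e\<in>F. det_on F ((\<lambda>i j. K i j x)(e := K' e)))) (at x within A)"
proof -
  have "((\<lambda>x. \<Prod>i\<in>F. K i (p i) x) has_vector_derivative
      (\<Sum>e\<in>F. K' e (p e) * (\<Prod>i\<in>F - {e}. K i (p i) x))) (at x within A)" if "p permutes F" for p
  proof -
    have "((\<lambda>x. \<Prod>i\<in>F. K i (p i) x) has_derivative
        (\<lambda>h. \<Sum>e\<in>F. (h *\<^sub>R K' e (p e)) * (\<Prod>i\<in>F - {e}. K i (p i) x))) (at x within A)"
      using K that unfolding has_vector_derivative_def
      by (intro has_derivative_prod) (auto simp: permutes_in_image)
    then show ?thesis
      unfolding has_vector_derivative_def by (simp add: scaleR_sum_right)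
  qed
  then have "((\<lambda>x. \<Sum>p | p permutes F. of_int (sign p) * (\<Prod>i\<in>F. K i (p i) x)) has_vector_derivative
      (\<Sum>p | p permutes F. of_int (sign p) * (\<Sum>e\<in>F. K' e (p e) * (\<Prod>i\<in>F - {e}. K i (p i) x)))) (at x within A)"
    by (intro has_vector_derivative_sum has_vector_derivative_mult_right) auto
  moreover have "(\<Sum>p | p permutes F. of_int (sign p) * (\<Sum>e\<in>F. K' e (p e) * (\<Prod>i\<in>F - {e}. K i (p i) x)))
      = (\<Sum>e\<in>F. det_on F ((\<lambda>i j. K i j x)(e := K' e)))"
    using F by (simp add: det_on_fun_upd sum_distrib_left) (rule sum.swap)
  ultimately show ?thesis unfolding det_on_def by simp
qed

section \<open>Bounds for sums of minors\<close>

lemma norm_det_on_le: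
  fixes K :: "'i \<Rightarrow> 'i \<Rightarrow> complex"
  assumes "finite F" and K: "\<And>i j. i \<in> F \<Longrightarrow> j \<in> F \<Longrightarrow> norm (K i j) \<le> u i * v j"
  shows "norm (det_on F K) \<le> fact (card F) * (\<Prod>e\<in>F. u e * v e)"
proof -
  have "norm (det_on F K) \<le> (\<Sum>p | p permutes F. \<Prod>e\<in>F. u e * v e)"
    unfolding det_on_def
  proof (rule sum_norm_le)
    fix p assume "p \<in> {p. p permutes F}"
    then have p: "p permutes F" by simp
    have "norm (of_int (sign p) * (\<Prod>e\<in>F. K e (p e)) :: complex) = (\<Prod>e\<in>F. norm (K e (p e)))"
      by (simp add: norm_mult prod_norm sign_def)
    also have "\<dots> \<le> (\<Prod>e\<in>F. u e * v (p e))"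
      using K p by (intro prod_mono) (auto simp: permutes_in_image)
    also have "\<dots> = (\<Prod>e\<in>F. u e) * (\<Prod>e\<in>F. v (p e))" by (rule prod.distrib)
    also have "(\<Prod>e\<in>F. v (p e)) = (\<Prod>e\<in>F. v e)"
      using prod.permute[OF p, of v] by (simp add: o_def)
    finally show "norm (of_int (sign p) * (\<Prod>e\<in>F. K e (p e))) \<le> (\<Prod>e\<in>F. u e * v e)"
      by (simp add: prod.distrib)
  qed
  then show ?thesis using card_permutations[OF refl assms(1)] by simp
qed

text \<open>Multiplying out the power on the right, each product of \<open>k\<close> different weights occurs \<open>k!\<close>
  times. In the induction over \<open>G\<close> this is Bernoulli's inequality.\<close>

lemma elementary_symmetric_le:
  fixes w :: "'i \<Rightarrow> real"
  assumes "finite G" "\<And>e. e \<in> G \<Longrightarrow> 0 \<le> w e"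
  shows "(\<Sum>F | F \<subseteq> G \<and> card F = k. fact k * (\<Prod>e\<in>F. w e)) \<le> (\<Sum>e\<in>G. w e) ^ k"
  using assms
proof (induction G arbitrary: k rule: finite_induct)
  case empty
  have "{F :: 'i set. F \<subseteq> {} \<and> card F = k} = (if k = 0 then {{}} else {})" by auto
  then show ?case by simp
next
  case (insert x G)
  let ?E = "\<lambda>G k. \<Sum>F | F \<subseteq> G \<and> card F = k. \<Prod>e\<in>F. w e" and ?S = "\<Sum>e\<in>G. w e"
  have IH: "fact k * ?E G k \<le> ?S ^ k" for k
    using insert.IH[of k] insert.prems by (simp add: sum_distrib_left)
  have S0: "0 \<le> ?S" and x0: "0 \<le> w x" using insert.prems by (auto intro: sum_nonneg)
  show ?case
  proof (cases k)
    case 0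
    have "{F. F \<subseteq> insert x G \<and> card F = 0} = {{}}"
      using insert.hyps finite_subset[of _ "insert x G"] by auto
    then show ?thesis using 0 by simp
  next
    case (Suc m)
    have "{F. F \<subseteq> insert x G \<and> card F = Suc m} =
        {F. F \<subseteq> G \<and> card F = Suc m} \<union> insert x ` {F. F \<subseteq> G \<and> card F = m}"
    proof (intro equalityI subsetI)
      fix F assume F: "F \<in> {F. F \<subseteq> insert x G \<and> card F = Suc m}"
      show "F \<in> {F. F \<subseteq> G \<and> card F = Suc m} \<union> insert x ` {F. F \<subseteq> G \<and> card F = m}"
      proof (cases "x \<in> F")
        case True
        then have "F = insert x (F - {x})" "card (F - {x}) = m" "F - {x} \<subseteq> G" using F by auto
        then show ?thesis by blast
      qed (use F in auto)
    next
      fix F assume "F \<in> {F. F \<subseteq> G \<and> card F = Suc m} \<union> insert x ` {F. F \<subseteq> G \<and> card F = m}"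
      then show "F \<in> {F. F \<subseteq> insert x G \<and> card F = Suc m}"
        using insert.hyps rev_finite_subset[OF insert.hyps(1)]
        by (auto simp: card_insert_if subset_eq)
    qed
    moreover have "inj_on (insert x) {F. F \<subseteq> G \<and> card F = m}"
      using insert.hyps(2) by (auto simp: inj_on_def insert_ident subset_eq)
    moreover have "{F. F \<subseteq> G \<and> card F = Suc m} \<inter> insert x ` {F. F \<subseteq> G \<and> card F = m} = {}"
      using insert.hyps(2) by auto
    ultimately have "?E (insert x G) (Suc m) =
        ?E G (Suc m) + (\<Sum>F | F \<subseteq> G \<and> card F = m. \<Prod>e\<in>insert x F. w e)"
      using insert.hyps(1) by (simp add: sum.union_disjoint sum.reindex)
    also have "(\<Sum>F | F \<subseteq> G \<and> card F = m. \<Prod>e\<in>insert x F. w e) = w x * ?E G m"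
      unfolding sum_distrib_left
    proof (intro sum.cong refl)
      fix F assume "F \<in> {F. F \<subseteq> G \<and> card F = m}"
      then have "finite F" "x \<notin> F" using insert.hyps by (auto dest: finite_subset)
      then show "(\<Prod>e\<in>insert x F. w e) = w x * (\<Prod>e\<in>F. w e)" by simp
    qed
    finally have "fact (Suc m) * ?E (insert x G) (Suc m) =
        fact (Suc m) * ?E G (Suc m) + (real (Suc m) * w x) * (fact m * ?E G m)"
      by (simp add: algebra_simps)
    also have "\<dots> \<le> ?S ^ Suc m + (real (Suc m) * w x) * ?S ^ m"
      using x0 by (intro add_mono[OF IH mult_left_mono[OF IH]]) auto
    also have "\<dots> \<le> (?S + w x) ^ Suc m"
    proof (cases "?S = 0")
      case False
      then have S: "?S > 0" using S0 by simp
      have "?S ^ Suc m + (real (Suc m) * w x) * ?S ^ m = ?S ^ Suc m * (1 + real (Suc m) * (w x / ?S))"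
        using S by (simp add: field_simps)
      also have "\<dots> \<le> ?S ^ Suc m * (1 + w x / ?S) ^ Suc m"
      proof (intro mult_left_mono Bernoulli_inequality)
        show "-1 \<le> w x / ?S" using x0 S by (meson divide_nonneg_pos order_trans neg_le_0_iff_le zero_le_one)
      qed (use S in auto)
      also have "\<dots> = (?S + w x) ^ Suc m"
      proof -
        have "?S * (1 + w x / ?S) = ?S + w x" using S by (simp add: field_simps)
        then show ?thesis unfolding power_mult_distrib[symmetric] by (simp only:)
      qed
      finally show ?thesis .
    next
      case True
      then show ?thesis using x0 by (cases m) auto
    qed
    also have "?S + w x = (\<Sum>e\<in>insert x G. w e)" using insert.hyps by simp
    finally show ?thesis unfolding Suc by (simp only: sum_distrib_left)
  qed
qed

text \<open>Since the elements of \<open>F\<close> are distinct, at most \<open>card G0\<close> of them lie in \<open>G0\<close>; so the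
  weights on \<open>G0\<close> can be scaled by \<open>\<delta>\<close> at the price of a factor that does not depend on \<open>k\<close>.\<close>

lemma k_subset_sum_le:
  fixes w :: "'i \<Rightarrow> real"
  assumes G: "finite G" and w: "\<And>e. e \<in> G \<Longrightarrow> 0 \<le> w e" and G0: "finite G0"
    and \<delta>: "0 < \<delta>" "\<delta> \<le> 1"
    and inside: "(\<Sum>e\<in>G \<inter> G0. w e) \<le> M" and outside: "(\<Sum>e\<in>G - G0. w e) \<le> \<epsilon>"
  shows "(\<Sum>F | F \<subseteq> G \<and> card F = k. fact k * (\<Prod>e\<in>F. w e)) \<le> (1 / \<delta>) ^ card G0 * (\<delta> * M + \<epsilon>) ^ k"
proof -
  define w' where "w' e = (if e \<in> G0 then \<delta> * w e else w e)" for e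
  have w'0: "0 \<le> w' e" if "e \<in> G" for e using w[OF that] \<delta> by (simp add: w'_def)
  have "(\<Prod>e\<in>F. w e) \<le> (1 / \<delta>) ^ card G0 * (\<Prod>e\<in>F. w' e)" if F: "F \<subseteq> G" for F
  proof -
    have fin: "finite F" using F G finite_subset by blast
    have "(\<Prod>e\<in>F. w e) = (\<Prod>e\<in>F. (if e \<in> G0 then 1 / \<delta> else 1) * w' e)"
      using \<delta> by (intro prod.cong) (auto simp: w'_def)
    also have "\<dots> = (1 / \<delta>) ^ card (F \<inter> G0) * (\<Prod>e\<in>F. w' e)"
      using fin by (simp add: prod.distrib prod.If_cases)
    also have "\<dots> \<le> (1 / \<delta>) ^ card G0 * (\<Prod>e\<in>F. w' e)"
      using \<delta> F w'0 G0 by (intro mult_right_mono power_increasing card_mono prod_nonneg) auto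
    finally show ?thesis .
  qed
  then have "(\<Sum>F | F \<subseteq> G \<and> card F = k. fact k * (\<Prod>e\<in>F. w e))
      \<le> (\<Sum>F | F \<subseteq> G \<and> card F = k. (1 / \<delta>) ^ card G0 * (fact k * (\<Prod>e\<in>F. w' e)))"
    by (intro sum_mono) (simp add: mult.left_commute)
  also have "\<dots> = (1 / \<delta>) ^ card G0 * (\<Sum>F | F \<subseteq> G \<and> card F = k. fact k * (\<Prod>e\<in>F. w' e))"
    by (rule sum_distrib_left[symmetric])
  also have "\<dots> \<le> (1 / \<delta>) ^ card G0 * (\<Sum>e\<in>G. w' e) ^ k"
    using \<delta> w'0 by (intro mult_left_mono elementary_symmetric_le G) auto
  also have "\<dots> \<le> (1 / \<delta>) ^ card G0 * (\<delta> * M + \<epsilon>) ^ k"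
  proof (intro mult_left_mono power_mono)
    have "(\<Sum>e\<in>G. w' e) = (\<Sum>e\<in>G \<inter> G0. w' e) + (\<Sum>e\<in>G - G0. w' e)"
      using G by (metis Int_Diff_Un Int_Diff_disjoint finite_Diff finite_Int sum.union_disjoint)
    also have "(\<Sum>e\<in>G \<inter> G0. w' e) = \<delta> * (\<Sum>e\<in>G \<inter> G0. w e)"
      unfolding sum_distrib_left by (intro sum.cong) (auto simp: w'_def)
    also have "(\<Sum>e\<in>G - G0. w' e) = (\<Sum>e\<in>G - G0. w e)"
      by (intro sum.cong) (auto simp: w'_def)
    finally show "(\<Sum>e\<in>G. w' e) \<le> \<delta> * M + \<epsilon>"
      using outside mult_left_mono[OF inside less_imp_le[OF \<delta>(1)]] by linarith
  qed (use w'0 \<delta> in \<open>auto intro: sum_nonneg\<close>)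
  finally show ?thesis .
qed

section \<open>The operators \<open>R\<close>\<close>

lemma set_integral_tail_diff:
  fixes f :: "real \<Rightarrow> 'b::{banach, second_countable_topology}"
  assumes "set_integrable lborel {x<..} f" "x \<le> y"
  shows "(LINT t:{x<..}|lborel. f t) - (LINT t:{y<..}|lborel. f t) = (LINT t:{x<..y}|lborel. f t)"
proof -
  have "{x<..} = {x<..y} \<union> {y<..}" using assms(2) by auto
  moreover have "(LINT t:{x<..y} \<union> {y<..}|lborel. f t) = (LINT t:{x<..y}|lborel. f t) + (LINT t:{y<..}|lborel. f t)"
    by (intro set_integral_Un set_integrable_subset[OF assms(1)]) (use assms(2) in auto)
  ultimately show ?thesis by simp
qed

lemma norm_set_integral_interval_le:
  fixes f :: "real \<Rightarrow> 'b::{banach, second_countable_topology}"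
  assumes "set_integrable lborel {x<..y} f" "x \<le> y" "\<And>t. x < t \<Longrightarrow> t \<le> y \<Longrightarrow> norm (f t) \<le> K"
  shows "norm (LINT t:{x<..y}|lborel. f t) \<le> K * (y - x)"
proof -
  have "norm (LINT t:{x<..y}|lborel. f t) \<le> (LINT t:{x<..y}|lborel. norm (f t))"
    by (rule set_integral_norm_bound[OF assms(1)])
  also have "\<dots> \<le> (LINT t:{x<..y}|lborel. K)"
    using assms by (intro set_integral_mono set_integrable_norm) (auto simp: set_integrable_def)
  also have "\<dots> = K * (y - x)" using assms(2) by (simp add: set_lebesgue_integral_def)
  finally show ?thesis .
qed

text \<open>The fundamental theorem of calculus for Bochner integrals, whose values may lie in an
  infinite dimensional space.\<close>

lemma tail_integral_has_vector_derivative: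
  fixes f :: "real \<Rightarrow> 'b::{banach, second_countable_topology}"
  assumes f: "continuous_on {0..} f" "set_integrable lborel {0<..} f" and x: "0 < x"
  shows "((\<lambda>x. LINT t:{x<..}|lborel. f t) has_vector_derivative - f x) (at x)"
proof -
  define F where "F x = (LINT t:{x<..}|lborel. f t)" for x
  have int: "set_integrable lborel A f" if "A \<in> sets lborel" "A \<subseteq> {0<..}" for A
    using set_integrable_subset[OF f(2)] that by blast
  have "continuous_on {0<..} f" by (rule continuous_on_subset[OF f(1)]) auto
  then have "isCont f x" using x by (simp add: continuous_on_eq_continuous_at)
  have step: "norm (F z - F y - (y - z) *\<^sub>R f x) \<le> e * (y - z)"
    if "0 < z" "z \<le> y" and e: "\<And>t. z < t \<Longrightarrow> t \<le> y \<Longrightarrow> norm (f t - f x) \<le> e" for y z e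
  proof -
    have sub: "{z<..y} \<subseteq> {0<..}" using that by auto
    have c: "set_integrable lborel {z<..y} (\<lambda>_. f x)"
      unfolding set_integrable_def using that by (intro integrable_scaleR_left integrable_real_indicator) auto
    have "F z - F y - (y - z) *\<^sub>R f x = (LINT t:{z<..y}|lborel. f t) - (LINT t:{z<..y}|lborel. f x)"
      unfolding F_def using that
      by (subst set_integral_tail_diff) (auto intro!: int simp: set_lebesgue_integral_def)
    also have "\<dots> = (LINT t:{z<..y}|lborel. f t - f x)"
      using int[OF _ sub] c by (subst set_integral_diff) auto
    also have "norm \<dots> \<le> e * (y - z)"
      by (rule norm_set_integral_interval_le[OF set_integral_diff(1)[OF int[OF _ sub] c] that(2) e]) auto
    finally show ?thesis .
  qed
  have "(F has_derivative (\<lambda>h. h *\<^sub>R - f x)) (at x)"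
    unfolding has_derivative_at_alt
  proof (intro conjI allI impI)
    show "bounded_linear (\<lambda>h. h *\<^sub>R - f x)" by (rule bounded_linear_scaleR_left)
    fix e :: real assume "0 < e"
    then obtain d where d: "d > 0" "\<And>t. dist t x < d \<Longrightarrow> dist (f t) (f x) < e"
      using \<open>isCont f x\<close> unfolding continuous_at_eps_delta by blast
    show "\<exists>d>0. \<forall>y. norm (y - x) < d \<longrightarrow> norm (F y - F x - (y - x) *\<^sub>R - f x) \<le> e * norm (y - x)"
    proof (intro exI[of _ "min d x"] conjI allI impI)
      fix y assume y: "norm (y - x) < min d x"
      have close: "norm (f t - f x) \<le> e" if "\<bar>t - x\<bar> \<le> \<bar>y - x\<bar>" for t
        using d(2)[of t] that y by (simp add: dist_norm)
      show "norm (F y - F x - (y - x) *\<^sub>R - f x) \<le> e * norm (y - x)"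
      proof (cases "x \<le> y")
        case True
        have "norm (F x - F y - (y - x) *\<^sub>R f x) \<le> e * (y - x)"
          by (rule step[OF x True close]) (use True in auto)
        moreover have "norm (F y - F x - (y - x) *\<^sub>R - f x) = norm (F x - F y - (y - x) *\<^sub>R f x)"
          by (subst norm_minus_cancel[symmetric]) (simp add: algebra_simps)
        ultimately show ?thesis using True by simp
      next
        case False
        have "norm (F y - F x - (x - y) *\<^sub>R f x) \<le> e * (x - y)"
          by (rule step[OF _ _ close]) (use False y in auto)
        then show ?thesis using False by (simp add: algebra_simps)
      qed
    qed (use d x in auto)
  qed
  then show ?thesis unfolding has_vector_derivative_def F_def .
qed

lemma bounded_family_continuous_on:
  fixes T :: "'x::topological_space \<Rightarrow> 'b::real_normed_vector \<Rightarrow> 'c::real_normed_vector"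
  assumes lin: "\<And>x. x \<in> A \<Longrightarrow> bounded_linear (T x)"
    and bd: "\<And>x h. x \<in> A \<Longrightarrow> norm (T x h) \<le> K * norm h"
    and cont: "\<And>h. continuous_on A (\<lambda>x. T x h)" and v: "continuous_on A v"
  shows "continuous_on A (\<lambda>x. T x (v x))"
  unfolding continuous_on_def
proof
  fix x assume x: "x \<in> A"
  have "((\<lambda>y. T y (v y - v x)) \<longlongrightarrow> 0) (at x within A)"
  proof (rule Lim_null_comparison)
    show "eventually (\<lambda>y. norm (T y (v y - v x)) \<le> K * norm (v y - v x)) (at x within A)"
      using bd by (auto simp: eventually_at_filter)
    have "((\<lambda>y. K * norm (v y - v x)) \<longlongrightarrow> K * norm (v x - v x)) (at x within A)"
      using v x unfolding continuous_on_def by (intro tendsto_intros) auto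
    then show "((\<lambda>y. K * norm (v y - v x)) \<longlongrightarrow> 0) (at x within A)" by simp
  qed
  moreover have "((\<lambda>y. T y (v x)) \<longlongrightarrow> T x (v x)) (at x within A)"
    using cont[of "v x"] x unfolding continuous_on_def by blast
  ultimately have "((\<lambda>y. T y (v y - v x) + T y (v x)) \<longlongrightarrow> 0 + T x (v x)) (at x within A)"
    by (rule tendsto_add)
  moreover have "eventually (\<lambda>y. T y (v y - v x) + T y (v x) = T y (v y)) (at x within A)"
    using linear_diff[OF bounded_linear.linear[OF lin]] by (auto simp: eventually_at_filter)
  ultimately show "((\<lambda>y. T y (v y)) \<longlongrightarrow> T x (v x)) (at x within A)"
    by (simp add: tendsto_cong)
qed

context scalar_system
begin

lemma S_linear: "0 \<le> t \<Longrightarrow> bounded_linear (S t)"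
  by (rule bounded_clinear_imp_linear[OF S_clinear])

lemma C_linear: "bounded_linear C"
  by (rule bounded_clinear_imp_linear[OF C_clinear])

lemma CS_linear: "0 \<le> t \<Longrightarrow> bounded_linear (\<lambda>h. C (S t h))"
  by (rule bounded_linear_compose[OF C_linear S_linear])

lemma CS_clinear: "0 \<le> t \<Longrightarrow> bounded_clinear (\<lambda>h. C (S t h))"
  using CS_linear bounded_clinear_scaleC[OF S_clinear] bounded_clinear_scaleC[OF C_clinear]
  by (simp add: bounded_clinear_def)

lemma CS_continuous: "continuous_on {0..} (\<lambda>t. C (S t h))"
  by (rule bounded_linear.continuous_on[OF C_linear S_continuous])

lemma Cb_continuous: "continuous_on {0..} (\<lambda>t. C (S t h) *\<^sub>C S t b)"
  by (rule continuous_on_scaleC[OF CS_continuous S_continuous])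

definition R :: "real \<Rightarrow> 'a \<Rightarrow> 'a"
  where "R x h = (LINT t:{x<..}|lborel. C (S t h) *\<^sub>C S t b)"

lemma Cb_set_integrable: "0 \<le> x \<Longrightarrow> set_integrable lborel {x<..} (\<lambda>t. C (S t h) *\<^sub>C S t b)"
  by (rule set_integrable_subset[of _ "{0<..}"]) (auto simp: set_integrable_halfline Cb_integrable)

lemma cinner_R: "0 \<le> x \<Longrightarrow> cinner g (R x h) = (LINT t:{x<..}|lborel. C (S t h) * cinner g (S t b))"
  unfolding R_def set_lebesgue_integral_def
  using integral_bounded_linear[OF bounded_linear_cinner_right Cb_set_integrable[unfolded set_integrable_def, of x h], of g]
  by (simp add: cinner_scaleR_right cinner_scaleC_right)

lemma CS_b_set_integrable:
  assumes "0 \<le> x" shows "set_integrable lborel {x<..} (\<lambda>t. C (S t h) * cinner g (S t b))"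
  by (rule set_integrable_subset[of _ "{0<..}"])
    (use assms square_integrable_mult[OF C_sq b_sq] in \<open>auto simp: set_integrable_halfline\<close>)

lemma norm_cinner_R_le:
  assumes "0 \<le> x"
  shows "norm (cinner g (R x h)) \<le> sqrt (LINT t|halfline. (norm (cinner g (S t b)))\<^sup>2) *
    sqrt (LINT t|halfline. (norm (C (S t h)))\<^sup>2)"
proof -
  have int: "set_integrable lborel {0<..} (\<lambda>t. norm (C (S t h)) * norm (cinner g (S t b)))"
    using square_integrable_norm_mult[OF C_sq b_sq] by (simp add: set_integrable_halfline)
  have "norm (cinner g (R x h)) \<le> (LINT t:{x<..}|lborel. norm (C (S t h)) * norm (cinner g (S t b)))"
    unfolding cinner_R[OF assms] norm_mult[symmetric]
    by (rule set_integral_norm_bound[OF CS_b_set_integrable[OF assms]])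
  also have "\<dots> \<le> (LINT t:{0<..}|lborel. norm (C (S t h)) * norm (cinner g (S t b)))"
    unfolding set_lebesgue_integral_def
    using assms int set_integrable_subset[OF int, of "{x<..}"]
    by (intro integral_mono) (auto simp: set_integrable_def indicator_def)
  also have "\<dots> \<le> sqrt (LINT t|halfline. (norm (C (S t h)))\<^sup>2) * sqrt (LINT t|halfline. (norm (cinner g (S t b)))\<^sup>2)"
    unfolding set_integral_halfline by (rule integral_cauchy_schwarz[OF C_sq b_sq])
  finally show ?thesis by (simp add: mult.commute)
qed

text \<open>The operator \<open>R x\<close> is the product of the restrictions to \<open>(x, \<infinity>)\<close> of two operators of norm
  at most \<open>M\<close>; in terms of the sesquilinear form this is the Cauchy--Schwarz inequality in
  $L^2$.\<close>

lemma norm_R_le: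
  assumes "0 \<le> x" shows "norm (R x h) \<le> M\<^sup>2 * norm h"
proof (cases "R x h = 0")
  case False
  have "norm (R x h) * norm (R x h) = norm (cinner (R x h) (R x h))"
    unfolding cinner_self norm_of_real by (simp add: power2_eq_square)
  also have "\<dots> \<le> sqrt (LINT t|halfline. (norm (cinner (R x h) (S t b)))\<^sup>2) * sqrt (LINT t|halfline. (norm (C (S t h)))\<^sup>2)"
    by (rule norm_cinner_R_le[OF assms])
  also have "\<dots> \<le> (M * norm (R x h)) * (M * norm h)"
    using M_nonneg b_sq_bound[of "R x h"] C_sq_bound[of h]
    by (intro mult_mono real_le_lsqrt) auto
  finally have "norm (R x h) * norm (R x h) \<le> (M\<^sup>2 * norm h) * norm (R x h)"
    by (simp add: power2_eq_square mult_ac)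
  then show ?thesis using False by simp
qed (use M_nonneg in simp)

lemma R_clinear: assumes "0 \<le> x" shows "bounded_clinear (R x)"
  unfolding bounded_clinear_def
proof
  note int = Cb_set_integrable[OF assms]
  have eq: "R x h = (LINT t|lborel. indicator {x<..} t *\<^sub>R (C (S t h) *\<^sub>C S t b))" for h
    by (simp add: R_def set_lebesgue_integral_def)
  have on: "indicator {x<..} t *\<^sub>R u = indicator {x<..} t *\<^sub>R u'" if "0 \<le> t \<Longrightarrow> u = u'" for t and u u' :: 'a
    using that assms by (auto simp: indicator_def)
  show "bounded_linear (R x)"
  proof (rule bounded_linear_intro)
    fix g h
    have "R x (g + h) = (LINT t:{x<..}|lborel. C (S t g) *\<^sub>C S t b + C (S t h) *\<^sub>C S t b)"
      unfolding eq set_lebesgue_integral_def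
      by (intro Bochner_Integration.integral_cong refl on)
        (simp add: linear_add[OF bounded_linear.linear[OF CS_linear]] scaleC_add_left)
    then show "R x (g + h) = R x g + R x h"
      unfolding R_def by (simp add: set_integral_add int)
  next
    fix r h
    have "R x (r *\<^sub>R h) = (LINT t:{x<..}|lborel. r *\<^sub>R (C (S t h) *\<^sub>C S t b))"
      unfolding eq set_lebesgue_integral_def
      by (intro Bochner_Integration.integral_cong refl on)
        (simp add: linear_scale[OF bounded_linear.linear[OF CS_linear]]
          linear_scale[OF bounded_linear.linear[OF bounded_linear_scaleC_left]])
    then show "R x (r *\<^sub>R h) = r *\<^sub>R R x h"
      unfolding R_def by simp
  next
    show "norm (R x h) \<le> norm h * M\<^sup>2" for h using norm_R_le[OF assms, of h] by (simp add: mult.commute)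
  qed
  show "\<forall>a h. R x (a *\<^sub>C h) = a *\<^sub>C R x h"
  proof (intro allI)
    fix a h
    have "R x (a *\<^sub>C h) = (LINT t|lborel. a *\<^sub>C (indicator {x<..} t *\<^sub>R (C (S t h) *\<^sub>C S t b)))"
      unfolding eq linear_scale[OF bounded_linear.linear[OF bounded_linear_scaleC_right], symmetric]
      unfolding linear_scale[OF bounded_linear.linear[OF bounded_linear_scaleC_right]]
      by (intro Bochner_Integration.integral_cong refl on)
        (simp add: bounded_clinear_scaleC[OF CS_clinear] scaleC_scaleC scaleC_complex_def)
    also have "\<dots> = a *\<^sub>C R x h"
      unfolding eq
      by (rule integral_bounded_linear[OF bounded_linear_scaleC_right int[unfolded set_integrable_def]])
    finally show "R x (a *\<^sub>C h) = a *\<^sub>C R x h" .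
  qed
qed

lemma R_linear: "0 \<le> x \<Longrightarrow> bounded_linear (R x)"
  by (rule bounded_clinear_imp_linear[OF R_clinear])

lemma R_has_vector_derivative:
  "0 < x \<Longrightarrow> ((\<lambda>x. R x h) has_vector_derivative - (C (S x h) *\<^sub>C S x b)) (at x)"
  unfolding R_def
  by (intro tail_integral_has_vector_derivative Cb_continuous Cb_set_integrable) auto

lemma norm_R_diff_le:
  assumes "0 \<le> x" "x \<le> y" shows "norm (R x h - R y h) \<le> L * norm h * L * (y - x)"
  unfolding R_def set_integral_tail_diff[OF Cb_set_integrable[OF assms(1)] assms(2)]
proof (rule norm_set_integral_interval_le[OF _ assms(2)])
  show "set_integrable lborel {x<..y} (\<lambda>t. C (S t h) *\<^sub>C S t b)"
    by (rule set_integrable_subset[OF Cb_set_integrable[OF assms(1)]]) auto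
  show "norm (C (S t h) *\<^sub>C S t b) \<le> L * norm h * L" if "x < t" "t \<le> y" for t
    unfolding norm_scaleC using that assms L_pos C_bound[of t h] b_bound[of t]
    by (intro mult_mono) auto
qed

lemma R_continuous: "continuous_on {0..} (\<lambda>x. R x h)"
proof (rule lipschitz_on_continuous_on)
  have "dist (R x h) (R y h) \<le> L * norm h * L * dist x y" if "0 \<le> x" "0 \<le> y" for x y
  proof (cases "x \<le> y")
    case True
    then show ?thesis using norm_R_diff_le[OF that(1) True, of h] by (simp add: dist_norm)
  next
    case False
    then show ?thesis using norm_R_diff_le[OF that(2), of x h]
      by (simp add: dist_norm norm_minus_commute)
  qed
  then show "(L * norm h * L)-lipschitz_on {0..} (\<lambda>x. R x h)"
    using L_pos by (intro lipschitz_onI) auto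
qed

lemma S_applied_continuous: "continuous_on {0..} v \<Longrightarrow> continuous_on {0..} (\<lambda>x. S x (v x))"
  by (rule bounded_family_continuous_on[where K = L]) (auto simp: S_linear S_bound S_continuous)

lemma R_applied_continuous: "continuous_on {0..} v \<Longrightarrow> continuous_on {0..} (\<lambda>x. R x (v x))"
  by (rule bounded_family_continuous_on[where K = "M\<^sup>2"]) (auto simp: R_linear norm_R_le R_continuous)

lemma R_power_continuous:
  "continuous_on {0..} v \<Longrightarrow> continuous_on {0..} (\<lambda>x. (R x ^^ j) (v x))"
  by (induction j) (auto intro: R_applied_continuous)

text \<open>Both factors \<open>S\<^sub>t b\<close> and \<open>C S\<^sub>t\<close> of the kernel are shifted by \<open>s\<close>; substitute in the
  integral.\<close>

lemma S_R_S:
  assumes "0 \<le> s" "0 \<le> x" shows "S s (R x (S s h)) = R (x + s) h"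
proof -
  have "S s (R x (S s h)) = (LINT t|lborel. S s (indicator {x<..} t *\<^sub>R (C (S t (S s h)) *\<^sub>C S t b)))"
    unfolding R_def set_lebesgue_integral_def
    by (rule integral_bounded_linear[OF S_linear[OF assms(1)] Cb_set_integrable[OF assms(2), unfolded set_integrable_def], symmetric])
  also have "\<dots> = (LINT t|lborel. indicator {x + s<..} (s + 1 * t) *\<^sub>R (C (S (s + 1 * t) h) *\<^sub>C S (s + 1 * t) b))"
  proof (intro Bochner_Integration.integral_cong refl)
    fix t :: real
    show "S s (indicator {x<..} t *\<^sub>R (C (S t (S s h)) *\<^sub>C S t b)) =
        indicator {x + s<..} (s + 1 * t) *\<^sub>R (C (S (s + 1 * t) h) *\<^sub>C S (s + 1 * t) b)"
    proof (cases "x < t")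
      case True
      have "S t (S s h) = S (s + t) h" using S_add[of t s h] True assms by (simp add: add.commute)
      moreover have "S s (S t b) = S (s + t) b" using S_add[of s t b] True assms by simp
      ultimately show ?thesis using True assms
        by (simp add: bounded_clinear_scaleC[OF S_clinear])
    next
      case False
      then show ?thesis by (simp add: linear_0[OF bounded_linear.linear[OF S_linear[OF assms(1)]]])
    qed
  qed
  also have "\<dots> = R (x + s) h"
    unfolding R_def set_lebesgue_integral_def
    by (subst lborel_integral_real_affine[where c = 1 and t = s]) auto
  finally show ?thesis .
qed

section \<open>Minors of \<open>R\<close>\<close>

definition kern :: "real \<Rightarrow> 'a \<Rightarrow> 'a \<Rightarrow> complex"
  where "kern x e f = cinner e (R x f)"

definition minor :: "real \<Rightarrow> 'a set \<Rightarrow> complex"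
  where "minor x F = det_on F (kern x)"

text \<open>This is minus the derivative of \<^term>\<open>minor x F\<close> with respect to \<open>x\<close>.\<close>

definition minor_rate :: "real \<Rightarrow> 'a set \<Rightarrow> complex"
  where "minor_rate x F =
    (\<Sum>e\<in>F. cinner e (S x b) * det_on F ((kern x)(e := \<lambda>f. C (S x f))))"

lemma kern_has_vector_derivative:
  assumes "0 < x"
  shows "((\<lambda>x. kern x e f) has_vector_derivative - cinner e (S x b) * C (S x f)) (at x)"
  using bounded_linear.has_vector_derivative[OF bounded_linear_cinner_right R_has_vector_derivative[OF assms, of f], of e]
  by (simp add: kern_def cinner_minus_right cinner_scaleC_right mult.commute)

lemma minor_has_vector_derivative:
  assumes "0 < x" "finite F"
  shows "((\<lambda>x. minor x F) has_vector_derivative - minor_rate x F) (at x)"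
proof -
  have "((\<lambda>x. det_on F (\<lambda>i j. kern x i j)) has_vector_derivative
      (\<Sum>e\<in>F. det_on F ((\<lambda>i j. kern x i j)(e := \<lambda>f. - cinner e (S x b) * C (S x f))))) (at x)"
    by (intro has_vector_derivative_det_on kern_has_vector_derivative assms)
  also have "(\<Sum>e\<in>F. det_on F ((\<lambda>i j. kern x i j)(e := \<lambda>f. - cinner e (S x b) * C (S x f)))) = - minor_rate x F"
    unfolding minor_rate_def sum_negf[symmetric]
    using assms(2) by (intro sum.cong refl) (subst det_on_row_scale, auto)
  finally show ?thesis by (simp add: minor_def)
qed

definition u :: "'a \<Rightarrow> real" where "u e = sqrt (LINT t|halfline. (norm (cinner e (S t b)))\<^sup>2)"
definition v :: "'a \<Rightarrow> real" where "v e = sqrt (LINT t|halfline. (norm (C (S t e)))\<^sup>2)"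

lemma uv_nonneg [simp]: "0 \<le> u e" "0 \<le> v e"
  by (auto simp: u_def v_def)

lemma u_L2: "orthonormal G \<Longrightarrow> finite G \<Longrightarrow> L2_set u G \<le> M"
  using b_hs M_nonneg by (auto simp: L2_set_def u_def intro!: real_le_lsqrt)

lemma v_L2: "orthonormal G \<Longrightarrow> finite G \<Longrightarrow> L2_set v G \<le> M"
  using C_hs M_nonneg by (auto simp: L2_set_def v_def intro!: real_le_lsqrt)

lemma b_L2: "orthonormal G \<Longrightarrow> finite G \<Longrightarrow> 0 \<le> x \<Longrightarrow> L2_set (\<lambda>e. norm (cinner e (S x b))) G \<le> L"
  using bessel_inequality[of G G "S x b"] b_bound[of x] L_pos
  unfolding L2_set_def by (intro real_le_lsqrt) (auto intro: order_trans power_mono)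

lemma C_L2: "orthonormal G \<Longrightarrow> finite G \<Longrightarrow> 0 \<le> x \<Longrightarrow> L2_set (\<lambda>e. norm (C (S x e))) G \<le> L"
  using bounded_functional_coefficients[of G G "\<lambda>h. C (S x h)" L] C_bound[of x] CS_clinear[of x] L_pos
  unfolding L2_set_def by (intro real_le_lsqrt) auto

lemma sum_mult_le_L2:
  assumes "\<And>e. e \<in> G \<Longrightarrow> 0 \<le> (f e :: real)" "\<And>e. e \<in> G \<Longrightarrow> 0 \<le> g e" "L2_set f G \<le> X" "L2_set g G \<le> Y"
  shows "(\<Sum>e\<in>G. f e * g e) \<le> X * Y"
proof -
  have "(\<Sum>e\<in>G. f e * g e) = (\<Sum>e\<in>G. \<bar>f e\<bar> * \<bar>g e\<bar>)" using assms by (intro sum.cong) auto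
  also have "\<dots> \<le> L2_set f G * L2_set g G" by (rule L2_set_mult_ineq)
  also have "\<dots> \<le> X * Y"
    using assms by (intro mult_mono) (auto intro: L2_set_nonneg order_trans)
  finally show ?thesis .
qed

lemma norm_kern_le: "0 \<le> x \<Longrightarrow> norm (kern x e f) \<le> u e * v f"
  unfolding kern_def u_def v_def by (rule norm_cinner_R_le)

text \<open>The matrix of \<open>R x\<close> is dominated by the products \<open>u e * v f\<close>. In the rate of change the
  entries of one row are replaced by products of the coefficients of \<open>S\<^sub>x b\<close> and of \<open>C S\<^sub>x\<close>;
  to dominate these as well, \<open>u\<close> and \<open>v\<close> are enlarged by a small multiple \<open>s\<close> of those
  coefficients.\<close>

definition w :: "real \<Rightarrow> real \<Rightarrow> 'a \<Rightarrow> real"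
  where "w s x e = (u e + s * norm (cinner e (S x b))) * (v e + s * norm (C (S x e)))"

lemma w_nonneg: "0 \<le> s \<Longrightarrow> 0 \<le> w s x e"
  by (simp add: w_def)

lemma norm_minor_le:
  assumes "finite F" "0 \<le> x" "0 \<le> s"
  shows "norm (minor x F) \<le> fact (card F) * (\<Prod>e\<in>F. w s x e)"
  unfolding minor_def w_def
proof (rule norm_det_on_le[OF assms(1)])
  fix e f
  show "norm (kern x e f) \<le> (u e + s * norm (cinner e (S x b))) * (v f + s * norm (C (S x f)))"
    using assms by (intro order_trans[OF norm_kern_le] mult_mono) auto
qed

text \<open>Multiplied by \<open>s\<^sup>2\<close>, the entries of the replaced row are bounded by products of the second
  summands in the factors of \<open>w\<close>. The factor \<open>2 ^ card F\<close> is a bound for the number of rows.\<close>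

lemma norm_minor_rate_le:
  assumes F: "finite F" and "0 \<le> x" and s: "0 < s"
  shows "norm (minor_rate x F) \<le> (1 / s)\<^sup>2 * 2 ^ card F * (fact (card F) * (\<Prod>e\<in>F. w s x e))"
proof -
  let ?u = "\<lambda>e. u e + s * norm (cinner e (S x b))" and ?v = "\<lambda>e. v e + s * norm (C (S x e))"
  have row_le: "norm (cinner e (S x b) * det_on F ((kern x)(e := \<lambda>f. C (S x f))))
      \<le> (1 / s)\<^sup>2 * (fact (card F) * (\<Prod>e\<in>F. w s x e))" if e: "e \<in> F" for e
  proof -
    have "(\<lambda>f. (complex_of_real s * cinner e (S x b)) * (complex_of_real s * C (S x f))) =
        (\<lambda>f. (complex_of_real (s\<^sup>2) * cinner e (S x b)) * C (S x f))"
      by (simp add: power2_eq_square mult_ac)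
    then have "det_on F ((kern x)(e := \<lambda>f. (complex_of_real s * cinner e (S x b)) * (complex_of_real s * C (S x f))))
        = (complex_of_real (s\<^sup>2) * cinner e (S x b)) * det_on F ((kern x)(e := \<lambda>f. C (S x f)))"
      by (simp only: det_on_row_scale[OF F e])
    moreover have "complex_of_real ((1/s)\<^sup>2) * complex_of_real (s\<^sup>2) = 1"
      using s by (simp add: power_divide flip: of_real_mult)
    ultimately have "cinner e (S x b) * det_on F ((kern x)(e := \<lambda>f. C (S x f))) = complex_of_real ((1/s)\<^sup>2) *
        det_on F ((kern x)(e := \<lambda>f. (complex_of_real s * cinner e (S x b)) * (complex_of_real s * C (S x f))))"
      by (metis mult.assoc mult_1_left)
    then have "norm (cinner e (S x b) * det_on F ((kern x)(e := \<lambda>f. C (S x f)))) = (1/s)\<^sup>2 *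
        norm (det_on F ((kern x)(e := \<lambda>f. (complex_of_real s * cinner e (S x b)) * (complex_of_real s * C (S x f)))))"
      by (simp only: norm_mult norm_of_real abs_power2)
    also have "\<dots> \<le> (1/s)\<^sup>2 * (fact (card F) * (\<Prod>e\<in>F. w s x e))"
    proof (rule mult_left_mono)
      show "norm (det_on F ((kern x)(e := \<lambda>f. (complex_of_real s * cinner e (S x b)) * (complex_of_real s * C (S x f)))))
          \<le> fact (card F) * (\<Prod>e\<in>F. w s x e)"
        unfolding w_def
      proof (rule norm_det_on_le[OF F])
        fix i f assume "i \<in> F" "f \<in> F"
        have "norm (kern x i f) \<le> ?u i * ?v f"
          using assms by (intro order_trans[OF norm_kern_le] mult_mono) auto
        moreover have "norm ((complex_of_real s * cinner e (S x b)) * (complex_of_real s * C (S x f))) \<le> ?u e * ?v f"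
          unfolding norm_mult norm_of_real using s by (intro mult_mono) auto
        ultimately show "norm (((kern x)(e := \<lambda>f. (complex_of_real s * cinner e (S x b)) * (complex_of_real s * C (S x f)))) i f)
            \<le> ?u i * ?v f" by simp
      qed
    qed simp
    finally show ?thesis .
  qed
  have "norm (minor_rate x F) \<le> (\<Sum>e\<in>F. (1 / s)\<^sup>2 * (fact (card F) * (\<Prod>e\<in>F. w s x e)))"
    unfolding minor_rate_def by (rule sum_norm_le[OF row_le])
  also have "\<dots> = (1 / s)\<^sup>2 * card F * (fact (card F) * (\<Prod>e\<in>F. w s x e))" by simp
  also have "\<dots> \<le> (1 / s)\<^sup>2 * 2 ^ card F * (fact (card F) * (\<Prod>e\<in>F. w s x e))"
  proof (intro mult_right_mono mult_left_mono mult_nonneg_nonneg prod_nonneg)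
    show "real (card F) \<le> 2 ^ card F" using less_exp[of "card F"] by (metis less_imp_le of_nat_le_iff of_nat_numeral of_nat_power)
  qed (use s in \<open>auto intro: w_nonneg\<close>)
  finally show ?thesis .
qed

lemma uv_tail_small:
  assumes E: "orthonormal E" and "0 < \<eta>"
  shows "\<exists>G0. finite G0 \<and> G0 \<subseteq> E \<and> (\<forall>G. finite G \<longrightarrow> G \<subseteq> E - G0 \<longrightarrow> (\<Sum>e\<in>G. u e * v e) \<le> \<eta>)"
proof -
  let ?A = "(\<lambda>G. \<Sum>e\<in>G. u e * v e) ` {G. finite G \<and> G \<subseteq> E}"
  have sub: "orthonormal G" if "G \<subseteq> E" for G by (rule orthonormal_subset[OF E that])
  have le: "(\<Sum>e\<in>G. u e * v e) \<le> M * M" if "finite G" "G \<subseteq> E" for G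
    using u_L2[OF sub[OF that(2)] that(1)] v_L2[OF sub[OF that(2)] that(1)]
    by (intro sum_mult_le_L2) auto
  then have bdd: "bdd_above ?A" by (auto intro!: bdd_aboveI)
  have ne: "?A \<noteq> {}" by auto
  have "Sup ?A - \<eta> < Sup ?A" using assms by simp
  then obtain G0 where G0: "finite G0" "G0 \<subseteq> E" "Sup ?A - \<eta> < (\<Sum>e\<in>G0. u e * v e)"
    using less_cSup_iff[OF ne bdd] by auto
  have "(\<Sum>e\<in>G. u e * v e) \<le> \<eta>" if G: "finite G" "G \<subseteq> E - G0" for G
  proof -
    have "(\<Sum>e\<in>G \<union> G0. u e * v e) = (\<Sum>e\<in>G. u e * v e) + (\<Sum>e\<in>G0. u e * v e)"
      using G G0 by (intro sum.union_disjoint) auto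
    moreover have "(\<Sum>e\<in>G \<union> G0. u e * v e) \<le> Sup ?A"
      using G G0 by (intro cSup_upper bdd) auto
    ultimately show ?thesis using G0 by linarith
  qed
  then show ?thesis using G0 by blast
qed

text \<open>The sums of the \<open>k\<close>-rowed minors decay faster than every geometric sequence, uniformly in
  \<open>x\<close>. A minor is at most \<open>k!\<close> times the product of the weights \<open>w\<close> of its rows, and the
  weights are summable: outside a finite set \<open>G0\<close> they are small, and on \<open>G0\<close> they may be
  scaled down.\<close>

lemma minor_sums_bound:
  assumes E: "orthonormal E" and "0 < \<epsilon>"
  shows "\<exists>K\<ge>0. \<forall>k x G. 0 \<le> x \<longrightarrow> finite G \<longrightarrow> G \<subseteq> E \<longrightarrow>
    (\<Sum>F | F \<subseteq> G \<and> card F = k. norm (minor x F)) \<le> K * \<epsilon> ^ k \<and>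
    (\<Sum>F | F \<subseteq> G \<and> card F = k. norm (minor_rate x F)) \<le> K * \<epsilon> ^ k"
proof -
  \<comment> \<open>The ratio below is at most \<open>3 \<eta>\<close>, and \<open>2 ^ k\<close> comes from the number of rows.\<close>
  define \<eta> where "\<eta> = \<epsilon> / 6"
  have \<eta>: "0 < \<eta>" using assms by (simp add: \<eta>_def)
  obtain G0 where G0: "finite G0" "G0 \<subseteq> E"
    "\<And>G. finite G \<Longrightarrow> G \<subseteq> E - G0 \<Longrightarrow> (\<Sum>e\<in>G. u e * v e) \<le> \<eta>"
    using uv_tail_small[OF E \<eta>] by blast
  define N where "N = M * L + L * M + L * L"
  have N: "0 \<le> N" using M_nonneg L_pos by (simp add: N_def)
  define s where "s = min 1 (\<eta> / (1 + N))"
  have s: "0 < s" "s \<le> 1" "s * N \<le> \<eta>"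
  proof -
    have "s * N \<le> (\<eta> / (1 + N)) * N" using N by (intro mult_right_mono) (auto simp: s_def)
    also have "\<dots> \<le> \<eta>" using N \<eta> by (simp add: field_simps)
    finally show "s * N \<le> \<eta>" .
  qed (use \<eta> N in \<open>auto simp: s_def\<close>)
  define \<delta> where "\<delta> = min 1 (\<eta> / (1 + M * M + N))"
  have \<delta>: "0 < \<delta>" "\<delta> \<le> 1" "\<delta> * (M * M + N) \<le> \<eta>"
  proof -
    have "\<delta> * (M * M + N) \<le> (\<eta> / (1 + M * M + N)) * (M * M + N)"
      using N by (intro mult_right_mono) (auto simp: \<delta>_def)
    also have "\<dots> \<le> \<eta>" using N \<eta> by (simp add: field_simps add_pos_nonneg)
    finally show "\<delta> * (M * M + N) \<le> \<eta>" .
  qed (use \<eta> N in \<open>auto simp: \<delta>_def add_pos_nonneg\<close>)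
  have w_sum: "(\<Sum>e\<in>G. w s x e) \<le> (\<Sum>e\<in>G. u e * v e) + s * N"
    if x: "0 \<le> x" and G: "finite G" "G \<subseteq> E" for x G
  proof -
    have on: "orthonormal G" using G by (intro orthonormal_subset[OF E]) auto
    note L2 = u_L2[OF on G(1)] v_L2[OF on G(1)] b_L2[OF on G(1) x] C_L2[OF on G(1) x]
    have s_N: "s * s * (L * L) \<le> s * (L * L)"
      using s L_pos by (intro mult_right_mono) (auto simp: mult_le_cancel_left1)
    have "(\<Sum>e\<in>G. w s x e) = (\<Sum>e\<in>G. u e * v e) + s * (\<Sum>e\<in>G. u e * norm (C (S x e)))
        + s * (\<Sum>e\<in>G. norm (cinner e (S x b)) * v e)
        + s * s * (\<Sum>e\<in>G. norm (cinner e (S x b)) * norm (C (S x e)))"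
      unfolding w_def by (simp add: algebra_simps sum.distrib sum_distrib_left)
    also have "\<dots> \<le> (\<Sum>e\<in>G. u e * v e) + s * (M * L) + s * (L * M) + s * s * (L * L)"
      using L2 s by (intro add_mono order_refl mult_left_mono sum_mult_le_L2) auto
    also have "\<dots> \<le> (\<Sum>e\<in>G. u e * v e) + s * N" using s_N by (simp add: N_def algebra_simps)
    finally show ?thesis .
  qed
  define K where "K = (1 / s)\<^sup>2 * (1 / \<delta>) ^ card G0"
  have core: "(\<Sum>F | F \<subseteq> G \<and> card F = k. fact k * (\<Prod>e\<in>F. w s x e)) \<le> (1 / \<delta>) ^ card G0 * (\<epsilon> / 2) ^ k"
    if x: "0 \<le> x" and G: "finite G" "G \<subseteq> E" for x G k
  proof -
    have "(\<Sum>F | F \<subseteq> G \<and> card F = k. fact k * (\<Prod>e\<in>F. w s x e))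
        \<le> (1 / \<delta>) ^ card G0 * (\<delta> * (M * M + N) + 2 * \<eta>) ^ k"
    proof (rule k_subset_sum_le[OF G(1) w_nonneg G0(1) \<delta>(1,2)])
      have on: "orthonormal (G \<inter> G0)" using G by (intro orthonormal_subset[OF E]) auto
      have "(\<Sum>e\<in>G \<inter> G0. w s x e) \<le> (\<Sum>e\<in>G \<inter> G0. u e * v e) + s * N"
        using G by (intro w_sum x) auto
      also have "(\<Sum>e\<in>G \<inter> G0. u e * v e) \<le> M * M"
        using u_L2[OF on] v_L2[OF on] G by (intro sum_mult_le_L2) auto
      also have "s * N \<le> N" using s N by (simp add: mult_left_le_one_le)
      finally show "(\<Sum>e\<in>G \<inter> G0. w s x e) \<le> M * M + N" by simp
      have "(\<Sum>e\<in>G - G0. w s x e) \<le> (\<Sum>e\<in>G - G0. u e * v e) + s * N"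
        using G by (intro w_sum x) auto
      also have "\<dots> \<le> \<eta> + \<eta>" using G s by (intro add_mono G0(3)) auto
      finally show "(\<Sum>e\<in>G - G0. w s x e) \<le> 2 * \<eta>" by simp
    qed (use s in auto)
    also have "\<dots> \<le> (1 / \<delta>) ^ card G0 * (\<epsilon> / 2) ^ k"
      using \<delta> \<eta> N by (intro mult_left_mono power_mono) (auto simp: \<eta>_def)
    finally show ?thesis .
  qed
  have fin: "finite F" if "F \<subseteq> G" "finite G" for F G :: "'a set" using that finite_subset by blast
  show ?thesis
  proof (intro exI[of _ K] conjI allI impI)
    show "0 \<le> K" using s \<delta> by (simp add: K_def)
    fix k :: nat and x :: real and G :: "'a set" assume *: "0 \<le> x" "finite G" "G \<subseteq> E"
    have le: "(\<Sum>F | F \<subseteq> G \<and> card F = k. norm (minor x F)) \<le> (1 / \<delta>) ^ card G0 * (\<epsilon> / 2) ^ k"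
      using * s by (intro order_trans[OF sum_mono core[OF *]]) (use norm_minor_le fin in fastforce)
    also have "\<dots> \<le> K * \<epsilon> ^ k"
    proof (rule mult_mono)
      have "1 \<le> (1 / s)\<^sup>2" using s by (simp add: one_le_power)
      then show "(1 / \<delta>) ^ card G0 \<le> K" unfolding K_def using \<delta> by (simp add: mult_le_cancel_right1)
      show "(\<epsilon> / 2) ^ k \<le> \<epsilon> ^ k" using assms by (intro power_mono) auto
    qed (use \<open>0 \<le> K\<close> assms in auto)
    finally show "(\<Sum>F | F \<subseteq> G \<and> card F = k. norm (minor x F)) \<le> K * \<epsilon> ^ k" .
    have "(\<Sum>F | F \<subseteq> G \<and> card F = k. norm (minor_rate x F))
        \<le> (\<Sum>F | F \<subseteq> G \<and> card F = k. (1 / s)\<^sup>2 * 2 ^ k * (fact k * (\<Prod>e\<in>F. w s x e)))"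
      using norm_minor_rate_le[OF fin *(1) s(1)] *(2) by (intro sum_mono) blast
    also have "\<dots> = (1 / s)\<^sup>2 * 2 ^ k * (\<Sum>F | F \<subseteq> G \<and> card F = k. fact k * (\<Prod>e\<in>F. w s x e))"
      by (rule sum_distrib_left[symmetric])
    also have "\<dots> \<le> (1 / s)\<^sup>2 * 2 ^ k * ((1 / \<delta>) ^ card G0 * (\<epsilon> / 2) ^ k)"
      by (intro mult_left_mono core *) auto
    also have "\<dots> = K * \<epsilon> ^ k" by (simp add: K_def power_divide)
    finally show "(\<Sum>F | F \<subseteq> G \<and> card F = k. norm (minor_rate x F)) \<le> K * \<epsilon> ^ k" .
  qed
qed

end

section \<open>Traces of exterior powers\<close>

text \<open>A bound for the absolute sums over the members of an exhaustion by finite sets gives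
  absolute convergence, and the sum can then be computed along the exhaustion.\<close>

lemma k_subset_infsum:
  fixes f :: "'a set \<Rightarrow> complex" and G :: "nat \<Rightarrow> 'a set"
  assumes G: "\<And>n. finite (G n)" "\<And>n. G n \<subseteq> E" "incseq G" "(\<Union>n. G n) = E"
    and K: "\<And>n. (\<Sum>F | F \<subseteq> G n \<and> card F = k. norm (f F)) \<le> K"
  shows "(\<lambda>n. \<Sum>F | F \<subseteq> G n \<and> card F = k. f F) \<longlonglongrightarrow> (\<Sum>\<^sub>\<infinity>F\<in>{F. F \<subseteq> E \<and> finite F \<and> card F = k}. f F)"
    and "norm (\<Sum>\<^sub>\<infinity>F\<in>{F. F \<subseteq> E \<and> finite F \<and> card F = k}. f F) \<le> K"
proof -
  let ?A = "{F. F \<subseteq> E \<and> finite F \<and> card F = k}" and ?G = "\<lambda>n. {F. F \<subseteq> G n \<and> card F = k}"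
  have fin: "finite (?G n)" for n using G(1)[of n] by simp
  have cover: "eventually (\<lambda>n. X \<subseteq> ?G n) sequentially" if X: "finite X" "X \<subseteq> ?A" for X
  proof -
    have "eventually (\<lambda>n. \<Union>X \<subseteq> G n) sequentially"
      using X by (intro exhaustion_eventually[OF G(3,4)]) auto
    then show ?thesis by eventually_elim (use X in auto)
  qed
  have summ: "(\<lambda>F. norm (f F)) summable_on ?A"
  proof (rule nonneg_bdd_above_summable_on)
    show "bdd_above (sum (\<lambda>F. norm (f F)) ` {X. X \<subseteq> ?A \<and> finite X})"
    proof (rule bdd_aboveI2)
      fix X assume "X \<in> {X. X \<subseteq> ?A \<and> finite X}"
      then obtain n where "X \<subseteq> ?G n"
        using cover[of X] eventually_happens'[OF sequentially_bot] by blast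
      then have "(\<Sum>F\<in>X. norm (f F)) \<le> (\<Sum>F\<in>?G n. norm (f F))"
        using fin by (intro sum_mono2) auto
      then show "(\<Sum>F\<in>X. norm (f F)) \<le> K" using K[of n] by linarith
    qed
  qed simp
  have "(sum f \<longlongrightarrow> infsum f ?A) (finite_subsets_at_top ?A)"
    by (rule infsum_tendsto[OF abs_summable_summable[OF summ]])
  moreover have "filterlim ?G (finite_subsets_at_top ?A) sequentially"
    unfolding filterlim_finite_subsets_at_top
  proof (intro allI impI)
    fix X assume "finite X \<and> X \<subseteq> ?A"
    then have "eventually (\<lambda>n. X \<subseteq> ?G n) sequentially" using cover by blast
    moreover have "finite (?G n) \<and> ?G n \<subseteq> ?A" for n
      using fin G(1,2) by (auto intro: finite_subset)
    ultimately show "eventually (\<lambda>n. finite (?G n) \<and> X \<subseteq> ?G n \<and> ?G n \<subseteq> ?A) sequentially"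
      by (auto elim: eventually_mono)
  qed
  ultimately show lim: "(\<lambda>n. \<Sum>F\<in>?G n. f F) \<longlonglongrightarrow> infsum f ?A"
    by (rule filterlim_compose)
  show "norm (infsum f ?A) \<le> K"
  proof (rule LIMSEQ_le_const2[OF tendsto_norm[OF lim]])
    show "\<exists>N. \<forall>n\<ge>N. norm (\<Sum>F\<in>?G n. f F) \<le> K"
      using K norm_sum order_trans by blast
  qed
qed

locale scalar_system_basis = scalar_system +
  fixes E :: "'a set" and G :: "nat \<Rightarrow> 'a set"
  assumes E_basis: "orthonormal_basis E"
    and G: "finite (G n)" "G n \<subseteq> E" "incseq G" "(\<Union>n. G n) = E"
begin

lemmas E_orthonormal = orthonormal_basisD(1)[OF E_basis]

definition trace_ext :: "nat \<Rightarrow> real \<Rightarrow> complex"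
  where "trace_ext k x = (\<Sum>\<^sub>\<infinity>F\<in>{F. F \<subseteq> E \<and> finite F \<and> card F = k}. minor x F)"

definition trace_ext_rate :: "nat \<Rightarrow> real \<Rightarrow> complex"
  where "trace_ext_rate k x = (\<Sum>\<^sub>\<infinity>F\<in>{F. F \<subseteq> E \<and> finite F \<and> card F = k}. minor_rate x F)"

lemma trace_ext_bound:
  assumes "0 < \<epsilon>"
  shows "\<exists>K\<ge>0. \<forall>k x. 0 \<le> x \<longrightarrow> norm (trace_ext k x) \<le> K * \<epsilon> ^ k \<and> norm (trace_ext_rate k x) \<le> K * \<epsilon> ^ k"
proof -
  obtain K where K: "K \<ge> 0" "\<And>k x G. 0 \<le> x \<Longrightarrow> finite G \<Longrightarrow> G \<subseteq> E \<Longrightarrow>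
    (\<Sum>F | F \<subseteq> G \<and> card F = k. norm (minor x F)) \<le> K * \<epsilon> ^ k \<and>
    (\<Sum>F | F \<subseteq> G \<and> card F = k. norm (minor_rate x F)) \<le> K * \<epsilon> ^ k"
    using minor_sums_bound[OF E_orthonormal assms] by blast
  show ?thesis
    unfolding trace_ext_def trace_ext_rate_def
    using K G by (intro exI[of _ K] conjI allI impI k_subset_infsum(2)[OF G]) auto
qed

lemma trace_ext_tendsto:
  assumes "0 \<le> x"
  shows "(\<lambda>n. \<Sum>F | F \<subseteq> G n \<and> card F = k. minor x F) \<longlonglongrightarrow> trace_ext k x"
    and "(\<lambda>n. \<Sum>F | F \<subseteq> G n \<and> card F = k. minor_rate x F) \<longlonglongrightarrow> trace_ext_rate k x"
proof -
  obtain K where K: "K \<ge> 0" "\<And>k x G. 0 \<le> x \<Longrightarrow> finite G \<Longrightarrow> G \<subseteq> E \<Longrightarrow>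
    (\<Sum>F | F \<subseteq> G \<and> card F = k. norm (minor x F)) \<le> K * 1 ^ k \<and>
    (\<Sum>F | F \<subseteq> G \<and> card F = k. norm (minor_rate x F)) \<le> K * 1 ^ k"
    using minor_sums_bound[OF E_orthonormal zero_less_one] by blast
  show "(\<lambda>n. \<Sum>F | F \<subseteq> G n \<and> card F = k. minor x F) \<longlonglongrightarrow> trace_ext k x"
    unfolding trace_ext_def using K(2)[OF assms G(1,2)] by (intro k_subset_infsum(1)[OF G]) blast
  show "(\<lambda>n. \<Sum>F | F \<subseteq> G n \<and> card F = k. minor_rate x F) \<longlonglongrightarrow> trace_ext_rate k x"
    unfolding trace_ext_rate_def using K(2)[OF assms G(1,2)] by (intro k_subset_infsum(1)[OF G]) blast
qed

section \<open>The logarithmic derivative of the determinant\<close>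

text \<open>The coefficients of \<open>C S\<^sub>x (I + X R\<^sub>x)\<^sup>-\<^sup>1 S\<^sub>x b\<close> as a power series in \<open>X\<close>.\<close>

definition resolvent_coeff :: "nat \<Rightarrow> real \<Rightarrow> complex"
  where "resolvent_coeff k x = (-1) ^ k * C (S x ((R x ^^ k) (S x b)))"

definition tau_fps :: "real \<Rightarrow> complex fps" where "tau_fps x = Abs_fps (\<lambda>k. trace_ext k x)"
definition rate_fps :: "real \<Rightarrow> complex fps" where "rate_fps x = Abs_fps (\<lambda>k. trace_ext_rate k x)"
definition resolvent_fps :: "real \<Rightarrow> complex fps" where "resolvent_fps x = Abs_fps (\<lambda>k. resolvent_coeff k x)"

text \<open>For the compression of \<open>R x\<close> to the span of \<open>G n\<close>, the row vector \<open>y\<close> of Cramer's rule is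
  the Neumann series of \<open>C S\<^sub>x (I + X P R\<^sub>x)\<^sup>-\<^sup>1\<close>, where \<open>P\<close> is the projection.\<close>

lemma compressed_rate:
  assumes x: "0 \<le> x"
  shows "Abs_fps (\<lambda>k. \<Sum>F | F \<subseteq> G n \<and> card F = k. minor_rate x F) =
    fps_X * Abs_fps (\<lambda>k. \<Sum>F | F \<subseteq> G n \<and> card F = k. minor x F) *
    Abs_fps (\<lambda>k. (-1) ^ k * C (S x (((\<lambda>h. ortho_proj (G n) (R x h)) ^^ k) (ortho_proj (G n) (S x b)))))"
proof -
  define T where "T h = ortho_proj (G n) (R x h)" for h
  have T: "bounded_clinear (T ^^ k)" for k
    unfolding T_def using bounded_clinear_compose[OF ortho_proj_clinear[OF G(1)] R_clinear[OF x]]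
    by (rule bounded_clinear_funpow)
  note CT = bounded_clinear_sum_scaleC[OF bounded_clinear_compose[OF CS_clinear[OF x] T]]
  define y where "y i = Abs_fps (\<lambda>k. (-1) ^ k * C (S x ((T ^^ k) i)))" for i
  have y_eq: "fps_const (C (S x j)) = y j + (\<Sum>i\<in>G n. y i * (fps_X * fps_const (kern x i j)))" for j
  proof (rule fps_ext)
    fix k
    have nth: "fps_nth (\<Sum>i\<in>G n. y i * (fps_X * fps_const (kern x i j))) k =
        (if k = 0 then 0 else \<Sum>i\<in>G n. fps_nth (y i) (k - 1) * kern x i j)"
      unfolding fps_sum_nth mult.left_commute[of "y _" fps_X] by simp
    show "fps_nth (fps_const (C (S x j))) k =
        fps_nth (y j + (\<Sum>i\<in>G n. y i * (fps_X * fps_const (kern x i j)))) k"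
    proof (cases k)
      case 0
      then show ?thesis unfolding fps_add_nth nth by (simp add: y_def)
    next
      case (Suc m)
      have "(\<Sum>i\<in>G n. fps_nth (y i) m * kern x i j) =
          (-1) ^ m * (\<Sum>i\<in>G n. kern x i j *\<^sub>C C (S x ((T ^^ m) i)))"
        by (simp add: y_def scaleC_complex_def sum_distrib_left mult_ac)
      also have "(\<Sum>i\<in>G n. kern x i j *\<^sub>C C (S x ((T ^^ m) i))) = C (S x ((T ^^ m) (T j)))"
        unfolding CT[symmetric] by (simp add: T_def ortho_proj_def kern_def)
      also have "(T ^^ m) (T j) = (T ^^ Suc m) j" by (simp add: funpow_swap1)
      finally show ?thesis unfolding fps_add_nth nth using Suc by (simp add: y_def)
    qed
  qed
  have "(\<Sum>e\<in>G n. fps_const (cinner e (S x b)) * y e) =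
      Abs_fps (\<lambda>k. (-1) ^ k * C (S x ((T ^^ k) (ortho_proj (G n) (S x b)))))"
    by (rule fps_ext)
      (simp add: fps_sum_nth y_def ortho_proj_def CT scaleC_complex_def sum_distrib_left mult_ac)
  then show ?thesis
    using minors_cramer[where G = "G n" and \<gamma> = "\<lambda>j. C (S x j)" and y = y and R = "kern x"
        and \<beta> = "\<lambda>e. cinner e (S x b)", OF G(1) y_eq]
    unfolding minor_rate_def minor_def T_def[abs_def] by (simp only:)
qed

lemma compression_tendsto:
  assumes x: "0 \<le> x"
  shows "(\<lambda>n. ((\<lambda>h. ortho_proj (G n) (R x h)) ^^ k) (ortho_proj (G n) h)) \<longlonglongrightarrow> (R x ^^ k) h"
proof (induction k)
  case 0
  show ?case using ortho_proj_tendsto[OF E_basis G] by simp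
next
  case (Suc k)
  let ?v = "\<lambda>n. ((\<lambda>h. ortho_proj (G n) (R x h)) ^^ k) (ortho_proj (G n) h)" and ?w = "(R x ^^ k) h"
  have "(\<lambda>n. R x (?v n)) \<longlonglongrightarrow> R x ?w"
    by (rule bounded_linear.tendsto[OF R_linear[OF x] Suc])
  then have "(\<lambda>n. norm (R x (?v n) - R x ?w)) \<longlonglongrightarrow> 0" by (simp add: LIM_zero tendsto_norm_zero)
  then have "(\<lambda>n. ortho_proj (G n) (R x (?v n) - R x ?w)) \<longlonglongrightarrow> 0"
    by (rule Lim_null_comparison[rotated]) (simp add: norm_ortho_proj_le[OF E_orthonormal G(1,2)])
  then have "(\<lambda>n. ortho_proj (G n) (R x (?v n) - R x ?w) + ortho_proj (G n) (R x ?w)) \<longlonglongrightarrow> 0 + R x ?w"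
    by (intro tendsto_add ortho_proj_tendsto[OF E_basis G])
  moreover have "ortho_proj (G n) (R x (?v n) - R x ?w) + ortho_proj (G n) (R x ?w) = ortho_proj (G n) (R x (?v n))" for n
    by (simp add: linear_diff[OF bounded_linear.linear[OF bounded_linear_ortho_proj[OF G(1)]]])
  ultimately show ?case by simp
qed

text \<open>The formula \<open>(log \<tau>)' = - \<mu> C S\<^sub>x (I + \<mu> R\<^sub>x)\<^sup>-\<^sup>1 S\<^sub>x b\<close>, as an identity of power series in
  \<open>\<mu>\<close>. It is the limit of its finite dimensional versions, since each coefficient involves
  only finitely many powers of the compressed operators, which converge strongly.\<close>

lemma rate_fps_eq:
  assumes x: "0 \<le> x"
  shows "rate_fps x = fps_X * tau_fps x * resolvent_fps x"
proof (rule fps_ext)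
  fix k
  define P where "P n = Abs_fps (\<lambda>k. (-1) ^ k * C (S x (((\<lambda>h. ortho_proj (G n) (R x h)) ^^ k) (ortho_proj (G n) (S x b)))))" for n
  define A where "A n = Abs_fps (\<lambda>k. \<Sum>F | F \<subseteq> G n \<and> card F = k. minor x F)" for n
  have P: "(\<lambda>n. fps_nth (P n) i) \<longlonglongrightarrow> fps_nth (resolvent_fps x) i" for i
    unfolding P_def resolvent_fps_def resolvent_coeff_def fps_nth_Abs_fps
    by (intro tendsto_mult tendsto_const bounded_linear.tendsto[OF CS_linear[OF x]] compression_tendsto x)
  have A: "(\<lambda>n. fps_nth (A n) i) \<longlonglongrightarrow> fps_nth (tau_fps x) i" for i
    unfolding A_def tau_fps_def fps_nth_Abs_fps by (rule trace_ext_tendsto(1)[OF x])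
  have "(\<lambda>n. fps_nth (A n * P n) i) \<longlonglongrightarrow> fps_nth (tau_fps x * resolvent_fps x) i" for i
    unfolding fps_mult_nth by (intro tendsto_sum tendsto_mult A P)
  then have "(\<lambda>n. fps_nth (fps_X * A n * P n) k) \<longlonglongrightarrow> fps_nth (fps_X * tau_fps x * resolvent_fps x) k"
    unfolding mult.assoc[of fps_X] by (cases k) simp_all
  moreover have "fps_nth (fps_X * A n * P n) k = (\<Sum>F | F \<subseteq> G n \<and> card F = k. minor_rate x F)" for n
    unfolding A_def P_def compressed_rate[OF x, symmetric] by simp
  ultimately show "fps_nth (rate_fps x) k = fps_nth (fps_X * tau_fps x * resolvent_fps x) k"
    using trace_ext_tendsto(2)[OF x, of k] by (simp add: rate_fps_def LIMSEQ_unique)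
qed

text \<open>The rates of change converge pointwise and boundedly along the exhaustion, but perhaps not
  uniformly. So the integrated form passes to the limit, and differentiability follows later
  from the continuity of the limit rate, which the formula for the logarithmic derivative
  provides.\<close>

lemma trace_ext_rate_has_integral:
  assumes "0 < x" "x \<le> y"
  shows "(trace_ext_rate k has_integral trace_ext k x - trace_ext k y) {x..y}"
proof -
  obtain K where K: "K \<ge> 0" "\<And>k x G. 0 \<le> x \<Longrightarrow> finite G \<Longrightarrow> G \<subseteq> E \<Longrightarrow>
    (\<Sum>F | F \<subseteq> G \<and> card F = k. norm (minor x F)) \<le> K * 1 ^ k \<and>
    (\<Sum>F | F \<subseteq> G \<and> card F = k. norm (minor_rate x F)) \<le> K * 1 ^ k"
    using minor_sums_bound[OF E_orthonormal zero_less_one] by blast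
  define a where "a n t = (\<Sum>F | F \<subseteq> G n \<and> card F = k. minor t F)" for n t
  define q where "q n t = (\<Sum>F | F \<subseteq> G n \<and> card F = k. minor_rate t F)" for n t
  have fin: "finite F" if "F \<subseteq> G n" for F n using that G(1) finite_subset by blast
  have int: "(q n has_integral a n x - a n y) {x..y}" for n
  proof -
    have "(a n has_vector_derivative (\<Sum>F | F \<subseteq> G n \<and> card F = k. - minor_rate t F)) (at t within {x..y})"
      if "t \<in> {x..y}" for t
      unfolding a_def[abs_def]
    proof (rule has_vector_derivative_at_within, intro has_vector_derivative_sum minor_has_vector_derivative)
      show "0 < t" using that assms by simp
      show "finite F" if "F \<in> {F. F \<subseteq> G n \<and> card F = k}" for F using that fin by blast
    qed
    then have "((\<lambda>t. - q n t) has_integral a n y - a n x) {x..y}"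
      unfolding q_def sum_negf[symmetric] by (rule fundamental_theorem_of_calculus[OF assms(2)])
    from has_integral_neg[OF this] show ?thesis by simp
  qed
  have dom: "norm (q n t) \<le> K" if "t \<in> {x..y}" for n t
    unfolding q_def using K(2)[of t "G n" k] G(1,2) that assms by (intro order_trans[OF norm_sum]) auto
  have lim: "(\<lambda>n. q n t) \<longlonglongrightarrow> trace_ext_rate k t" if "t \<in> {x..y}" for t
    unfolding q_def using that assms by (intro trace_ext_tendsto(2)) auto
  have ints: "(\<lambda>_. K) integrable_on {x..y}" by (rule integrable_const_ivl)
  note conv = dominated_convergence[OF has_integral_integrable[OF int] ints dom lim]
  have "(\<lambda>n. a n x - a n y) \<longlonglongrightarrow> trace_ext k x - trace_ext k y"
    unfolding a_def using assms by (intro tendsto_diff trace_ext_tendsto(1)) auto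
  then have "(\<lambda>n. integral {x..y} (q n)) \<longlonglongrightarrow> trace_ext k x - trace_ext k y"
    unfolding integral_unique[OF int] .
  then have "integral {x..y} (trace_ext_rate k) = trace_ext k x - trace_ext k y"
    using conv(2) LIMSEQ_unique by blast
  then show ?thesis using conv(1) by (metis has_integral_integral)
qed

lemma trace_ext_continuous: "continuous_on {0<..} (trace_ext k)"
proof -
  obtain K where K: "K \<ge> 0" "\<And>k x. 0 \<le> x \<Longrightarrow> norm (trace_ext_rate k x) \<le> K"
    using trace_ext_bound[of 1] by auto
  have le: "dist (trace_ext k x) (trace_ext k y) \<le> K * dist x y" if "0 < x" "x \<le> y" for x y
    using has_integral_bound[of K "trace_ext_rate k" _ x y, OF K(1)] trace_ext_rate_has_integral[OF that, of k]
      K(2) that by (auto simp: dist_norm)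
  show ?thesis
  proof (rule lipschitz_on_continuous_on, rule lipschitz_onI[OF _ K(1)])
    fix x y :: real assume "x \<in> {0<..}" "y \<in> {0<..}"
    then show "dist (trace_ext k x) (trace_ext k y) \<le> K * dist x y"
      using le[of x y] le[of y x] by (cases "x \<le> y") (auto simp: dist_commute)
  qed
qed

lemma resolvent_coeff_continuous: "continuous_on {0..} (resolvent_coeff k)"
  unfolding resolvent_coeff_def[abs_def]
  by (intro continuous_on_mult continuous_on_const bounded_linear.continuous_on[OF C_linear]
      S_applied_continuous R_power_continuous S_continuous)

lemma trace_ext_rate_continuous: "continuous_on {0<..} (trace_ext_rate k)"
proof (cases k)
  case 0
  have "trace_ext_rate k x = 0" if "x \<in> {0<..}" for x
    using arg_cong[OF rate_fps_eq[of x], of "\<lambda>f. fps_nth f k"] 0 that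
    by (simp add: rate_fps_def mult.assoc)
  then show ?thesis by (intro continuous_on_eq[OF continuous_on_const[of _ 0]]) simp
next
  case (Suc m)
  have "trace_ext_rate k x = (\<Sum>i=0..m. trace_ext i x * resolvent_coeff (m - i) x)" if "x \<in> {0<..}" for x
  proof -
    have "trace_ext_rate k x = fps_nth (fps_X * (tau_fps x * resolvent_fps x)) k"
      using arg_cong[OF rate_fps_eq[of x], of "\<lambda>f. fps_nth f k"] that
      by (simp add: rate_fps_def mult.assoc)
    also have "\<dots> = fps_nth (tau_fps x * resolvent_fps x) m" unfolding Suc fps_X_mult_nth by simp
    finally show ?thesis by (simp add: fps_mult_nth tau_fps_def resolvent_fps_def)
  qed
  moreover have "continuous_on {0<..} (\<lambda>x. \<Sum>i=0..m. trace_ext i x * resolvent_coeff (m - i) x)"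
    by (intro continuous_on_sum continuous_on_mult trace_ext_continuous
        continuous_on_subset[OF resolvent_coeff_continuous]) auto
  ultimately show ?thesis by (metis (no_types, lifting) continuous_on_cong)
qed

lemma trace_ext_has_vector_derivative:
  assumes "0 < x"
  shows "(trace_ext k has_vector_derivative - trace_ext_rate k x) (at x)"
proof -
  let ?I = "{x/2..x+1}"
  have cont: "continuous_on ?I (trace_ext_rate k)"
    by (rule continuous_on_subset[OF trace_ext_rate_continuous]) (use assms in auto)
  have "((\<lambda>t. trace_ext k (x/2) - integral {x/2..t} (trace_ext_rate k)) has_vector_derivative
      0 - trace_ext_rate k x) (at x within ?I)"
    using assms by (intro has_vector_derivative_diff has_vector_derivative_const
        integral_has_vector_derivative[OF cont]) auto
  moreover have "trace_ext k (x/2) - integral {x/2..t} (trace_ext_rate k) = trace_ext k t" if "t \<in> ?I" for t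
    using integral_unique[OF trace_ext_rate_has_integral[of "x/2" t k]] that assms by simp
  ultimately have "(trace_ext k has_vector_derivative 0 - trace_ext_rate k x) (at x within ?I)"
    using assms by (intro has_vector_derivative_transform[of x ?I "trace_ext k"]) auto
  moreover have "at x within ?I = at x" using assms by (intro at_within_Icc_at) auto
  ultimately show ?thesis by simp
qed

end

section \<open>Differentiating the resolvent\<close>

text \<open>A product rule for operators that are differentiable only in the strong sense; the uniform
  bound \<open>K\<close> takes care of the varying argument.\<close>

lemma has_vector_derivative_family_apply:
  fixes T :: "real \<Rightarrow> 'b::real_normed_vector \<Rightarrow> 'c::real_normed_vector"
  assumes A: "open A" "x \<in> A"
    and lin: "\<And>y. y \<in> A \<Longrightarrow> bounded_linear (T y)"
    and bd: "\<And>y h. y \<in> A \<Longrightarrow> norm (T y h) \<le> K * norm h"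
    and T: "((\<lambda>y. T y (v x)) has_vector_derivative D) (at x)"
    and cont: "((\<lambda>y. T y v') \<longlongrightarrow> T x v') (at x)"
    and v: "(v has_vector_derivative v') (at x)"
  shows "((\<lambda>y. T y (v y)) has_vector_derivative T x v' + D) (at x)"
proof -
  let ?ev = "\<lambda>y. norm (v y - v x - (y - x) *\<^sub>R v') / norm (y - x)"
  let ?eT = "\<lambda>y. norm (T y (v x) - T x (v x) - (y - x) *\<^sub>R D) / norm (y - x)"
  have ev: "(?ev \<longlongrightarrow> 0) (at x)" and eT: "(?eT \<longlongrightarrow> 0) (at x)"
    using v T unfolding has_vector_derivative_def has_derivative_iff_norm by auto
  have "((\<lambda>y. norm (T y (v y) - T x (v x) - (y - x) *\<^sub>R (T x v' + D)) / norm (y - x)) \<longlongrightarrow> 0) (at x)"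
  proof (rule Lim_null_comparison)
    have "((\<lambda>y. K * ?ev y + norm (T y v' - T x v') + ?eT y) \<longlongrightarrow> K * 0 + 0 + 0) (at x)"
      using cont by (intro tendsto_add tendsto_mult tendsto_const ev eT tendsto_norm_zero) (simp add: LIM_zero)
    then show "((\<lambda>y. K * ?ev y + norm (T y v' - T x v') + ?eT y) \<longlongrightarrow> 0) (at x)" by simp
    have "eventually (\<lambda>y. y \<in> A) (at x)" using A by (simp add: eventually_at_in_open')
    moreover have "eventually (\<lambda>y. y \<noteq> x) (at x)" by (simp add: eventually_at_filter)
    ultimately show "eventually (\<lambda>y. norm (norm (T y (v y) - T x (v x) - (y - x) *\<^sub>R (T x v' + D)) / norm (y - x))
        \<le> K * ?ev y + norm (T y v' - T x v') + ?eT y) (at x)"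
    proof eventually_elim
      case (elim y)
      interpret Ty: bounded_linear "T y" by (rule lin) (use elim in auto)
      let ?e = "v y - v x - (y - x) *\<^sub>R v'"
      have e: "T y ?e = T y (v y) - T y (v x) - (y - x) *\<^sub>R T y v'"
        by (simp only: Ty.diff Ty.scaleR)
      have "T y (v y) - T x (v x) - (y - x) *\<^sub>R (T x v' + D) =
          T y ?e + (y - x) *\<^sub>R (T y v' - T x v') + (T y (v x) - T x (v x) - (y - x) *\<^sub>R D)"
        unfolding e by (simp add: algebra_simps)
      also have "norm \<dots> \<le> norm (T y ?e) + norm ((y - x) *\<^sub>R (T y v' - T x v')) + norm (T y (v x) - T x (v x) - (y - x) *\<^sub>R D)"
        by (meson norm_triangle_ineq norm_triangle_mono order_refl)
      also have "\<dots> \<le> K * norm ?e + norm (y - x) * norm (T y v' - T x v') + norm (T y (v x) - T x (v x) - (y - x) *\<^sub>R D)"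
        using bd[of y ?e] elim by (intro add_mono) auto
      finally show ?case using elim by (simp add: field_simps)
    qed
  qed
  then show ?thesis
    unfolding has_vector_derivative_def has_derivative_iff_norm
    by (auto intro: bounded_linear_scaleR_left)
qed

context scalar_system
begin

text \<open>\<open>orbit k x = (U R\<^sub>0)\<^sup>k U b\<close> with \<open>U = S\<^sub>2\<^sub>x\<close>. Since \<open>R\<^sub>x = S\<^sub>x R\<^sub>0 S\<^sub>x\<close>, these vectors give
  the coefficients of the resolvent.\<close>

definition orbit :: "nat \<Rightarrow> real \<Rightarrow> 'a"
  where "orbit k x = ((\<lambda>h. S (2 * x) (R 0 h)) ^^ k) (S (2 * x) b)"

lemma S_R_power:
  assumes "0 \<le> x" shows "S x ((R x ^^ k) (S x b)) = orbit k x"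
proof (induction k)
  case 0
  show ?case using S_add[of x x b] assms by (simp add: orbit_def)
next
  case (Suc k)
  let ?h = "(R x ^^ k) (S x b)"
  have "S x (R x ?h) = S x (S x (R 0 (S x ?h)))" using S_R_S[of x 0 ?h] assms by simp
  also have "\<dots> = S (2 * x) (R 0 (orbit k x))" using S_add[of x x] assms Suc by simp
  finally show ?case by (simp add: orbit_def)
qed

lemma R_double: "0 \<le> x \<Longrightarrow> R (2 * x) h = S (2 * x) (R 0 (S (2 * x) h))"
  using S_R_S[of "2 * x" 0 h] by simp

lemma orbit_add_2: "0 \<le> x \<Longrightarrow> orbit (Suc (Suc k)) x = R (2 * x) (R 0 (orbit k x))"
  by (simp add: orbit_def R_double)

lemma orbit_1: "0 \<le> x \<Longrightarrow> orbit (Suc 0) x = R (2 * x) b"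
  by (simp add: orbit_def R_double)

lemma R_double_has_vector_derivative:
  assumes "0 < x"
  shows "((\<lambda>x. R (2 * x) h) has_vector_derivative - (2 * C (S (2 * x) h)) *\<^sub>C S (2 * x) b) (at x)"
proof -
  have d: "((\<lambda>x. 2 * x) has_vector_derivative 2) (at x)"
    using has_vector_derivative_mult_right[OF has_vector_derivative_id, of 2] by simp
  have R: "((\<lambda>y. R y h) has_vector_derivative - (C (S (2 * x) h) *\<^sub>C S (2 * x) b)) (at (2 * x))"
    using assms by (intro R_has_vector_derivative) simp
  have scale: "2 *\<^sub>R - (c *\<^sub>C s) = - (2 * c) *\<^sub>C s" for c and s :: 'a
    using scaleC_of_real[of 2 "- (c *\<^sub>C s)"] scaleC_scaleC[of 2 "- c" s]
    by (simp add: scaleC_minus_left)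
  show ?thesis using vector_diff_chain_at[OF d R] unfolding o_def scale .
qed

text \<open>The vectors of odd index only involve \<open>R\<^sub>2\<^sub>x\<close> and the fixed operator \<open>R\<^sub>0\<close>, so that they are
  differentiable although \<open>S\<^sub>x b\<close> need not be.\<close>

lemma orbit_odd_has_vector_derivative:
  assumes x: "0 < x"
  shows "(orbit (Suc (2 * j)) has_vector_derivative
    (\<Sum>l\<le>j. - (2 * C (orbit (2 * (j - l)) x)) *\<^sub>C orbit (2 * l) x)) (at x)"
proof (induction j)
  case 0
  have "((\<lambda>x. R (2 * x) b) has_vector_derivative - (2 * C (S (2 * x) b)) *\<^sub>C S (2 * x) b) (at x)"
    by (rule R_double_has_vector_derivative[OF x])
  moreover have "orbit (Suc 0) y = R (2 * y) b" if "y \<in> {0<..}" for y using that by (simp add: orbit_1)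
  ultimately have "(orbit (Suc 0) has_vector_derivative - (2 * C (S (2 * x) b)) *\<^sub>C S (2 * x) b) (at x)"
    using x by (intro has_vector_derivative_transform_within_open[of _ _ _ "{0<..}" "orbit (Suc 0)"]) auto
  moreover have "orbit 0 x = S (2 * x) b" by (simp add: orbit_def)
  ultimately show ?case by simp
next
  case (Suc j)
  let ?D = "\<lambda>j. \<Sum>l\<le>j. - (2 * C (orbit (2 * (j - l)) x)) *\<^sub>C orbit (2 * l) x"
  let ?v = "\<lambda>y. R 0 (orbit (Suc (2 * j)) y)"
  have R0: "bounded_clinear (R 0)" by (rule R_clinear) simp
  have v: "(?v has_vector_derivative R 0 (?D j)) (at x)"
    by (rule bounded_linear.has_vector_derivative[OF R_linear Suc]) simp
  have cont: "((\<lambda>y. R (2 * y) h) \<longlongrightarrow> R (2 * x) h) (at x)" for h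
  proof -
    have "continuous_on {0<..} (\<lambda>y. R (2 * y) h)"
      by (intro continuous_on_compose2[OF R_continuous] continuous_intros) auto
    then show ?thesis using x by (simp add: continuous_on_eq_continuous_at isCont_def)
  qed
  have "((\<lambda>y. R (2 * y) (?v y)) has_vector_derivative
      R (2 * x) (R 0 (?D j)) + - (2 * C (S (2 * x) (?v x))) *\<^sub>C S (2 * x) b) (at x)"
    using x
    by (intro has_vector_derivative_family_apply[where A = "{0<..}" and K = "M\<^sup>2", OF _ _ _ _ R_double_has_vector_derivative cont v])
      (auto intro: R_linear norm_R_le)
  moreover have "R (2 * x) (R 0 (?D j)) = (\<Sum>l\<le>j. - (2 * C (orbit (2 * (j - l)) x)) *\<^sub>C orbit (2 * Suc l) x)"
  proof -
    have R2: "bounded_clinear (R (2 * x))" using x by (intro R_clinear) simp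
    have "orbit (2 * Suc l) x = R (2 * x) (R 0 (orbit (2 * l) x))" for l
      using orbit_add_2[of x "2 * l"] x by simp
    then show ?thesis
      unfolding bounded_clinear_sum_scaleC[OF R0] bounded_clinear_sum_scaleC[OF R2] by (simp only:)
  qed
  moreover have "S (2 * x) (?v x) = orbit (2 * Suc j) x" by (simp add: orbit_def)
  moreover have "?D (Suc j) = (\<Sum>l\<le>j. - (2 * C (orbit (2 * (j - l)) x)) *\<^sub>C orbit (2 * Suc l) x)
      + - (2 * C (orbit (2 * Suc j) x)) *\<^sub>C S (2 * x) b"
    unfolding sum.atMost_Suc_shift by (simp add: orbit_def)
  ultimately have "((\<lambda>y. R (2 * y) (?v y)) has_vector_derivative ?D (Suc j)) (at x)" by simp
  moreover have "orbit (Suc (2 * Suc j)) y = R (2 * y) (?v y)" if "y \<in> {0<..}" for y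
    using that orbit_add_2[of y "Suc (2 * j)"] by simp
  ultimately show ?case
    using x by (intro has_vector_derivative_transform_within_open[of _ _ _ "{0<..}" "orbit (Suc (2 * Suc j))"]) auto
qed

end

section \<open>Power series with rapidly decreasing coefficients\<close>

text \<open>The power series of \<open>f (- X)\<close>.\<close>

definition fps_reflect :: "complex fps \<Rightarrow> complex fps"
  where "fps_reflect f = Abs_fps (\<lambda>n. (-1) ^ n * fps_nth f n)"

lemma fps_nth_reflect: "fps_nth (fps_reflect f) n = (-1) ^ n * fps_nth f n"
  by (simp add: fps_reflect_def)

lemma fps_reflect_mult: "fps_reflect (f * g) = fps_reflect f * fps_reflect g"
proof (rule fps_ext)
  fix n
  have "(-1) ^ n * (\<Sum>i=0..n. fps_nth f i * fps_nth g (n - i)) =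
      (\<Sum>i=0..n. ((-1) ^ i * fps_nth f i) * ((-1) ^ (n - i) * fps_nth g (n - i)))"
    unfolding sum_distrib_left
  proof (intro sum.cong refl)
    fix i assume "i \<in> {0..n}"
    then have "(-1 :: complex) ^ n = (-1) ^ i * (-1) ^ (n - i)" by (simp flip: power_add)
    then show "(-1) ^ n * (fps_nth f i * fps_nth g (n - i)) =
        ((-1) ^ i * fps_nth f i) * ((-1) ^ (n - i) * fps_nth g (n - i))"
      by (simp add: mult_ac)
  qed
  then show "fps_nth (fps_reflect (f * g)) n = fps_nth (fps_reflect f * fps_reflect g) n"
    by (simp add: fps_reflect_def fps_mult_nth)
qed

lemma fps_reflect_X: "fps_reflect fps_X = - fps_X"
  by (rule fps_ext) (simp add: fps_reflect_def fps_X_def)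

lemma fps_reflect_uminus: "fps_reflect (- f) = - fps_reflect f"
  by (rule fps_ext) (simp add: fps_reflect_def)

lemma fps_mult_even_nth:
  fixes f :: "complex fps"
  assumes f: "\<And>n. odd n \<Longrightarrow> fps_nth f n = 0"
  shows "fps_nth (f * f) n = (if even n then \<Sum>l\<le>n div 2. fps_nth f (2 * (n div 2 - l)) * fps_nth f (2 * l) else 0)"
proof (cases "even n")
  case True
  then obtain j where n: "n = 2 * j" by blast
  have "fps_nth (f * f) n = (\<Sum>i=0..n. fps_nth f i * fps_nth f (n - i))" by (rule fps_mult_nth)
  also have "\<dots> = (\<Sum>i\<in>(\<lambda>l. 2 * l) ` {..j}. fps_nth f i * fps_nth f (n - i))"
  proof (rule sum.mono_neutral_right)
    show "\<forall>i\<in>{0..n} - (\<lambda>l. 2 * l) ` {..j}. fps_nth f i * fps_nth f (n - i) = 0"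
    proof
      fix i assume i: "i \<in> {0..n} - (\<lambda>l. 2 * l) ` {..j}"
      then have "odd i" by (auto simp: n elim!: evenE)
      then show "fps_nth f i * fps_nth f (n - i) = 0" using f by simp
    qed
  qed (auto simp: n)
  also have "\<dots> = (\<Sum>l\<le>j. fps_nth f (2 * l) * fps_nth f (n - 2 * l))"
    by (subst sum.reindex) (auto simp: inj_on_def)
  also have "\<dots> = (\<Sum>l\<le>j. fps_nth f (2 * (j - l)) * fps_nth f (2 * l))"
  proof (intro sum.cong refl)
    fix l
    have "n - 2 * l = 2 * (j - l)" unfolding n by (simp add: diff_mult_distrib2)
    then show "fps_nth f (2 * l) * fps_nth f (n - 2 * l) = fps_nth f (2 * (j - l)) * fps_nth f (2 * l)"
      by (simp only: mult.commute)
  qed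
  finally show ?thesis using n by simp
next
  case False
  have "fps_nth f i * fps_nth f (n - i) = 0" if "i \<in> {0..n}" for i
  proof (cases "odd i")
    case False
    then have "odd (n - i)" using \<open>\<not> even n\<close> that by simp
    then show ?thesis using f by simp
  qed (use f in simp)
  then have "(\<Sum>i=0..n. fps_nth f i * fps_nth f (n - i)) = 0" by (intro sum.neutral) blast
  then show ?thesis using False by (simp add: fps_mult_nth)
qed

definition has_fps_param_deriv :: "(real \<Rightarrow> complex fps) \<Rightarrow> complex fps \<Rightarrow> real \<Rightarrow> bool"
  where "has_fps_param_deriv f f' x \<longleftrightarrow>
    (\<forall>n. ((\<lambda>t. fps_nth (f t) n) has_vector_derivative fps_nth f' n) (at x))"

lemma has_fps_param_deriv_mult:
  assumes "has_fps_param_deriv f f' x" "has_fps_param_deriv g g' x"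
  shows "has_fps_param_deriv (\<lambda>t. f t * g t) (f x * g' + f' * g x) x"
  unfolding has_fps_param_deriv_def
proof
  fix n
  have "((\<lambda>t. \<Sum>i=0..n. fps_nth (f t) i * fps_nth (g t) (n - i)) has_vector_derivative
      (\<Sum>i=0..n. fps_nth (f x) i * fps_nth g' (n - i) + fps_nth f' i * fps_nth (g x) (n - i))) (at x)"
    using assms unfolding has_fps_param_deriv_def
    by (intro has_vector_derivative_sum has_vector_derivative_mult) auto
  then show "((\<lambda>t. fps_nth (f t * g t) n) has_vector_derivative fps_nth (f x * g' + f' * g x) n) (at x)"
    by (simp add: fps_mult_nth sum.distrib)
qed

lemma has_fps_param_deriv_const: "has_fps_param_deriv (\<lambda>_. f) 0 x"
  by (simp add: has_fps_param_deriv_def)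

lemma has_fps_param_deriv_transform:
  assumes "has_fps_param_deriv f f' x" "0 < x" "\<And>t. 0 < t \<Longrightarrow> f t = g t"
  shows "has_fps_param_deriv g f' x"
  unfolding has_fps_param_deriv_def
proof
  fix n
  have "((\<lambda>t. fps_nth (f t) n) has_vector_derivative fps_nth f' n) (at x)"
    using assms(1) by (simp add: has_fps_param_deriv_def)
  then show "((\<lambda>t. fps_nth (g t) n) has_vector_derivative fps_nth f' n) (at x)"
    by (rule has_vector_derivative_transform_within_open[of _ _ _ "{0<..}"]) (use assms in auto)
qed

lemma has_fps_param_deriv_reflect:
  "has_fps_param_deriv f f' x \<Longrightarrow> has_fps_param_deriv (\<lambda>t. fps_reflect (f t)) (fps_reflect f') x"
  by (simp add: has_fps_param_deriv_def fps_reflect_def has_vector_derivative_mult_right)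

text \<open>Uniformly in the parameter, the power series have infinite radius of convergence.\<close>

definition rapidly_decreasing :: "(real \<Rightarrow> complex fps) \<Rightarrow> bool"
  where "rapidly_decreasing f \<longleftrightarrow>
    (\<forall>\<epsilon>>0. \<exists>K\<ge>0. \<forall>n. \<forall>x>0. norm (fps_nth (f x) n) \<le> K * \<epsilon> ^ n)"

lemma rapidly_decreasingE:
  assumes "rapidly_decreasing f" "0 < \<epsilon>"
  obtains K where "0 \<le> K" "\<And>n x. 0 < x \<Longrightarrow> norm (fps_nth (f x) n) \<le> K * \<epsilon> ^ n"
  using assms unfolding rapidly_decreasing_def by blast

lemma rapidly_decreasing_mult:
  assumes "rapidly_decreasing f" "rapidly_decreasing g"
  shows "rapidly_decreasing (\<lambda>x. f x * g x)"
  unfolding rapidly_decreasing_def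
proof (intro allI impI)
  fix \<epsilon> :: real assume "0 < \<epsilon>"
  obtain K\<^sub>1 where K\<^sub>1: "0 \<le> K\<^sub>1" "\<And>n x. 0 < x \<Longrightarrow> norm (fps_nth (f x) n) \<le> K\<^sub>1 * (\<epsilon> / 2) ^ n"
    using rapidly_decreasingE[OF assms(1), of "\<epsilon> / 2"] \<open>0 < \<epsilon>\<close> by (metis half_gt_zero)
  obtain K\<^sub>2 where K\<^sub>2: "0 \<le> K\<^sub>2" "\<And>n x. 0 < x \<Longrightarrow> norm (fps_nth (g x) n) \<le> K\<^sub>2 * (\<epsilon> / 2) ^ n"
    using rapidly_decreasingE[OF assms(2), of "\<epsilon> / 2"] \<open>0 < \<epsilon>\<close> by (metis half_gt_zero)
  show "\<exists>K\<ge>0. \<forall>n. \<forall>x>0. norm (fps_nth (f x * g x) n) \<le> K * \<epsilon> ^ n"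
  proof (intro exI[of _ "K\<^sub>1 * K\<^sub>2"] conjI allI impI)
    fix n and x :: real assume x: "0 < x"
    have "norm (fps_nth (f x * g x) n) \<le> (\<Sum>i=0..n. K\<^sub>1 * K\<^sub>2 * (\<epsilon> / 2) ^ n)"
      unfolding fps_mult_nth
    proof (rule sum_norm_le)
      fix i assume i: "i \<in> {0..n}"
      have "norm (fps_nth (f x) i * fps_nth (g x) (n - i)) \<le> (K\<^sub>1 * (\<epsilon> / 2) ^ i) * (K\<^sub>2 * (\<epsilon> / 2) ^ (n - i))"
        unfolding norm_mult using K\<^sub>1 K\<^sub>2 x \<open>0 < \<epsilon>\<close> by (intro mult_mono) auto
      also have "\<dots> = K\<^sub>1 * K\<^sub>2 * ((\<epsilon> / 2) ^ i * (\<epsilon> / 2) ^ (n - i))" by (simp only: mult_ac)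
      also have "(\<epsilon> / 2) ^ i * (\<epsilon> / 2) ^ (n - i) = (\<epsilon> / 2) ^ n" using i by (simp flip: power_add)
      finally show "norm (fps_nth (f x) i * fps_nth (g x) (n - i)) \<le> K\<^sub>1 * K\<^sub>2 * (\<epsilon> / 2) ^ n" .
    qed
    also have "\<dots> = K\<^sub>1 * K\<^sub>2 * (real (n + 1) * (\<epsilon> / 2) ^ n)" by simp
    also have "\<dots> \<le> K\<^sub>1 * K\<^sub>2 * (2 ^ n * (\<epsilon> / 2) ^ n)"
    proof (intro mult_left_mono mult_right_mono)
      have "n + 1 \<le> 2 ^ n" using Suc_leI[OF less_exp[of n]] by simp
      then show "real (n + 1) \<le> 2 ^ n" by (metis of_nat_le_iff of_nat_numeral of_nat_power)
    qed (use K\<^sub>1 K\<^sub>2 \<open>0 < \<epsilon>\<close> in auto)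
    also have "2 ^ n * (\<epsilon> / 2) ^ n = \<epsilon> ^ n" by (simp flip: power_mult_distrib)
    finally show "norm (fps_nth (f x * g x) n) \<le> K\<^sub>1 * K\<^sub>2 * \<epsilon> ^ n" .
  qed (use K\<^sub>1 K\<^sub>2 in auto)
qed

lemma rapidly_decreasing_reflect:
  "rapidly_decreasing f \<Longrightarrow> rapidly_decreasing (\<lambda>x. fps_reflect (f x))"
  by (simp add: rapidly_decreasing_def fps_reflect_def norm_mult norm_power)

lemma rapidly_decreasing_uminus: "rapidly_decreasing f \<Longrightarrow> rapidly_decreasing (\<lambda>x. - f x)"
  by (simp add: rapidly_decreasing_def)

lemma rapidly_decreasing_add:
  assumes "rapidly_decreasing f" "rapidly_decreasing g"
  shows "rapidly_decreasing (\<lambda>x. f x + g x)"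
  unfolding rapidly_decreasing_def
proof (intro allI impI)
  fix \<epsilon> :: real assume \<epsilon>: "0 < \<epsilon>"
  obtain K\<^sub>1 where K\<^sub>1: "0 \<le> K\<^sub>1" "\<And>n x. 0 < x \<Longrightarrow> norm (fps_nth (f x) n) \<le> K\<^sub>1 * \<epsilon> ^ n"
    using rapidly_decreasingE[OF assms(1) \<epsilon>] by blast
  obtain K\<^sub>2 where K\<^sub>2: "0 \<le> K\<^sub>2" "\<And>n x. 0 < x \<Longrightarrow> norm (fps_nth (g x) n) \<le> K\<^sub>2 * \<epsilon> ^ n"
    using rapidly_decreasingE[OF assms(2) \<epsilon>] by blast
  have "norm (fps_nth (f x + g x) n) \<le> (K\<^sub>1 + K\<^sub>2) * \<epsilon> ^ n" if "0 < x" for x n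
    using norm_triangle_mono[OF K\<^sub>1(2)[OF that] K\<^sub>2(2)[OF that]] by (simp add: distrib_right)
  then show "\<exists>K\<ge>0. \<forall>n. \<forall>x>0. norm (fps_nth (f x + g x) n) \<le> K * \<epsilon> ^ n"
    using K\<^sub>1(1) K\<^sub>2(1) by (intro exI[of _ "K\<^sub>1 + K\<^sub>2"]) auto
qed

lemma rapidly_decreasing_majorant:
  assumes "rapidly_decreasing f"
  obtains m where "summable m" "\<And>n x. 0 < x \<Longrightarrow> norm (fps_nth (f x) n * z ^ n) \<le> m n"
proof -
  define r where "r = 1 + norm z"
  have r: "0 < r" by (simp add: r_def add_pos_nonneg)
  obtain K where K: "0 \<le> K" "\<And>n x. 0 < x \<Longrightarrow> norm (fps_nth (f x) n) \<le> K * (1 / (2 * r)) ^ n"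
    using rapidly_decreasingE[OF assms, of "1 / (2 * r)"] r by auto
  show ?thesis
  proof (rule that)
    show "summable (\<lambda>n. K * (1 / 2) ^ n)" by (intro summable_mult) (simp add: summable_geometric)
    fix n and x :: real assume "0 < x"
    then have "norm (fps_nth (f x) n * z ^ n) \<le> (K * (1 / (2 * r)) ^ n) * r ^ n"
      unfolding norm_mult norm_power using K r by (intro mult_mono power_mono) (auto simp: r_def)
    also have "\<dots> = K * (1 / 2) ^ n"
      using r by (simp add: mult.assoc flip: power_mult_distrib)
    finally show "norm (fps_nth (f x) n * z ^ n) \<le> K * (1 / 2) ^ n" .
  qed
qed

lemma rapidly_decreasing_summable:
  assumes "rapidly_decreasing f" "0 < x" shows "summable (\<lambda>n. norm (fps_nth (f x) n * z ^ n))"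
proof -
  obtain m where m: "summable m" "\<And>n x. 0 < x \<Longrightarrow> norm (fps_nth (f x) n * z ^ n) \<le> m n"
    using rapidly_decreasing_majorant[OF assms(1), of z] by blast
  show ?thesis by (rule summable_comparison_test'[OF m(1), of 0]) (use m(2)[OF assms(2)] in simp)
qed

lemma rapidly_decreasing_conv_radius:
  fixes z :: complex
  assumes "rapidly_decreasing f" "0 < x" shows "norm z < fps_conv_radius (f x)"
proof -
  let ?z = "of_real (norm z + 1) :: complex"
  have "summable (\<lambda>n. fps_nth (f x) n * ?z ^ n)"
    by (rule summable_norm_cancel[OF rapidly_decreasing_summable[OF assms]])
  then have "ereal (norm ?z) \<le> conv_radius (fps_nth (f x))"
    by (rule conv_radius_geI)
  moreover have "norm ?z = norm z + 1" unfolding norm_of_real by simp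
  ultimately have "ereal (norm z + 1) \<le> fps_conv_radius (f x)" by (simp only: fps_conv_radius_def)
  moreover have "ereal (norm z) < ereal (norm z + 1)" by simp
  ultimately show ?thesis by (rule order.strict_trans2[rotated])
qed

lemma eval_fps_mult_rapid:
  assumes "rapidly_decreasing f" "rapidly_decreasing g" "0 < x"
  shows "eval_fps (f x * g x) z = eval_fps (f x) z * eval_fps (g x) z"
  using assms by (intro eval_fps_mult rapidly_decreasing_conv_radius)

lemma eval_fps_reflect: "eval_fps (fps_reflect f) z = eval_fps f (- z)"
  unfolding eval_fps_def fps_reflect_def fps_nth_Abs_fps
  by (intro suminf_cong) (metis mult.assoc mult.commute power_minus)

lemma eval_fps_continuous_on:
  assumes f: "rapidly_decreasing f" and cont: "\<And>n. continuous_on {0<..} (\<lambda>x. fps_nth (f x) n)"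
  shows "continuous_on {0<..} (\<lambda>x. eval_fps (f x) z)"
proof -
  obtain m where m: "summable m" "\<And>n x. 0 < x \<Longrightarrow> norm (fps_nth (f x) n * z ^ n) \<le> m n"
    using rapidly_decreasing_majorant[OF f, of z] by blast
  have "uniform_limit {0<..} (\<lambda>n x. \<Sum>i<n. fps_nth (f x) i * z ^ i) (\<lambda>x. \<Sum>i. fps_nth (f x) i * z ^ i) sequentially"
    using m by (intro Weierstrass_m_test) auto
  moreover have "continuous_on {0<..} (\<lambda>x. \<Sum>i<n. fps_nth (f x) i * z ^ i)" for n
    by (intro continuous_intros cont)
  ultimately show ?thesis
    unfolding eval_fps_def by (intro uniform_limit_theorem[where F = sequentially]) auto
qed

lemma eval_fps_has_vector_derivative:
  assumes f: "rapidly_decreasing f" "rapidly_decreasing f'"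
    and deriv: "\<And>x. 0 < x \<Longrightarrow> has_fps_param_deriv f (f' x) x" and x: "0 < x"
  shows "((\<lambda>x. eval_fps (f x) z) has_vector_derivative eval_fps (f' x) z) (at x)"
proof -
  obtain m where m: "summable m" "\<And>n x. 0 < x \<Longrightarrow> norm (fps_nth (f' x) n * z ^ n) \<le> m n"
    using rapidly_decreasing_majorant[OF f(2), of z] by blast
  have unif: "uniform_limit {0<..} (\<lambda>n x. \<Sum>i<n. fps_nth (f' x) i * z ^ i) (\<lambda>x. eval_fps (f' x) z) sequentially"
    unfolding eval_fps_def using m by (intro Weierstrass_m_test) auto
  have "\<exists>g. \<forall>y\<in>{0<..}. (\<lambda>n. fps_nth (f y) n * z ^ n) sums g y \<and>
      (g has_derivative (\<lambda>h. h *\<^sub>R eval_fps (f' y) z)) (at y within {0<..})"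
  proof (rule has_derivative_series)
    show "convex {0::real<..}" by simp
    show "((\<lambda>x. fps_nth (f x) n * z ^ n) has_derivative (\<lambda>h. h *\<^sub>R (fps_nth (f' y) n * z ^ n))) (at y within {0<..})"
      if "y \<in> {0<..}" for n y
      using deriv[of y] that unfolding has_fps_param_deriv_def has_vector_derivative_def[symmetric]
      by (intro has_vector_derivative_at_within[OF has_vector_derivative_mult_left]) auto
    show "eventually (\<lambda>n. \<forall>y\<in>{0<..}. \<forall>h. norm ((\<Sum>i<n. h *\<^sub>R (fps_nth (f' y) i * z ^ i)) - h *\<^sub>R eval_fps (f' y) z)
        \<le> e * norm h) sequentially" if "e > 0" for e
      using uniform_limitD[OF unif that]
    proof eventually_elim
      case (elim n)
      show ?case
      proof (intro ballI allI)
        fix y h :: real assume "y \<in> {0<..}"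
        then have "norm ((\<Sum>i<n. fps_nth (f' y) i * z ^ i) - eval_fps (f' y) z) \<le> e"
          using elim by (auto simp: dist_norm less_imp_le)
        then have "norm h * norm ((\<Sum>i<n. fps_nth (f' y) i * z ^ i) - eval_fps (f' y) z) \<le> norm h * e"
          by (rule mult_left_mono) simp
        then show "norm ((\<Sum>i<n. h *\<^sub>R (fps_nth (f' y) i * z ^ i)) - h *\<^sub>R eval_fps (f' y) z) \<le> e * norm h"
          unfolding scaleR_sum_right[symmetric] scaleR_diff_right[symmetric] norm_scaleR
          by (simp add: mult.commute)
      qed
    qed
    show "x \<in> {0<..}" using x by simp
    show "(\<lambda>n. fps_nth (f x) n * z ^ n) sums eval_fps (f x) z"
      unfolding eval_fps_def
      by (intro summable_sums summable_norm_cancel[OF rapidly_decreasing_summable[OF f(1) x]])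
  qed
  then obtain g where g: "\<And>y. 0 < y \<Longrightarrow> (\<lambda>n. fps_nth (f y) n * z ^ n) sums g y"
    "\<And>y. 0 < y \<Longrightarrow> (g has_vector_derivative eval_fps (f' y) z) (at y within {0<..})"
    unfolding has_vector_derivative_def by auto
  have deriv_g: "(g has_vector_derivative eval_fps (f' x) z) (at x)"
    using g(2)[OF x] x at_within_open[of x "{0<..}"] by simp
  have g_eq: "g y = eval_fps (f y) z" if "y \<in> {0<..}" for y
    using g(1)[of y] that by (simp add: eval_fps_def sums_unique)
  show ?thesis
    by (rule has_vector_derivative_transform_within_open[OF deriv_g _ _ g_eq, of "{0<..}"]) (use x in auto)
qed

section \<open>Toda's equation\<close>

context scalar_system_basis
begin

lemma resolvent_coeff_orbit: "0 \<le> x \<Longrightarrow> resolvent_coeff k x = (-1) ^ k * C (orbit k x)"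
  by (simp add: resolvent_coeff_def S_R_power)

text \<open>The odd part of the resolvent is differentiable, and its derivative is \<open>2 X\<close> times the
  square of the even part. This is the identity behind the relation between \<open>W\<close> and \<open>V\<close>, and
  behind Toda's equation.\<close>

lemma resolvent_odd_deriv:
  assumes x: "0 < x"
  shows "has_fps_param_deriv (\<lambda>t. resolvent_fps t - fps_reflect (resolvent_fps t))
    (fps_X * (resolvent_fps x + fps_reflect (resolvent_fps x)) ^ 2) x"
  unfolding has_fps_param_deriv_def
proof
  fix n
  define f where "f = resolvent_fps x + fps_reflect (resolvent_fps x)"
  have f_nth: "fps_nth f m = (if even m then 2 * C (orbit m x) else 0)" for m
    using x by (simp add: f_def fps_nth_reflect resolvent_fps_def resolvent_coeff_orbit)
  have odd0: "fps_nth f m = 0" if "odd m" for m using that f_nth by simp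
  have sq: "fps_nth (f ^ 2) m =
      (if even m then \<Sum>l\<le>m div 2. fps_nth f (2 * (m div 2 - l)) * fps_nth f (2 * l) else 0)" for m
    using fps_mult_even_nth[of f m, OF odd0] by (simp add: power2_eq_square)
  have "((\<lambda>t. fps_nth (resolvent_fps t - fps_reflect (resolvent_fps t)) n) has_vector_derivative
      fps_nth (fps_X * f ^ 2) n) (at x)"
  proof (cases "even n")
    case True
    then have "fps_nth (fps_X * f ^ 2) n = 0"
      by (cases n) (simp_all add: sq)
    moreover have "(\<lambda>t. fps_nth (resolvent_fps t - fps_reflect (resolvent_fps t)) n) = (\<lambda>_. 0)"
      using True by (simp add: fps_nth_reflect)
    ultimately show ?thesis by simp
  next
    case False
    then obtain j where n: "n = Suc (2 * j)" by (metis oddE Suc_eq_plus1)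
    have "fps_nth (fps_X * f ^ 2) n = (\<Sum>l\<le>j. fps_nth f (2 * (j - l)) * fps_nth f (2 * l))"
      by (simp add: n sq)
    also have "\<dots> = (\<Sum>l\<le>j. 4 * (C (orbit (2 * (j - l)) x) * C (orbit (2 * l) x)))"
      unfolding f_nth by simp
    finally have rhs: "fps_nth (fps_X * f ^ 2) n = (\<Sum>l\<le>j. 4 * (C (orbit (2 * (j - l)) x) * C (orbit (2 * l) x)))" .
    have "((\<lambda>t. C (orbit n t)) has_vector_derivative
        C (\<Sum>l\<le>j. - (2 * C (orbit (2 * (j - l)) x)) *\<^sub>C orbit (2 * l) x)) (at x)"
      unfolding n by (rule bounded_linear.has_vector_derivative[OF C_linear orbit_odd_has_vector_derivative[OF x]])
    then have "((\<lambda>t. - 2 * C (orbit n t)) has_vector_derivative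
        - 2 * C (\<Sum>l\<le>j. - (2 * C (orbit (2 * (j - l)) x)) *\<^sub>C orbit (2 * l) x)) (at x)"
      by (rule has_vector_derivative_mult_right)
    also have "- 2 * C (\<Sum>l\<le>j. - (2 * C (orbit (2 * (j - l)) x)) *\<^sub>C orbit (2 * l) x) = fps_nth (fps_X * f ^ 2) n"
      unfolding rhs bounded_clinear_sum_scaleC[OF C_clinear] sum_distrib_left
      by (intro sum.cong refl) (simp add: scaleC_complex_def)
    finally show ?thesis
    proof (rule has_vector_derivative_transform_within_open[of _ _ _ "{0<..}"])
      fix t :: real assume "t \<in> {0<..}"
      then show "- 2 * C (orbit n t) = fps_nth (resolvent_fps t - fps_reflect (resolvent_fps t)) n"
        using False by (simp add: fps_nth_reflect resolvent_fps_def resolvent_coeff_orbit)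
    qed (use x in auto)
  qed
  then show "((\<lambda>t. fps_nth (resolvent_fps t - fps_reflect (resolvent_fps t)) n) has_vector_derivative
      fps_nth (fps_X * (resolvent_fps x + fps_reflect (resolvent_fps x)) ^ 2) n) (at x)"
    unfolding f_def .
qed

lemma tau_fps_deriv: "0 < x \<Longrightarrow> has_fps_param_deriv tau_fps (- rate_fps x) x"
  using trace_ext_has_vector_derivative
  by (simp add: has_fps_param_deriv_def tau_fps_def rate_fps_def)

lemma tau_fps_rapid: "rapidly_decreasing tau_fps"
  unfolding rapidly_decreasing_def tau_fps_def fps_nth_Abs_fps
  using trace_ext_bound by (meson less_imp_le)

lemma rate_fps_rapid: "rapidly_decreasing rate_fps"
  unfolding rapidly_decreasing_def rate_fps_def fps_nth_Abs_fps
  using trace_ext_bound by (meson less_imp_le)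

text \<open>The first derivative of \<open>\<tau>(\<mu>) \<tau>(- \<mu>)\<close>, that is, of \<open>det (I - \<mu>\<^sup>2 R\<^sub>x\<^sup>2)\<close>.\<close>

definition tau_product_deriv :: "real \<Rightarrow> complex fps"
  where "tau_product_deriv x = tau_fps x * fps_reflect (- rate_fps x) + - rate_fps x * fps_reflect (tau_fps x)"

text \<open>Let \<open>a\<close>, \<open>p\<close> be the power series of \<open>\<tau>\<close> and of the resolvent, and \<open>a\<^sup>*\<close>, \<open>p\<^sup>*\<close> their
  reflections. From \<open>a' = - X a p\<close> and \<open>a\<^sup>*' = X a\<^sup>* p\<^sup>*\<close> follows \<open>(a a\<^sup>*)' = - X a a\<^sup>* (p -
  p\<^sup>*)\<close>, where only the odd part of \<open>p\<close> has to be differentiated again, with \<open>(p - p\<^sup>*)' = X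
  (p + p\<^sup>*)\<^sup>2\<close>. The result is \<open>X\<^sup>2 a a\<^sup>* ((p - p\<^sup>*)\<^sup>2 - (p + p\<^sup>*)\<^sup>2) = - 4 X\<^sup>2 a a\<^sup>* p p\<^sup>* = 4
  a' a\<^sup>*'\<close>.\<close>

lemma tau_product_second_deriv:
  assumes x: "0 < x"
  shows "has_fps_param_deriv tau_product_deriv (4 * ((- rate_fps x) * fps_reflect (- rate_fps x))) x"
proof -
  let ?d = "\<lambda>t. resolvent_fps t - fps_reflect (resolvent_fps t)"
  let ?s = "resolvent_fps x + fps_reflect (resolvent_fps x)"
  have eq: "tau_product_deriv t = - fps_X * ((tau_fps t * fps_reflect (tau_fps t)) * ?d t)" if "0 < t" for t
    using that unfolding tau_product_deriv_def
    by (simp add: rate_fps_eq fps_reflect_mult fps_reflect_uminus fps_reflect_X algebra_simps)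
  have prod: "has_fps_param_deriv (\<lambda>t. tau_fps t * fps_reflect (tau_fps t)) (tau_product_deriv x) x"
    unfolding tau_product_deriv_def
    by (intro has_fps_param_deriv_mult has_fps_param_deriv_reflect tau_fps_deriv x)
  have "has_fps_param_deriv (\<lambda>t. - fps_X * ((tau_fps t * fps_reflect (tau_fps t)) * ?d t))
      (- fps_X * ((tau_fps x * fps_reflect (tau_fps x)) * (fps_X * ?s ^ 2) + tau_product_deriv x * ?d x) + 0 * ((tau_fps x * fps_reflect (tau_fps x)) * ?d x)) x"
    by (intro has_fps_param_deriv_mult[OF has_fps_param_deriv_const] has_fps_param_deriv_mult[OF prod]
        resolvent_odd_deriv x)
  also have "- fps_X * ((tau_fps x * fps_reflect (tau_fps x)) * (fps_X * ?s ^ 2) + tau_product_deriv x * ?d x) + 0 * ((tau_fps x * fps_reflect (tau_fps x)) * ?d x)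
      = 4 * ((- rate_fps x) * fps_reflect (- rate_fps x))"
    using x by (simp add: eq rate_fps_eq fps_reflect_mult fps_reflect_uminus fps_reflect_X
        power2_eq_square algebra_simps)
  finally show ?thesis
    by (rule has_fps_param_deriv_transform) (use x eq in auto)
qed

definition tau :: "complex \<Rightarrow> real \<Rightarrow> complex" where "tau z x = eval_fps (tau_fps x) z"
definition tau' :: "complex \<Rightarrow> real \<Rightarrow> complex" where "tau' z x = - eval_fps (rate_fps x) z"

lemma tau'_eval: "0 < x \<Longrightarrow> eval_fps (- rate_fps x) z = tau' z x"
  unfolding tau'_def by (intro eval_fps_minus rapidly_decreasing_conv_radius[OF rate_fps_rapid])

lemma tau_has_vector_derivative: "0 < x \<Longrightarrow> (tau z has_vector_derivative tau' z x) (at x)"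
  using eval_fps_has_vector_derivative[OF tau_fps_rapid rapidly_decreasing_uminus[OF rate_fps_rapid] tau_fps_deriv, of x z]
  by (simp add: tau'_eval tau_def[abs_def])

lemma tau'_continuous: "continuous_on {0<..} (tau' z)"
  unfolding tau'_def[abs_def]
  using trace_ext_rate_continuous
  by (intro continuous_on_minus eval_fps_continuous_on[OF rate_fps_rapid]) (simp add: rate_fps_def)

lemma toda_integrated:
  assumes x: "0 < x"
  shows "((\<lambda>x. tau z x * tau' (- z) x + tau' z x * tau (- z) x) has_vector_derivative
    4 * (tau' z x * tau' (- z) x)) (at x)"
proof -
  note rapid = tau_fps_rapid rate_fps_rapid rapidly_decreasing_uminus[OF rate_fps_rapid]
  note rapid' = rapid rapid[THEN rapidly_decreasing_reflect]
  have four: "rapidly_decreasing (\<lambda>_. 4)"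
    unfolding rapidly_decreasing_def
  proof (intro allI impI exI[of _ 4] conjI)
    fix \<epsilon> :: real and n and x :: real assume "0 < \<epsilon>" "0 < x"
    then show "norm (fps_nth (4 :: complex fps) n) \<le> 4 * \<epsilon> ^ n" by (simp add: fps_numeral_nth)
  qed simp
  have rapid_deriv: "rapidly_decreasing (\<lambda>x. 4 * ((- rate_fps x) * fps_reflect (- rate_fps x)))"
    by (intro rapidly_decreasing_mult four rapid')
  have rapid_prod: "rapidly_decreasing tau_product_deriv"
    unfolding tau_product_deriv_def[abs_def] by (intro rapidly_decreasing_add rapidly_decreasing_mult rapid')
  have "eval_fps (4 * ((- rate_fps x) * fps_reflect (- rate_fps x))) z = 4 * (tau' z x * tau' (- z) x)"
    unfolding eval_fps_mult_rapid[OF four rapidly_decreasing_mult[OF rapid'(3) rapid'(6)] x]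
      eval_fps_mult_rapid[OF rapid'(3) rapid'(6) x] eval_fps_reflect tau'_eval[OF x] by simp
  then have "((\<lambda>x. eval_fps (tau_product_deriv x) z) has_vector_derivative 4 * (tau' z x * tau' (- z) x)) (at x)"
    using eval_fps_has_vector_derivative[OF rapid_prod rapid_deriv tau_product_second_deriv x, of z] by simp
  then show ?thesis
  proof (rule has_vector_derivative_transform_within_open[of _ _ _ "{0<..}"])
    fix x :: real assume "x \<in> {0<..}"
    then have x: "0 < x" by simp
    have "eval_fps (tau_product_deriv x) z = eval_fps (tau_fps x * fps_reflect (- rate_fps x)) z
        + eval_fps (- rate_fps x * fps_reflect (tau_fps x)) z"
      unfolding tau_product_deriv_def
      using x by (intro eval_fps_add rapidly_decreasing_conv_radius[OF rapidly_decreasing_mult] rapid')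
    then show "eval_fps (tau_product_deriv x) z = tau z x * tau' (- z) x + tau' z x * tau (- z) x"
      unfolding eval_fps_mult_rapid[OF rapid'(1) rapid'(6) x] eval_fps_mult_rapid[OF rapid'(3) rapid'(4) x]
        eval_fps_reflect tau'_eval[OF x] tau_def .
  qed (use x in auto)
qed

end

text \<open>Toda's equation says that \<open>(f g)'' = 4 f' g'\<close>. In this form it only needs \<open>H = (f g)'\<close> to be
  differentiable. Where \<open>f'\<close> and \<open>g'\<close> are differentiable the product rule gives the pointwise
  equation; the distributional equation is \<open>\<integral> (H \<psi>)' = 0\<close>.\<close>

lemma toda_of_integrated:
  fixes f g f' g' :: "real \<Rightarrow> complex"
  assumes f: "\<And>x. 0 < x \<Longrightarrow> (f has_vector_derivative f' x) (at x)" and f': "continuous_on {0<..} f'"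
    and g: "\<And>x. 0 < x \<Longrightarrow> (g has_vector_derivative g' x) (at x)" and g': "continuous_on {0<..} g'"
    and H: "\<And>x. 0 < x \<Longrightarrow> ((\<lambda>x. f x * g' x + f' x * g x) has_vector_derivative 4 * (f' x * g' x)) (at x)"
  shows "toda_pointwise g f" "toda_distributional g f" "C1_halfline f"
proof -
  have ddx_f: "ddx f x = f' x" and ddx_g: "ddx g x = g' x" if "0 < x" for x
    using f[OF that] g[OF that] by (auto intro: vector_derivative_at)
  show "C1_halfline f"
    unfolding C1_halfline_def
    using f continuous_on_eq[OF f', of "ddx f"] ddx_f by (auto intro: differentiableI_vector)
  show "toda_pointwise g f"
    unfolding toda_pointwise_def
  proof (intro allI impI)
    fix x :: real assume x: "0 < x" and dg: "ddx g differentiable (at x)" and df: "ddx f differentiable (at x)"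
    have f'': "(f' has_vector_derivative ddx (ddx f) x) (at x)"
      using df[unfolded vector_derivative_works]
      by (rule has_vector_derivative_transform_within_open[of _ _ _ "{0<..}"]) (use x ddx_f in auto)
    have g'': "(g' has_vector_derivative ddx (ddx g) x) (at x)"
      using dg[unfolded vector_derivative_works]
      by (rule has_vector_derivative_transform_within_open[of _ _ _ "{0<..}"]) (use x ddx_g in auto)
    have "((\<lambda>x. f x * g' x + f' x * g x) has_vector_derivative
        (f x * ddx (ddx g) x + f' x * g' x) + (f' x * g' x + ddx (ddx f) x * g x)) (at x)"
      by (intro has_vector_derivative_add has_vector_derivative_mult f g f'' g'' x)
    from vector_derivative_unique_at[OF this H[OF x]]
    have "(f x * ddx (ddx g) x + f' x * g' x) + (f' x * g' x + ddx (ddx f) x * g x) = 4 * (f' x * g' x)" .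
    then show "ddx (ddx g) x * f x - 2 * ddx g x * ddx f x + g x * ddx (ddx f) x = 0"
      using ddx_f[OF x] ddx_g[OF x] by (simp add: algebra_simps)
  qed
  show "toda_distributional g f"
    unfolding toda_distributional_def
  proof (intro allI impI)
    fix \<psi> assume \<psi>: "test_function \<psi>"
    then obtain K where K: "compact K" "K \<subseteq> {0<..}" "\<And>x. x \<notin> K \<Longrightarrow> \<psi> x = 0"
      unfolding test_function_def by blast
    have \<psi>': "(\<psi> has_vector_derivative ddx \<psi> x) (at x)" for x
      using \<psi> unfolding test_function_def by (simp add: vector_derivative_works)
    have cont_\<psi>': "continuous_on A (ddx \<psi>)" for A
      using \<psi> unfolding test_function_def by (auto intro: continuous_on_subset)
    have cont_\<psi>: "continuous_on A \<psi>" for A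
      by (intro continuous_at_imp_continuous_on ballI has_vector_derivative_continuous[OF \<psi>'])
    obtain a b where ab: "0 < a" "a < b" "K \<subseteq> {a<..<b}"
    proof (cases "K = {}")
      case True
      then show ?thesis by (intro that[of 1 2]) auto
    next
      case False
      obtain m where m: "m \<in> K" "\<And>x. x \<in> K \<Longrightarrow> m \<le> x" using compact_attains_inf[OF K(1) False] by blast
      obtain M where M: "M \<in> K" "\<And>x. x \<in> K \<Longrightarrow> x \<le> M" using compact_attains_sup[OF K(1) False] by blast
      have "0 < m" using m K by auto
      have "m / 2 < x \<and> x < M + 1" if "x \<in> K" for x
        using m(2)[OF that] M(2)[OF that] \<open>0 < m\<close> by linarith
      then show ?thesis using \<open>0 < m\<close> M(2)[OF m(1)] by (intro that[of "m/2" "M+1"]) auto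
    qed
    have \<psi>0: "\<psi> x = 0" "ddx \<psi> x = 0" if "x \<notin> {a<..<b}" for x
    proof -
      have nK: "x \<notin> K" using that ab by auto
      then show "\<psi> x = 0" by (rule K(3))
      have "((\<lambda>_. 0 :: complex) has_vector_derivative 0) (at x)" by simp
      then have "(\<psi> has_vector_derivative 0) (at x)"
        by (rule has_vector_derivative_transform_within_open[of _ _ _ "- K"])
          (use nK K compact_imp_closed in \<open>auto simp: open_Compl\<close>)
      then show "ddx \<psi> x = 0" by (rule vector_derivative_at)
    qed
    have sub: "{a..b} \<subseteq> {0<..}" using ab by auto
    note conts = continuous_on_subset[OF f' sub] continuous_on_subset[OF g' sub] cont_\<psi> cont_\<psi>'
    have cont_f: "continuous_on {a..b} f" and cont_g: "continuous_on {a..b} g"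
      using sub by (auto intro!: continuous_at_imp_continuous_on has_vector_derivative_continuous[OF f]
          has_vector_derivative_continuous[OF g])
    have half: "(LINT x:{0<..}|lborel. h x) = integral {a..b} k" "k integrable_on {a..b}"
      if k: "continuous_on {a..b} k" and hk: "\<And>x. 0 < x \<Longrightarrow> h x = k x"
        and k0: "\<And>x. x \<notin> {a<..<b} \<Longrightarrow> k x = 0" for h k :: "real \<Rightarrow> complex"
    proof -
      have "(LINT x:{0<..}|lborel. h x) = (LINT x:{a..b}|lborel. k x)"
        unfolding set_lebesgue_integral_def
      proof (intro Bochner_Integration.integral_cong refl)
        fix x
        show "indicator {0<..} x *\<^sub>R h x = indicator {a..b} x *\<^sub>R k x"
          using hk[of x] k0[of x] ab by (auto simp: indicator_def)
      qed
      also have "\<dots> = integral {a..b} k"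
        by (rule set_borel_integral_eq_integral(2)[OF borel_integrable_atLeastAtMost'[OF k]])
      finally show "(LINT x:{0<..}|lborel. h x) = integral {a..b} k" .
      show "k integrable_on {a..b}" by (rule integrable_continuous_real[OF k])
    qed
    let ?k\<^sub>1 = "\<lambda>x. g' x * (f x * ddx \<psi> x + f' x * \<psi> x)"
    let ?k\<^sub>2 = "\<lambda>x. g' x * f' x * \<psi> x"
    let ?k\<^sub>3 = "\<lambda>x. f' x * (g x * ddx \<psi> x + g' x * \<psi> x)"
    have ddx_f\<psi>: "ddx (\<lambda>t. f t * \<psi> t) x = f x * ddx \<psi> x + f' x * \<psi> x"
      and ddx_g\<psi>: "ddx (\<lambda>t. g t * \<psi> t) x = g x * ddx \<psi> x + g' x * \<psi> x" if "0 < x" for x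
      by (intro vector_derivative_at has_vector_derivative_mult f g \<psi>' that)+
    have I\<^sub>1: "(LINT x:{0<..}|lborel. ddx g x * ddx (\<lambda>t. f t * \<psi> t) x) = integral {a..b} ?k\<^sub>1" "?k\<^sub>1 integrable_on {a..b}"
      by (rule half[of ?k\<^sub>1]; use ddx_g ddx_f\<psi> \<psi>0 in \<open>auto intro!: continuous_intros conts cont_f\<close>)+
    have I\<^sub>2: "(LINT x:{0<..}|lborel. ddx g x * ddx f x * \<psi> x) = integral {a..b} ?k\<^sub>2" "?k\<^sub>2 integrable_on {a..b}"
      by (rule half[of ?k\<^sub>2]; use ddx_g ddx_f \<psi>0 in \<open>auto intro!: continuous_intros conts\<close>)+
    have I\<^sub>3: "(LINT x:{0<..}|lborel. ddx f x * ddx (\<lambda>t. g t * \<psi> t) x) = integral {a..b} ?k\<^sub>3" "?k\<^sub>3 integrable_on {a..b}"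
      by (rule half[of ?k\<^sub>3]; use ddx_f ddx_g\<psi> \<psi>0 in \<open>auto intro!: continuous_intros conts cont_g\<close>)+
    let ?H = "\<lambda>x. f x * g' x + f' x * g x"
    have "((\<lambda>x. ?H x * ddx \<psi> x + 4 * (f' x * g' x) * \<psi> x) has_integral ?H b * \<psi> b - ?H a * \<psi> a) {a..b}"
      using sub ab
      by (intro fundamental_theorem_of_calculus has_vector_derivative_at_within[OF has_vector_derivative_mult] H \<psi>') auto
    then have "((\<lambda>x. ?H x * ddx \<psi> x + 4 * (f' x * g' x) * \<psi> x) has_integral 0) {a..b}"
      using \<psi>0(1)[of a] \<psi>0(1)[of b] by simp
    moreover have "(\<lambda>x. ?H x * ddx \<psi> x + 4 * (f' x * g' x) * \<psi> x) = (\<lambda>x. ?k\<^sub>1 x + 2 * ?k\<^sub>2 x + ?k\<^sub>3 x)"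
      by (auto simp: algebra_simps)
    ultimately have "((\<lambda>x. ?k\<^sub>1 x + 2 * ?k\<^sub>2 x + ?k\<^sub>3 x) has_integral 0) {a..b}" by (simp only:)
    moreover have "((\<lambda>x. ?k\<^sub>1 x + 2 * ?k\<^sub>2 x + ?k\<^sub>3 x) has_integral
        integral {a..b} ?k\<^sub>1 + 2 * integral {a..b} ?k\<^sub>2 + integral {a..b} ?k\<^sub>3) {a..b}"
      by (intro has_integral_add has_integral_mult_right integrable_integral I\<^sub>1 I\<^sub>2 I\<^sub>3)
    ultimately have "0 = integral {a..b} ?k\<^sub>1 + 2 * integral {a..b} ?k\<^sub>2 + integral {a..b} ?k\<^sub>3"
      by (rule has_integral_unique)
    then show "- (LINT x:{0<..}|lborel. ddx g x * ddx (\<lambda>t. f t * \<psi> t) x)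
        - 2 * (LINT x:{0<..}|lborel. ddx g x * ddx f x * \<psi> x)
        - (LINT x:{0<..}|lborel. ddx f x * ddx (\<lambda>t. g t * \<psi> t) x) = 0"
      unfolding I\<^sub>1 I\<^sub>2 I\<^sub>3
      by (simp only: minus_add_distrib[symmetric] diff_conv_add_uminus) (simp only: neg_equal_0_iff_equal)
  qed
qed

section \<open>The Gelfand--Levitan equation\<close>

context scalar_system
begin

lemma norm_R_power_le: "0 \<le> x \<Longrightarrow> norm ((R x ^^ k) h) \<le> (M\<^sup>2) ^ k * norm h"
proof (induction k)
  case (Suc k)
  have "norm ((R x ^^ Suc k) h) \<le> M\<^sup>2 * norm ((R x ^^ k) h)" using Suc norm_R_le by simp
  also have "\<dots> \<le> M\<^sup>2 * ((M\<^sup>2) ^ k * norm h)" using Suc by (intro mult_left_mono) auto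
  finally show ?case by (simp add: mult_ac)
qed simp

text \<open>The functional \<open>C S\<^sub>x (I + \<mu> R\<^sub>x)\<^sup>-\<^sup>1\<close>, as a Neumann series.\<close>

definition resolvent :: "complex \<Rightarrow> real \<Rightarrow> 'a \<Rightarrow> complex"
  where "resolvent \<mu> x h = (\<Sum>k. (- \<mu>) ^ k * C (S x ((R x ^^ k) h)))"

lemma resolvent_term_le:
  assumes "0 \<le> x"
  shows "norm ((- \<mu>) ^ k * C (S x ((R x ^^ k) h))) \<le> (norm \<mu> * M\<^sup>2) ^ k * (L * norm h)"
proof -
  have "norm (C (S x ((R x ^^ k) h))) \<le> L * ((M\<^sup>2) ^ k * norm h)"
    using L_pos by (intro order_trans[OF C_bound[OF assms]] mult_left_mono norm_R_power_le assms) simp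
  then have "norm \<mu> ^ k * norm (C (S x ((R x ^^ k) h))) \<le> norm \<mu> ^ k * (L * ((M\<^sup>2) ^ k * norm h))"
    by (rule mult_left_mono) simp
  then show ?thesis by (simp add: norm_mult norm_power power_mult_distrib mult_ac)
qed

lemma resolvent_summable:
  assumes "0 \<le> x" and q: "norm \<mu> * M\<^sup>2 < 1"
  shows "summable (\<lambda>k. (- \<mu>) ^ k * C (S x ((R x ^^ k) h)))"
proof (rule summable_comparison_test')
  show "summable (\<lambda>k. (norm \<mu> * M\<^sup>2) ^ k * (L * norm h))"
    using q by (intro summable_mult2 summable_geometric) simp
qed (rule resolvent_term_le[OF assms(1)])

lemma CSR_linear: "0 \<le> x \<Longrightarrow> bounded_clinear (\<lambda>h. C (S x ((R x ^^ k) h)))"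
  by (intro bounded_clinear_compose[OF CS_clinear] bounded_clinear_funpow R_clinear)

lemma resolvent_linear:
  assumes x: "0 \<le> x" and q: "norm \<mu> * M\<^sup>2 < 1"
  shows "bounded_linear (resolvent \<mu> x)"
proof (rule bounded_linear_intro)
  note summ = resolvent_summable[OF assms]
  note lin = bounded_linear.linear[OF bounded_clinear_imp_linear[OF CSR_linear[OF x]]]
  show "resolvent \<mu> x (g + h) = resolvent \<mu> x g + resolvent \<mu> x h" for g h
    unfolding resolvent_def suminf_add[OF summ summ] by (simp add: linear_add[OF lin] distrib_left)
  show "resolvent \<mu> x (r *\<^sub>R h) = r *\<^sub>R resolvent \<mu> x h" for r h
    unfolding resolvent_def suminf_scaleR_right[OF summ] by (simp add: linear_scale[OF lin])
  show "norm (resolvent \<mu> x h) \<le> norm h * ((\<Sum>k. (norm \<mu> * M\<^sup>2) ^ k) * L)" for h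
  proof -
    have geo: "summable (\<lambda>k. (norm \<mu> * M\<^sup>2) ^ k)" using q by (intro summable_geometric) simp
    have "norm (resolvent \<mu> x h) \<le> (\<Sum>k. (norm \<mu> * M\<^sup>2) ^ k * (L * norm h))"
      unfolding resolvent_def
      by (intro norm_suminf_le resolvent_term_le x summable_mult2 geo)
    also have "\<dots> = norm h * ((\<Sum>k. (norm \<mu> * M\<^sup>2) ^ k) * L)"
      using suminf_mult2[OF geo, of "L * norm h"] by (simp add: mult_ac)
    finally show ?thesis .
  qed
qed

lemma resolvent_scaleC:
  assumes x: "0 \<le> x" and q: "norm \<mu> * M\<^sup>2 < 1"
  shows "resolvent \<mu> x (a *\<^sub>C h) = a * resolvent \<mu> x h"
  unfolding resolvent_def
  by (subst suminf_mult[OF resolvent_summable[OF assms], symmetric])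
    (simp add: bounded_clinear_scaleC[OF CSR_linear[OF x]] scaleC_complex_def mult_ac)

lemma resolvent_identity:
  assumes x: "0 \<le> x" and q: "norm \<mu> * M\<^sup>2 < 1"
  shows "resolvent \<mu> x h + \<mu> * resolvent \<mu> x (R x h) = C (S x h)"
proof -
  have "resolvent \<mu> x h = C (S x h) + (\<Sum>k. (- \<mu>) ^ Suc k * C (S x ((R x ^^ Suc k) h)))"
    unfolding resolvent_def using suminf_split_head[OF resolvent_summable[OF assms, of h]] by simp
  also have "(\<Sum>k. (- \<mu>) ^ Suc k * C (S x ((R x ^^ Suc k) h))) = - \<mu> * resolvent \<mu> x (R x h)"
    unfolding resolvent_def suminf_mult[OF resolvent_summable[OF assms], symmetric]
    by (simp add: funpow_swap1 mult_ac)
  finally show ?thesis by simp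
qed

text \<open>The solution \<open>W + V\<close> of the scalar Gelfand--Levitan equation with kernel \<open>\<phi>(x + y) = C
  S\<^bsub>x+y\<^esub> b\<close>.\<close>

definition GL :: "complex \<Rightarrow> real \<Rightarrow> real \<Rightarrow> complex"
  where "GL \<mu> x y = - resolvent \<mu> x (S y b)"

text \<open>Since \<open>C S\<^bsub>z+y\<^esub> b = (C S\<^sub>z) (S\<^sub>y b)\<close>, the integral is minus the resolvent applied to
  \<open>R\<^sub>x S\<^sub>y b\<close>, and the equation reduces to \<open>(I + \<mu> R\<^sub>x)\<^sup>-\<^sup>1 (I + \<mu> R\<^sub>x) = I\<close>.\<close>

lemma GL_equation:
  assumes x: "0 \<le> x" and y: "0 \<le> y" and q: "norm \<mu> * M\<^sup>2 < 1"
  shows "set_integrable lborel {x<..} (\<lambda>z. GL \<mu> x z * C (S (z + y) b))"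
    and "GL \<mu> x y + C (S (x + y) b) + \<mu> * (LINT z:{x<..}|lborel. GL \<mu> x z * C (S (z + y) b)) = 0"
proof -
  let ?h = "S y b"
  note lin = resolvent_linear[OF x q]
  have eq: "indicator {x<..} z *\<^sub>R (GL \<mu> x z * C (S (z + y) b)) =
      - resolvent \<mu> x (indicator {x<..} z *\<^sub>R (C (S z ?h) *\<^sub>C S z b))" for z
  proof (cases "x < z")
    case True
    then show ?thesis using x y S_add[of z y b]
      by (simp add: GL_def resolvent_scaleC[OF x q] mult.commute)
  next
    case False
    then show ?thesis by (simp add: linear_0[OF bounded_linear.linear[OF lin]])
  qed
  have int: "integrable lborel (\<lambda>z. indicator {x<..} z *\<^sub>R (C (S z ?h) *\<^sub>C S z b))"
    using Cb_set_integrable[OF x] by (simp add: set_integrable_def)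
  show "set_integrable lborel {x<..} (\<lambda>z. GL \<mu> x z * C (S (z + y) b))"
    unfolding set_integrable_def eq by (intro Bochner_Integration.integrable_minus integrable_bounded_linear[OF lin int])
  have int_eq: "(LINT z:{x<..}|lborel. GL \<mu> x z * C (S (z + y) b)) = - resolvent \<mu> x (R x ?h)"
    unfolding set_lebesgue_integral_def eq R_def
    using integral_bounded_linear[OF lin int] by simp
  have C_eq: "C (S (x + y) b) = resolvent \<mu> x ?h + \<mu> * resolvent \<mu> x (R x ?h)"
    using S_add[OF x y, of b] resolvent_identity[OF x q, of ?h] by simp
  show "GL \<mu> x y + C (S (x + y) b) + \<mu> * (LINT z:{x<..}|lborel. GL \<mu> x z * C (S (z + y) b)) = 0"
    unfolding int_eq C_eq unfolding GL_def by simp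
qed

lemma GL_continuous:
  assumes "0 \<le> x" "norm \<mu> * M\<^sup>2 < 1" shows "continuous_on {x..} (GL \<mu> x)"
  unfolding GL_def[abs_def]
  by (intro continuous_on_minus bounded_linear.continuous_on[OF resolvent_linear[OF assms]]
      continuous_on_subset[OF S_continuous]) (use assms in auto)

end

lemma mat22_nth [simp]:
  "mat22 a b c d $ 1 $ 1 = a" "mat22 a b c d $ 1 $ 2 = b" "mat22 a b c d $ 2 $ 1 = c" "mat22 a b c d $ 2 $ 2 = d"
  by (simp_all add: mat22_def)

lemma mat22_eqI:
  fixes A B :: "complex^2^2"
  assumes "A $ 1 $ 1 = B $ 1 $ 1" "A $ 1 $ 2 = B $ 1 $ 2" "A $ 2 $ 1 = B $ 2 $ 1" "A $ 2 $ 2 = B $ 2 $ 2"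
  shows "A = B"
  using assms by (simp add: vec_eq_iff forall_2)

lemma bounded_linear_mat22: "bounded_linear (\<lambda>a. mat22 a 0 0 a)" "bounded_linear (\<lambda>a. mat22 0 a a 0)"
proof -
  have "linear (\<lambda>a. mat22 a 0 0 a)" "linear (\<lambda>a. mat22 0 a a 0)"
    by (auto intro!: linearI mat22_eqI)
  then show "bounded_linear (\<lambda>a. mat22 a 0 0 a)" "bounded_linear (\<lambda>a. mat22 0 a a 0)"
    by (simp_all add: linear_conv_bounded_linear)
qed

lemma mat22_set_integral:
  assumes f: "set_integrable lborel A f" and g: "set_integrable lborel A g"
  shows "set_integrable lborel A (\<lambda>z. mat22 (f z) (g z) (g z) (f z))"
    and "(LINT z:A|lborel. mat22 (f z) (g z) (g z) (f z)) =
      mat22 (LINT z:A|lborel. f z) (LINT z:A|lborel. g z) (LINT z:A|lborel. g z) (LINT z:A|lborel. f z)"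
proof -
  have eq: "indicator A z *\<^sub>R mat22 (f z) (g z) (g z) (f z) =
      mat22 (indicator A z *\<^sub>R f z) 0 0 (indicator A z *\<^sub>R f z) +
      mat22 0 (indicator A z *\<^sub>R g z) (indicator A z *\<^sub>R g z) 0" for z
    by (rule mat22_eqI) auto
  note int = integrable_bounded_linear[OF bounded_linear_mat22(1) f[unfolded set_integrable_def]]
    integrable_bounded_linear[OF bounded_linear_mat22(2) g[unfolded set_integrable_def]]
  show "set_integrable lborel A (\<lambda>z. mat22 (f z) (g z) (g z) (f z))"
    unfolding set_integrable_def eq by (rule Bochner_Integration.integrable_add[OF int])
  show "(LINT z:A|lborel. mat22 (f z) (g z) (g z) (f z)) =
      mat22 (LINT z:A|lborel. f z) (LINT z:A|lborel. g z) (LINT z:A|lborel. g z) (LINT z:A|lborel. f z)"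
    unfolding set_lebesgue_integral_def eq Bochner_Integration.integral_add[OF int]
      integral_bounded_linear[OF bounded_linear_mat22(1) f[unfolded set_integrable_def]]
      integral_bounded_linear[OF bounded_linear_mat22(2) g[unfolded set_integrable_def]]
    by (rule mat22_eqI) auto
qed

text \<open>The matrix equation splits into scalar equations for \<open>W + V\<close> and \<open>W - V\<close>, which are those
  for \<open>\<mu>\<close> and, up to sign, for \<open>- \<mu>\<close>.\<close>

lemma (in scalar_system) gelfand_levitan_GL:
  assumes q: "norm \<mu> * M\<^sup>2 < 1"
  shows "gelfand_levitan_solution (\<lambda>x. C (S x b)) \<mu>
    (\<lambda>x y. (GL \<mu> x y - GL (- \<mu>) x y) / 2) (\<lambda>x y. (GL \<mu> x y + GL (- \<mu>) x y) / 2)"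
proof -
  define W where "W x y = (GL \<mu> x y - GL (- \<mu>) x y) / 2" for x y
  define V where "V x y = (GL \<mu> x y + GL (- \<mu>) x y) / 2" for x y
  define \<phi> where "\<phi> x = C (S x b)" for x
  have q': "norm (- \<mu>) * M\<^sup>2 < 1" using q by simp
  have prod: "mat22 (W x z) (V x z) (V x z) (W x z) ** mat22 0 p p 0 =
      mat22 (V x z * p) (W x z * p) (W x z * p) (V x z * p)" for x z p
    by (rule mat22_eqI) (auto simp: matrix_matrix_mult_def sum_2)
  have eqs: "set_integrable lborel {x<..} (\<lambda>z. W x z * \<phi> (z + y))" "set_integrable lborel {x<..} (\<lambda>z. V x z * \<phi> (z + y))"
      "W x y + \<mu> * (LINT z:{x<..}|lborel. V x z * \<phi> (z + y)) = 0"
      "V x y + \<phi> (x + y) + \<mu> * (LINT z:{x<..}|lborel. W x z * \<phi> (z + y)) = 0"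
    if "0 < x" "x < y" for x y
  proof -
    have xy: "0 \<le> x" "0 \<le> y" using that by auto
    let ?f = "\<lambda>z. GL \<mu> x z * \<phi> (z + y)" and ?g = "\<lambda>z. GL (- \<mu>) x z * \<phi> (z + y)"
    have f: "set_integrable lborel {x<..} ?f" and g: "set_integrable lborel {x<..} ?g"
      unfolding \<phi>_def by (intro GL_equation(1) xy q q')+
    have f_eq: "GL \<mu> x y + \<phi> (x + y) + \<mu> * (LINT z:{x<..}|lborel. ?f z) = 0"
      unfolding \<phi>_def by (rule GL_equation(2)[OF xy q])
    have g_eq: "GL (- \<mu>) x y + \<phi> (x + y) - \<mu> * (LINT z:{x<..}|lborel. ?g z) = 0"
      using GL_equation(2)[OF xy q'] unfolding \<phi>_def by simp
    have W: "(\<lambda>z. W x z * \<phi> (z + y)) = (\<lambda>z. (?f z - ?g z) / 2)" and V: "(\<lambda>z. V x z * \<phi> (z + y)) = (\<lambda>z. (?f z + ?g z) / 2)"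
      by (auto simp: W_def V_def field_simps)
    show "set_integrable lborel {x<..} (\<lambda>z. W x z * \<phi> (z + y))" "set_integrable lborel {x<..} (\<lambda>z. V x z * \<phi> (z + y))"
      unfolding W V using f g by auto
    have WI: "(LINT z:{x<..}|lborel. W x z * \<phi> (z + y)) = ((LINT z:{x<..}|lborel. ?f z) - (LINT z:{x<..}|lborel. ?g z)) / 2"
      and VI: "(LINT z:{x<..}|lborel. V x z * \<phi> (z + y)) = ((LINT z:{x<..}|lborel. ?f z) + (LINT z:{x<..}|lborel. ?g z)) / 2"
      unfolding W V using f g by (simp_all add: set_integral_diff set_integral_add)
    show "W x y + \<mu> * (LINT z:{x<..}|lborel. V x z * \<phi> (z + y)) = 0"
    proof -
      have "W x y + \<mu> * ((I + J) / 2) = ((GL \<mu> x y + \<phi> (x + y) + \<mu> * I) - (GL (- \<mu>) x y + \<phi> (x + y) - \<mu> * J)) / 2"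
        for I J by (simp add: W_def field_simps)
      then show ?thesis unfolding VI by (simp only: f_eq g_eq) simp
    qed
    show "V x y + \<phi> (x + y) + \<mu> * (LINT z:{x<..}|lborel. W x z * \<phi> (z + y)) = 0"
    proof -
      have "V x y + \<phi> (x + y) + \<mu> * ((I - J) / 2) = ((GL \<mu> x y + \<phi> (x + y) + \<mu> * I) + (GL (- \<mu>) x y + \<phi> (x + y) - \<mu> * J)) / 2"
        for I J by (simp add: V_def field_simps)
      then show ?thesis unfolding WI by (simp only: f_eq g_eq) simp
    qed
  qed
  have "gelfand_levitan_solution \<phi> \<mu> W V"
    unfolding gelfand_levitan_solution_def Let_def prod
  proof (intro conjI allI impI)
    fix x y :: real assume xy: "0 < x \<and> x < y"
    then have xy: "0 < x" "x < y" by auto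
    note e = eqs[OF xy]
    show "set_integrable lborel {x<..} (\<lambda>z. mat22 (V x z * \<phi> (z + y)) (W x z * \<phi> (z + y)) (W x z * \<phi> (z + y)) (V x z * \<phi> (z + y)))"
      by (rule mat22_set_integral(1)[OF e(2,1)])
    show "mat22 (W x y) (V x y) (V x y) (W x y) + mat22 0 (\<phi> (x + y)) (\<phi> (x + y)) 0 +
        mat \<mu> ** (LINT z:{x<..}|lborel. mat22 (V x z * \<phi> (z + y)) (W x z * \<phi> (z + y)) (W x z * \<phi> (z + y)) (V x z * \<phi> (z + y))) = 0"
      unfolding mat22_set_integral(2)[OF e(2,1)]
      by (rule mat22_eqI) (use e(3,4) in \<open>auto simp: matrix_matrix_mult_def sum_2 mat_def\<close>)
  next
    fix x :: real assume "0 < x"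
    then have GL: "continuous_on {x..} (GL \<mu> x)" "continuous_on {x..} (GL (- \<mu>) x)"
      using q by (auto intro!: GL_continuous)
    show "continuous_on {x..} (W x)" "continuous_on {x..} (V x)"
      unfolding W_def[abs_def] V_def[abs_def] by (intro continuous_intros GL; simp)+
  qed
  then show ?thesis unfolding W_def[abs_def] V_def[abs_def] \<phi>_def[abs_def] .
qed

section \<open>Diagonal values\<close>

context scalar_system_basis
begin

lemma trace_ext_0: "trace_ext 0 x = 1"
proof -
  have "{F. F \<subseteq> E \<and> finite F \<and> card F = 0} = {{}}" by auto
  then show ?thesis by (simp add: trace_ext_def minor_def det_on_def)
qed

lemma tau_near_one: "\<exists>\<delta>>0. \<forall>z x. norm z < \<delta> \<longrightarrow> 0 < x \<longrightarrow> norm (tau z x - 1) \<le> 1 / 4"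
proof -
  obtain K where K: "0 \<le> K" "\<And>k x. 0 \<le> x \<Longrightarrow> norm (trace_ext k x) \<le> K"
    using trace_ext_bound[of 1] by auto
  have le: "norm (tau z x - 1) \<le> 1 / 4" if z: "norm z < 1 / (8 * (K + 1))" and x: "0 < x" for z x
  proof -
    have "1 / (8 * (K + 1)) \<le> 1 / 8" using K by (intro divide_left_mono) auto
    then have z2: "norm z < 1 / 2" using z by linarith
    have z3: "8 * K * norm z \<le> 1"
    proof -
      have "norm z * (8 * (K + 1)) < 1" using z K by (simp add: field_simps)
      then have "8 * K * norm z + 8 * norm z < 1" by (simp add: algebra_simps)
      then show ?thesis using norm_ge_zero[of z] by linarith
    qed
    have nth: "fps_nth (tau_fps x) k = trace_ext k x" for k by (simp add: tau_fps_def)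
    have summ: "summable (\<lambda>k. trace_ext k x * z ^ k)"
      using summable_norm_cancel[OF rapidly_decreasing_summable[OF tau_fps_rapid x, of z]] by (simp only: nth)
    have "tau z x - 1 = (\<Sum>k. trace_ext (Suc k) x * z ^ Suc k)"
      unfolding tau_def eval_fps_def nth using suminf_split_head[OF summ] by (simp add: trace_ext_0)
    also have "norm \<dots> \<le> (\<Sum>k. (K * norm z) * (1 / 2) ^ k)"
    proof (rule norm_suminf_le)
      show "summable (\<lambda>k. (K * norm z) * (1 / 2 :: real) ^ k)" by (intro summable_mult summable_geometric) simp
      fix k
      have "norm (trace_ext (Suc k) x * z ^ Suc k) \<le> K * (norm z * (1 / 2) ^ k)"
        unfolding norm_mult norm_power power_Suc using K x z2
        by (intro mult_mono power_mono mult_nonneg_nonneg) auto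
      then show "norm (trace_ext (Suc k) x * z ^ Suc k) \<le> (K * norm z) * (1 / 2) ^ k" by (simp only: mult.assoc)
    qed
    also have "\<dots> = 2 * (K * norm z)"
      by (subst suminf_mult) (auto simp: summable_geometric suminf_geometric)
    also have "\<dots> \<le> 1 / 4" using z3 by simp
    finally show ?thesis .
  qed
  show ?thesis by (rule exI[of _ "1 / (8 * (K + 1))"]) (use K le in auto)
qed

text \<open>The power series of the resolvent may have a finite radius of convergence, whence the bound
  on \<open>z\<close>.\<close>

lemma tau'_eq_GL:
  assumes x: "0 < x" and q: "norm z * (M\<^sup>2 + 1) < 1"
  shows "tau' z x = z * tau z x * GL z x x"
proof -
  define r where "r = 1 / (M\<^sup>2 + 1)"
  have M1: "0 < M\<^sup>2 + 1" by (simp add: add_nonneg_pos)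
  have r: "0 < r" "norm z < r" using M1 q by (auto simp: r_def field_simps)
  have "r * M\<^sup>2 < 1" using M1 by (simp add: r_def field_simps)
  then have rM: "norm (of_real r :: complex) * M\<^sup>2 < 1" using r(1) by (simp only: norm_of_real abs_of_pos)
  have nth: "fps_nth (resolvent_fps x) k * y ^ k = (- y) ^ k * C (S x ((R x ^^ k) (S x b)))" for k y
    by (simp add: resolvent_fps_def resolvent_coeff_def power_minus[of y])
  have "summable (\<lambda>k. fps_nth (resolvent_fps x) k * of_real r ^ k)"
    unfolding nth using x by (intro resolvent_summable rM) simp
  then have "ereal (norm (of_real r :: complex)) \<le> conv_radius (fps_nth (resolvent_fps x))"
    by (rule conv_radius_geI)
  then have "ereal r \<le> fps_conv_radius (resolvent_fps x)"
    using r by (simp add: fps_conv_radius_def)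
  then have radius: "norm z < fps_conv_radius (resolvent_fps x)"
    using r(2) by (metis less_ereal.simps(1) order.strict_trans2)
  have "eval_fps (resolvent_fps x) z = - GL z x x"
    unfolding eval_fps_def nth GL_def resolvent_def by simp
  moreover have "eval_fps (rate_fps x) z = z * tau z x * eval_fps (resolvent_fps x) z"
  proof -
    have tau_r: "norm z < fps_conv_radius (tau_fps x)"
      by (rule rapidly_decreasing_conv_radius[OF tau_fps_rapid x])
    have "norm z < fps_conv_radius (fps_X * tau_fps x)"
      using tau_r by (intro order.strict_trans2[OF _ fps_conv_radius_mult]) simp
    then show ?thesis
      using x tau_r radius by (simp add: rate_fps_eq eval_fps_mult tau_def)
  qed
  ultimately show ?thesis by (simp add: tau'_def)
qed

end

text \<open>Near \<open>1\<close>, products and quotients stay in the domain where the principal branch is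
  differentiable.\<close>

lemma Ln_product_quotient:
  fixes f g :: "real \<Rightarrow> complex"
  assumes f: "(f has_vector_derivative f') (at x)" and g: "(g has_vector_derivative g') (at x)"
    and near: "norm (f x - 1) \<le> 1 / 4" "norm (g x - 1) \<le> 1 / 4"
  shows "f x \<noteq> 0" "g x \<noteq> 0"
    and "((\<lambda>t. Ln (f t * g t)) has_vector_derivative f' / f x + g' / g x) (at x)"
    and "((\<lambda>t. Ln (f t / g t)) has_vector_derivative f' / f x - g' / g x) (at x)"
proof -
  show f0: "f x \<noteq> 0" and g0: "g x \<noteq> 0" using near by auto
  have right: "w \<notin> \<real>\<^sub>\<le>\<^sub>0" if "norm (w - 1) < 1" for w :: complex
  proof
    assume "w \<in> \<real>\<^sub>\<le>\<^sub>0"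
    then have "Re w \<le> 0" by (auto simp: complex_nonpos_Reals_iff)
    then have "1 \<le> norm (w - 1)" using abs_Re_le_cmod[of "w - 1"] by simp
    then show False using that by simp
  qed
  have inv: "((\<lambda>t. inverse (g t)) has_vector_derivative g' * (- inverse (g x * g x))) (at x)"
    using field_vector_diff_chain_at[OF g, of inverse "- inverse (g x * g x)"] DERIV_inverse[OF g0] 
    by (simp add: o_def power2_eq_square numeral_2_eq_2)
  have mult: "norm (f x * g x - 1) < 1"
  proof -
    have "f x * g x - 1 = (f x - 1) * (g x - 1) + (f x - 1) + (g x - 1)" by (simp add: algebra_simps)
    also have "norm \<dots> \<le> norm (f x - 1) * norm (g x - 1) + norm (f x - 1) + norm (g x - 1)"
      by (metis norm_mult norm_triangle_ineq norm_triangle_mono order_refl)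
    also have "\<dots> \<le> (1/4) * (1/4) + 1/4 + 1/4" using near by (intro add_mono mult_mono) auto
    finally show ?thesis by simp
  qed
  have quot: "norm (f x / g x - 1) < 1"
  proof -
    have "norm (f x - g x) \<le> 1/2" using near norm_triangle_ineq4[of "f x - 1" "g x - 1"] by simp
    moreover have "3/4 \<le> norm (g x)" using near(2) norm_triangle_ineq2[of 1 "1 - g x"] by (simp add: norm_minus_commute)
    moreover have "f x / g x - 1 = (f x - g x) / g x" using g0 by (simp add: field_simps)
    ultimately show ?thesis using g0 by (simp add: norm_divide divide_less_eq)
  qed
  show "((\<lambda>t. Ln (f t * g t)) has_vector_derivative f' / f x + g' / g x) (at x)"
    using field_vector_diff_chain_at[OF has_vector_derivative_mult[OF f g] has_field_derivative_Ln[OF right[OF mult]]] f0 g0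
    by (simp add: o_def field_simps)
  have "f x * inverse (g x) \<notin> \<real>\<^sub>\<le>\<^sub>0" using right[OF quot] by (simp add: divide_inverse)
  from field_vector_diff_chain_at[OF has_vector_derivative_mult[OF f inv] has_field_derivative_Ln[OF this]]
  have "((\<lambda>t. Ln (f t / g t)) has_vector_derivative
      (f x * (g' * - inverse (g x * g x)) + f' * inverse (g x)) * inverse (f x * inverse (g x))) (at x)"
    by (simp only: o_def divide_inverse)
  then show "((\<lambda>t. Ln (f t / g t)) has_vector_derivative f' / f x - g' / g x) (at x)"
    by (rule has_vector_derivative_eq_rhs) (use f0 g0 in \<open>simp add: field_simps\<close>)
qed

context scalar_system_basis
begin

text \<open>The logarithmic derivatives of \<open>\<tau>(\<mu>)\<close> and \<open>\<tau>(- \<mu>)\<close> are \<open>\<mu> GL\<^sub>\<mu>(x,x)\<close> and \<open>- \<mu> GL\<^bsub>-\<mu>\<^esub>(x,x)\<close>.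
  The function \<open>GL\<close> itself need not be differentiable on the diagonal, but \<open>W = H / (2 \<mu> \<tau>(\<mu>)
  \<tau>(- \<mu>))\<close> is, where \<open>H\<close> is the derivative of the product \<open>\<tau>(\<mu>) \<tau>(- \<mu>)\<close>.\<close>

lemma diagonal_identities:
  fixes \<mu> :: complex
  assumes x: "0 < x" and \<mu>: "\<mu> \<noteq> 0" and q: "norm \<mu> * (M\<^sup>2 + 1) < 1"
    and near: "\<And>z t. norm z = norm \<mu> \<Longrightarrow> 0 < t \<Longrightarrow> norm (tau z t - 1) \<le> 1 / 4"
  defines "W \<equiv> \<lambda>t. (GL \<mu> t t - GL (- \<mu>) t t) / 2" and "V \<equiv> \<lambda>t. (GL \<mu> t t + GL (- \<mu>) t t) / 2"
  shows "tau \<mu> x \<noteq> 0" "tau (- \<mu>) x \<noteq> 0"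
    and "((\<lambda>t. 1 / (2 * \<mu>) * Ln (tau \<mu> t * tau (- \<mu>) t)) has_vector_derivative W x) (at x)"
    and "((\<lambda>t. 1 / (2 * \<mu>) * Ln (tau \<mu> t / tau (- \<mu>) t)) has_vector_derivative V x) (at x)"
    and "(W has_vector_derivative - (2 * \<mu>) * (V x)\<^sup>2) (at x)"
proof -
  let ?f = "tau \<mu>" and ?g = "tau (- \<mu>)"
  have q': "norm (- \<mu>) * (M\<^sup>2 + 1) < 1" using q by simp
  have near_f: "norm (?f t - 1) \<le> 1 / 4" and near_g: "norm (?g t - 1) \<le> 1 / 4" if "0 < t" for t
    using near[of \<mu> t] near[of "- \<mu>" t] that by auto
  note f = tau_has_vector_derivative[of _ \<mu>] and g = tau_has_vector_derivative[of _ "- \<mu>"]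
  note Ln = Ln_product_quotient[OF f g near_f near_g]
  have nz: "?f t \<noteq> 0" "?g t \<noteq> 0" if "0 < t" for t using Ln(1,2)[of t] that by auto
  show "?f x \<noteq> 0" "?g x \<noteq> 0" using nz x by auto
  have f': "tau' \<mu> t = \<mu> * ?f t * GL \<mu> t t" and g': "tau' (- \<mu>) t = - \<mu> * ?g t * GL (- \<mu>) t t" if "0 < t" for t
    using tau'_eq_GL[OF that q] tau'_eq_GL[OF that q'] by auto
  have quot_f: "tau' \<mu> x / ?f x = \<mu> * GL \<mu> x x" and quot_g: "tau' (- \<mu>) x / ?g x = - \<mu> * GL (- \<mu>) x x"
    using nz[OF x] f'[OF x] g'[OF x] by auto
  show "((\<lambda>t. 1 / (2 * \<mu>) * Ln (?f t * ?g t)) has_vector_derivative W x) (at x)"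
    by (rule has_vector_derivative_eq_rhs[OF has_vector_derivative_mult_right[OF Ln(3)[OF x x x x]]])
      (use \<mu> in \<open>simp add: quot_f quot_g W_def field_simps\<close>)
  show "((\<lambda>t. 1 / (2 * \<mu>) * Ln (?f t / ?g t)) has_vector_derivative V x) (at x)"
    by (rule has_vector_derivative_eq_rhs[OF has_vector_derivative_mult_right[OF Ln(4)[OF x x x x]]])
      (use \<mu> in \<open>simp add: quot_f quot_g V_def field_simps\<close>)
  define H where "H t = ?f t * tau' (- \<mu>) t + tau' \<mu> t * ?g t" for t
  have H_eq: "H t = 2 * \<mu> * W t * (?f t * ?g t)" if "0 < t" for t
    unfolding H_def f'[OF that] g'[OF that] W_def by (simp add: algebra_simps)
  have dH: "(H has_vector_derivative 4 * (tau' \<mu> x * tau' (- \<mu>) x)) (at x)"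
    unfolding H_def[abs_def] by (rule toda_integrated[OF x])
  have dfg: "((\<lambda>t. ?f t * ?g t) has_vector_derivative H x) (at x)"
    unfolding H_def by (intro has_vector_derivative_mult f g x)
  have fg0: "?f x * ?g x \<noteq> 0" using nz[OF x] by simp
  have inv: "((\<lambda>t. inverse (?f t * ?g t)) has_vector_derivative H x * (- inverse ((?f x * ?g x) * (?f x * ?g x)))) (at x)"
    using field_vector_diff_chain_at[OF dfg, of inverse "- inverse ((?f x * ?g x) * (?f x * ?g x))"] DERIV_inverse[OF fg0]
    by (simp add: o_def power2_eq_square numeral_2_eq_2)
  have "((\<lambda>t. 1 / (2 * \<mu>) * (H t * inverse (?f t * ?g t))) has_vector_derivative
      1 / (2 * \<mu>) * (H x * (H x * (- inverse ((?f x * ?g x) * (?f x * ?g x)))) + 4 * (tau' \<mu> x * tau' (- \<mu>) x) * inverse (?f x * ?g x))) (at x)"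
    by (intro has_vector_derivative_mult_right has_vector_derivative_mult dH inv)
  moreover have "1 / (2 * \<mu>) * (H x * (H x * (- inverse ((?f x * ?g x) * (?f x * ?g x)))) + 4 * (tau' \<mu> x * tau' (- \<mu>) x) * inverse (?f x * ?g x))
      = - (2 * \<mu>) * (V x)\<^sup>2"
  proof -
    have "H x * (H x * (- inverse ((?f x * ?g x) * (?f x * ?g x)))) = - (4 * \<mu>\<^sup>2 * (W x)\<^sup>2)"
      unfolding H_eq[OF x] using nz[OF x] by (simp add: field_simps power2_eq_square)
    moreover have "4 * (tau' \<mu> x * tau' (- \<mu>) x) * inverse (?f x * ?g x) = - (4 * \<mu>\<^sup>2 * (GL \<mu> x x * GL (- \<mu>) x x))"
      unfolding f'[OF x] g'[OF x] using nz[OF x] by (simp add: field_simps power2_eq_square)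
    moreover have "(W x)\<^sup>2 + GL \<mu> x x * GL (- \<mu>) x x = (V x)\<^sup>2"
      by (simp add: W_def V_def power2_eq_square field_simps)
    ultimately have "H x * (H x * (- inverse ((?f x * ?g x) * (?f x * ?g x)))) + 4 * (tau' \<mu> x * tau' (- \<mu>) x) * inverse (?f x * ?g x)
        = - (4 * \<mu>\<^sup>2 * (V x)\<^sup>2)"
      by (metis add.commute distrib_left minus_add_distrib)
    then show ?thesis using \<mu> by (simp add: power2_eq_square)
  qed
  ultimately have "((\<lambda>t. 1 / (2 * \<mu>) * (H t * inverse (?f t * ?g t))) has_vector_derivative - (2 * \<mu>) * (V x)\<^sup>2) (at x)"
    by simp
  then show "(W has_vector_derivative - (2 * \<mu>) * (V x)\<^sup>2) (at x)"
  proof (rule has_vector_derivative_transform_within_open[of _ _ _ "{0<..}"])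
    fix t :: real assume "t \<in> {0<..}"
    then have t: "0 < t" by simp
    show "1 / (2 * \<mu>) * (H t * inverse (?f t * ?g t)) = W t"
      unfolding H_eq[OF t] using \<mu> nz[OF t] by (simp add: field_simps)
  qed (use x in auto)
qed

lemma fredholm_det_tau:
  assumes E: "E = (SOME E. orthonormal_basis E)" and T: "\<And>h. T h = z *\<^sub>C R x h"
  shows "fredholm_det_1_plus T = tau z x"
proof -
  have "principal_minor T F = minor x F * z ^ card F" if "finite F" for F
    using det_on_scale[OF that, of "\<lambda>_. z" "kern x"]
    by (simp add: principal_minor_det_on T cinner_scaleC_right minor_def kern_def[abs_def] mult.commute)
  then have "trace_exterior_power k T = trace_ext k x * z ^ k" for k
    unfolding trace_exterior_power_def Let_def E[symmetric] trace_ext_def infsum_cmult_left'[symmetric]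
    by (intro infsum_cong) auto
  then show ?thesis
    by (simp add: fredholm_det_1_plus_def tau_def eval_fps_def tau_fps_def)
qed

end

section \<open>Tau functions of an admissible system\<close>

theorem theorem3p2:
  fixes D :: "'a::{complex_hilbert, second_countable_topology} set"
    and A :: "'a \<Rightarrow> 'a"
    and S :: "real \<Rightarrow> 'a \<Rightarrow> 'a"
    and B :: "complex \<Rightarrow> 'a"
    and C :: "'a \<Rightarrow> complex"
  assumes "admissible22 D A S B C"
  shows "(\<exists>\<delta>>0. \<forall>\<mu>::complex. norm \<mu> < \<delta> \<longrightarrow>
            (\<exists>W V. gelfand_levitan_solution (phi S B C) \<mu> W V \<and>
              (\<mu> \<noteq> 0 \<longrightarrow> (\<forall>x>0.
                tau_inf S B C \<mu> x \<noteq> 0 \<and> tau_0 S B C \<mu> x \<noteq> 0 \<and>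
                ((\<lambda>t. 1 / (2 * \<mu>) * Ln (tau_inf S B C \<mu> t * tau_0 S B C \<mu> t))
                   has_vector_derivative W x x) (at x) \<and>
                ((\<lambda>t. 1 / (2 * \<mu>) * Ln (tau_inf S B C \<mu> t / tau_0 S B C \<mu> t))
                   has_vector_derivative V x x) (at x) \<and>
                (\<lambda>t. W t t) differentiable (at x) \<and>
                1 / (2 * \<mu>) * ddx (\<lambda>t. W t t) x = - (V x x)\<^sup>2))))
       \<and> (\<forall>\<mu>::complex.
            C1_halfline (tau_inf S B C \<mu>) \<and> C1_halfline (tau_0 S B C \<mu>) \<and>
            toda_pointwise (tau_0 S B C \<mu>) (tau_inf S B C \<mu>) \<and>
            toda_distributional (tau_0 S B C \<mu>) (tau_inf S B C \<mu>))"
proof -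
  obtain L M where "scalar_system S (B 1) C L M"
    using admissible22_imp_scalar_system[OF assms] by blast
  then interpret scalar_system S "B 1" C L M .
  define E :: "'a set" where "E = (SOME E. orthonormal_basis E)"
  have E_basis: "orthonormal_basis E"
    unfolding E_def by (rule someI_ex[OF orthonormal_basis_exists])
  obtain G where G: "\<And>n. finite (G n)" "\<And>n. G n \<subseteq> E" "incseq G" "(\<Union>n. G n) = E"
    using countable_exhaustion[OF orthonormal_imp_countable[OF orthonormal_basisD(1)[OF E_basis]]] by metis
  interpret scalar_system_basis S "B 1" C L M E G
    by unfold_locales (fact E_basis G)+
  have Bc: "bounded_clinear B" using assms by (simp add: admissible22_def linear_system_def)
  have SB: "S t (B z) = z *\<^sub>C S t (B 1)" if "0 \<le> t" for t z
    using bounded_clinear_scaleC[OF Bc, of z 1] bounded_clinear_scaleC[OF S_clinear[OF that], of z "B 1"]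
    by (simp add: scaleC_complex_def)
  have R_eq: "R_op S B C x h = R x h" if "0 \<le> x" for x h
    unfolding R_op_def R_def set_lebesgue_integral_def
  proof (intro Bochner_Integration.integral_cong refl)
    fix t
    show "indicator {x<..} t *\<^sub>R S t (B (C (S t h))) = indicator {x<..} t *\<^sub>R C (S t h) *\<^sub>C S t (B 1)"
    proof (cases "x < t")
      case True
      then show ?thesis using that SB[of t "C (S t h)"] by simp
    qed simp
  qed
  have tau_inf: "tau_inf S B C \<mu> x = tau \<mu> x" if "0 < x" for \<mu> x
    unfolding tau_inf_def using that by (intro fredholm_det_tau[OF E_def]) (simp add: R_eq)
  have tau_0: "tau_0 S B C \<mu> x = tau (- \<mu>) x" if "0 < x" for \<mu> x
    unfolding tau_0_def using that by (intro fredholm_det_tau[OF E_def]) (simp add: R_eq scaleC_minus_left)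
  have phi: "phi S B C = (\<lambda>x. C (S x (B 1)))" by (auto simp: phi_def)
  have deriv_inf: "(tau_inf S B C \<mu> has_vector_derivative tau' \<mu> x) (at x)" if "0 < x" for \<mu> x
    by (rule has_vector_derivative_transform_within_open[OF tau_has_vector_derivative[OF that], of "{0<..}"])
      (use that tau_inf in auto)
  have deriv_0: "(tau_0 S B C \<mu> has_vector_derivative tau' (- \<mu>) x) (at x)" if "0 < x" for \<mu> x
    by (rule has_vector_derivative_transform_within_open[OF tau_has_vector_derivative[OF that], of "{0<..}"])
      (use that tau_0 in auto)
  have integrated: "((\<lambda>x. tau_inf S B C \<mu> x * tau' (- \<mu>) x + tau' \<mu> x * tau_0 S B C \<mu> x) has_vector_derivative
      4 * (tau' \<mu> x * tau' (- \<mu>) x)) (at x)" if "0 < x" for \<mu> x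
    by (rule has_vector_derivative_transform_within_open[OF toda_integrated[OF that], of "{0<..}"])
      (use that tau_inf tau_0 in auto)
  have integrated': "((\<lambda>x. tau_0 S B C \<mu> x * tau' \<mu> x + tau' (- \<mu>) x * tau_inf S B C \<mu> x) has_vector_derivative
      4 * (tau' (- \<mu>) x * tau' \<mu> x)) (at x)" if "0 < x" for \<mu> x
    using integrated[OF that, of \<mu>] by (simp add: mult.commute add.commute)
  note toda = toda_of_integrated[OF deriv_inf tau'_continuous deriv_0 tau'_continuous integrated]
  note toda' = toda_of_integrated[OF deriv_0 tau'_continuous deriv_inf tau'_continuous integrated']
  obtain \<delta>\<^sub>1 where \<delta>\<^sub>1: "\<delta>\<^sub>1 > 0" "\<And>z x. norm z < \<delta>\<^sub>1 \<Longrightarrow> 0 < x \<Longrightarrow> norm (tau z x - 1) \<le> 1 / 4"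
    using tau_near_one by blast
  \<comment> \<open>The first bound keeps the tau functions near \<open>1\<close>, the second makes the Neumann series converge.\<close>
  define \<delta> where "\<delta> = min \<delta>\<^sub>1 (1 / (M\<^sup>2 + 1))"
  have M1: "0 < M\<^sup>2 + 1" by (simp add: add_nonneg_pos)
  have "\<delta> > 0" using \<delta>\<^sub>1(1) M1 by (simp add: \<delta>_def)
  moreover have "\<exists>W V. gelfand_levitan_solution (phi S B C) \<mu> W V \<and>
      (\<mu> \<noteq> 0 \<longrightarrow> (\<forall>x>0.
        tau_inf S B C \<mu> x \<noteq> 0 \<and> tau_0 S B C \<mu> x \<noteq> 0 \<and>
        ((\<lambda>t. 1 / (2 * \<mu>) * Ln (tau_inf S B C \<mu> t * tau_0 S B C \<mu> t)) has_vector_derivative W x x) (at x) \<and>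
        ((\<lambda>t. 1 / (2 * \<mu>) * Ln (tau_inf S B C \<mu> t / tau_0 S B C \<mu> t)) has_vector_derivative V x x) (at x) \<and>
        (\<lambda>t. W t t) differentiable (at x) \<and>
        1 / (2 * \<mu>) * ddx (\<lambda>t. W t t) x = - (V x x)\<^sup>2))"
    if \<mu>: "norm \<mu> < \<delta>" for \<mu> :: complex
  proof -
    have q: "norm \<mu> * (M\<^sup>2 + 1) < 1" using \<mu> M1 by (simp add: \<delta>_def field_simps)
    have q': "norm \<mu> * M\<^sup>2 < 1" using q norm_ge_zero[of \<mu>] unfolding distrib_left by linarith
    define W where "W x y = (GL \<mu> x y - GL (- \<mu>) x y) / 2" for x y
    define V where "V x y = (GL \<mu> x y + GL (- \<mu>) x y) / 2" for x y
    have "gelfand_levitan_solution (phi S B C) \<mu> W V"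
      unfolding phi W_def[abs_def] V_def[abs_def] by (rule gelfand_levitan_GL[OF q'])
    moreover have "tau_inf S B C \<mu> x \<noteq> 0 \<and> tau_0 S B C \<mu> x \<noteq> 0 \<and>
        ((\<lambda>t. 1 / (2 * \<mu>) * Ln (tau_inf S B C \<mu> t * tau_0 S B C \<mu> t)) has_vector_derivative W x x) (at x) \<and>
        ((\<lambda>t. 1 / (2 * \<mu>) * Ln (tau_inf S B C \<mu> t / tau_0 S B C \<mu> t)) has_vector_derivative V x x) (at x) \<and>
        (\<lambda>t. W t t) differentiable (at x) \<and>
        1 / (2 * \<mu>) * ddx (\<lambda>t. W t t) x = - (V x x)\<^sup>2"
      if \<mu>0: "\<mu> \<noteq> 0" and x: "0 < x" for x
    proof -
      have near: "norm (tau z t - 1) \<le> 1 / 4" if "norm z = norm \<mu>" "0 < t" for z t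
        using \<delta>\<^sub>1(2)[of z t] that \<mu> by (simp add: \<delta>_def)
      note diag = diagonal_identities[OF x \<mu>0 q near, folded W_def V_def]
      have dW: "((\<lambda>t. W t t) has_vector_derivative - (2 * \<mu>) * (V x x)\<^sup>2) (at x)"
        using diag(5) by simp
      have "((\<lambda>t. 1 / (2 * \<mu>) * Ln (tau_inf S B C \<mu> t * tau_0 S B C \<mu> t)) has_vector_derivative W x x) (at x)"
        by (rule has_vector_derivative_transform_within_open[OF diag(3), of "{0<..}"]) (use x tau_inf tau_0 in auto)
      moreover have "((\<lambda>t. 1 / (2 * \<mu>) * Ln (tau_inf S B C \<mu> t / tau_0 S B C \<mu> t)) has_vector_derivative V x x) (at x)"
        by (rule has_vector_derivative_transform_within_open[OF diag(4), of "{0<..}"]) (use x tau_inf tau_0 in auto)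
      moreover have "(\<lambda>t. W t t) differentiable (at x)" by (rule differentiableI_vector[OF dW])
      moreover have "1 / (2 * \<mu>) * ddx (\<lambda>t. W t t) x = - (V x x)\<^sup>2"
        unfolding vector_derivative_at[OF dW] using \<mu>0 by simp
      ultimately show ?thesis using diag(1,2) tau_inf[OF x] tau_0[OF x] by simp
    qed
    ultimately show ?thesis by blast
  qed
  ultimately show ?thesis using toda toda'(3) by blast
qed

end
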